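(* Let $q$ be a power of a prime $p$, and pick any $a,b,c,d\in\mathbb{F}_{q^2}$. Then $f(X) := aX^{3q} + bX^{2q+1} + cX^{q+2} + d X^3$ is a complete mapping of $\mathbb{F}_{q^2}$ if and only if one of the following holds: (1) $f(X)$ is $\mathbb{F}_q$-linearly conjugate to $\gamma X^{q+2}$ for some $\gamma\in\mathbb{F}_{q^2}^*$ with $\gamma^{2q-2}-\gamma^{q-1}+1=0$; (2) $q\equiv 0\pmod 3$ and $f(X)=aX^{3q}+dX^3$ where $a^{q+1}\ne d^{q+1}$ and $aX^{3q-1}+dX^2+1$ has no roots in $\mathbb{F}_{q^2}^*$.
   Context: A complete mapping of a field $F$ is a permutation $\pi$ of $F$ such that $x\mapsto \pi(x)+x$ also permutes $F$; a polynomial is called a complete mapping if the function it induces is one. Polynomials $f,g\in\mathbb{F}_{q^2}[X]$ are $\mathbb{F}_q$-linearly conjugate if the induced functions on $\mathbb{F}_{q^2}$ satisfy $f=\rho^{-1}\circ g\circ\rho$ for some $\mathbb{F}_q$-vector space automorphism $\rho$ of $\mathbb{F}_{q^2}$; equivalently, there exist $a,b\in\mathbb{F}_{q^2}$ with $a^{q+1}\ne b^{q+1}$ such that, with $L(X):=aX^q+bX$ and $L^{-1}(X):=(aX^q-b^qX)/(a^{q+1}-b^{q+1})$, one has $f(X)\equiv L^{-1}(X)\circ g(X)\circ L(X)\pmod{X^{q^2}-X}$. *)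

theory Defs
  imports "HOL-Computational_Algebra.Primes" "HOL-Library.Cardinality"
begin

text \<open>The field F_{q^2} is modelled as a finite field type 'a with CARD('a) = q^2.\<close>

definition prime_power :: "nat \<Rightarrow> bool" where
  "prime_power q \<longleftrightarrow> (\<exists>p k. prime p \<and> k > 0 \<and> q = p ^ k)"

definition complete_mapping :: "('a::field \<Rightarrow> 'a) \<Rightarrow> bool" where
  "complete_mapping f \<longleftrightarrow> bij f \<and> bij (\<lambda>x. f x + x)"

text \<open>F_q-linear conjugacy of (the functions induced by) polynomials over F_{q^2},
  via L(X) = a X^q + b X and its inverse, as in the paper.\<close>
definition lin_conj :: "nat \<Rightarrow> ('a::field \<Rightarrow> 'a) \<Rightarrow> ('a \<Rightarrow> 'a) \<Rightarrow> bool" where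
  "lin_conj q f g \<longleftrightarrow> (\<exists>a b :: 'a. a ^ (q + 1) \<noteq> b ^ (q + 1) \<and>
     (\<forall>x. f x = (let y = g (a * x ^ q + b * x) in
                  (a * y ^ q - b ^ q * y) / (a ^ (q + 1) - b ^ (q + 1)))))"

end

theory Submission
  imports Defs "HOL-Computational_Algebra.Polynomial"
begin

text \<open>
  Over the subfield \<open>K\<close> with \<open>q\<close> elements, the map \<open>f\<close> is a homogeneous cubic map of a plane. Let
  \<open>f (X e1 + Y e2) = P e1 + R e2\<close> in some \<open>K\<close>-basis, with
  \<open>P = P0 X^3 + P1 X^2 Y + P2 X Y^2 + P3 Y^3\<close>. If \<open>f\<close> is a complete mapping then
  \<open>P2^2 = 3 P1 P3\<close>. For \<open>p = 2\<close> this holds because every map \<open>f x + t x\<close> with \<open>t\<close> in \<open>K\<close> is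
  injective. For odd \<open>p\<close>
  it follows from the vanishing of the sum of \<open>(P + X)^n\<close> over \<open>K \<times> K\<close>, where \<open>n\<close> is chosen with equal
  digits in base \<open>p\<close>, so that one coefficient of a polynomial of degree \<open>2 p - 2\<close> decides the sum.
  As this holds in every basis, it amounts to five quadratic equations for the coefficients of \<open>f\<close>.

  If \<open>p \<noteq> 3\<close> these equations force \<open>f\<close> to be, in a suitable basis, the product of
  \<open>X^2 + X Y + Y^2\<close> and a linear map, which is the map \<open>\<gamma> x^(q+2)\<close> in disguise. If \<open>p = 3\<close> they say that
  \<open>f\<close> is additive or is determined by a quartic form \<open>H\<close> such that a fixed multiple of \<open>H\<close>
  takes only nonsquare values. By Stepanov's method \<open>H\<close> is then a multiple of the square of an irreducible quadratic
  form, and \<open>f\<close> is again conjugate to \<open>\<gamma> x^(q+2)\<close>.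
\<close>

subsection \<open>Finite fields of square order\<close>

text \<open>A single coordinate carries enough information for power sums. If \<open>(P, R)\<close>
  permutes \<open>K \<times> K\<close>, every value of \<open>P\<close> is taken \<open>q\<close>
  times, and \<open>q = 0\<close> in the field, so any function of \<open>P\<close> sums to zero;
  the same holds for \<open>P + X\<close>. Degrees decide which terms survive: a monomial needs both
  exponents to be positive multiples of \<open>q - 1\<close>.

  The quantity \<open>P2^2 - 3 P1 P3\<close> is one coefficient of the Hessian covariant of
  \<open>P\<close>. Replacing \<open>e2\<close> by \<open>e2 - v e1\<close> replaces
  \<open>P\<close> by \<open>P + v R\<close>, up to a substitution, so the condition becomes a
  polynomial of degree at most 4 in \<open>v\<close>, whose five coefficients are the five
  equations. They can be separated only if \<open>q > 4\<close>. As cubing must be injective on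
  \<open>K\<close>, \<open>q\<close> is 2 modulo 3 when \<open>p \<noteq> 3\<close>, and only
  \<open>q = 2\<close> is left to be treated by hand.

  In characteristic 3 the condition degenerates to \<open>P2 = 0\<close>, which leaves more freedom;
  the existence and uniqueness of a root line of \<open>P\<close> then supply the missing
  information in the form of nonsquare values. Stepanov's method needs \<open>q > 6\<close>, so
  \<open>q = 3\<close> is separate.\<close>

lemma card_power_eq_one_le:
  fixes n :: nat
  assumes "n > 0"
  shows "card {x::'a::{idom,finite}. x ^ n = 1} \<le> n"
proof -
  let ?P = "monom 1 n - 1 :: 'a poly"
  have "coeff ?P n = 1" using assms by (simp add: coeff_1)
  then have "?P \<noteq> 0" by force
  then have "card {x. poly ?P x = 0} \<le> degree ?P" by (rule card_poly_roots_bound)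
  also have "\<dots> \<le> n" by (intro degree_diff_le) (auto simp: degree_monom_le)
  finally show ?thesis by (simp add: poly_monom)
qed

lemma of_nat_CARD_eq_0: "of_nat CARD('a) = (0::'a::{finite,field})"
proof -
  have "(\<Sum>x\<in>(UNIV::'a set). x + 1) = (\<Sum>x\<in>(UNIV::'a set). x)"
    by (rule sum.reindex_bij_witness[of _ "\<lambda>x. x - 1" "\<lambda>x. x + 1"]) auto
  then show ?thesis by (simp add: sum.distrib)
qed

lemma power_CARD_eq_same: "(x::'a::{finite,field}) ^ CARD('a) = x"
proof (cases "x = 0")
  case False
  have "(\<Prod>y\<in>UNIV-{0}. x * y) = x ^ (CARD('a) - 1) * \<Prod>(UNIV-{0})"
    by (simp add: prod.distrib)
  moreover have "(\<Prod>y\<in>UNIV-{0}. x * y) = (\<Prod>y\<in>UNIV-{0}. y)"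
    by (rule prod.reindex_bij_witness[of _ "\<lambda>y. y / x" "\<lambda>y. x * y"]) (use False in auto)
  ultimately have "x ^ (CARD('a) - 1) = 1" by simp
  then show ?thesis
    by (metis One_nat_def Suc_pred finite_UNIV_card_ge_0 finite mult.right_neutral power_Suc)
qed simp

locale quadratic_extension =
  fixes q p k :: nat and K :: "'a::{finite,field} set"
  assumes prime_p: "prime p" and k_pos: "k > 0" and q_eq: "q = p ^ k"
    and CARD_eq: "CARD('a) = q\<^sup>2" and K_def: "K = {x. x ^ q = x}"
begin

lemma q_ge_2: "q \<ge> 2"
  using prime_gt_1_nat[OF prime_p] k_pos self_le_power[of p k] unfolding q_eq by linarith

lemma CHAR_eq: "CHAR('a) = p"
proof -
  have pos: "CHAR('a) > 0" by (rule finite_imp_CHAR_pos) simp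
  then have "prime CHAR('a)" by (rule prime_CHAR_semidom)
  moreover have "CHAR('a) dvd p ^ (k * 2)"
    using of_nat_CARD_eq_0[where 'a='a] unfolding of_nat_eq_0_iff_char_dvd CARD_eq q_eq
    by (simp add: power_mult)
  ultimately show ?thesis
    using prime_p by (metis prime_dvd_power primes_dvd_imp_eq)
qed

lemma of_nat_eq_0_iff: "of_nat n = (0::'a) \<longleftrightarrow> p dvd n"
  by (simp add: of_nat_eq_0_iff_char_dvd CHAR_eq)

lemma of_nat_q: "of_nat q = (0::'a)"
  using k_pos by (simp add: of_nat_eq_0_iff q_eq)

lemma frob_add: "(x + y :: 'a) ^ q = x ^ q + y ^ q"
  using freshmans_dream'[of q k x y] prime_p by (simp add: CHAR_eq q_eq)

lemma frob_minus: "(- x :: 'a) ^ q = - (x ^ q)"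
proof -
  have "(- x + x) ^ q = (- x) ^ q + x ^ q" by (rule frob_add)
  then show ?thesis using q_ge_2 by (simp add: power_0_left eq_neg_iff_add_eq_0)
qed

lemma frob_diff: "(x - y :: 'a) ^ q = x ^ q - y ^ q"
  using frob_add[of x "- y"] by (simp add: frob_minus)

lemma frob_frob: "((x::'a) ^ q) ^ q = x"
  using power_CARD_eq_same[of x] by (simp add: CARD_eq power2_eq_square power_mult)

lemmas frob_simps = frob_add frob_minus frob_diff frob_frob power_mult_distrib power_divide

lemma frob_power: "((x::'a) ^ n) ^ q = (x ^ q) ^ n"
  by (metis mult.commute power_mult)

lemma in_K_iff: "x \<in> K \<longleftrightarrow> x ^ q = x"
  by (simp add: K_def)

lemma K_0 [simp]: "0 \<in> K" using q_ge_2 by (simp add: in_K_iff)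
lemma K_1 [simp]: "1 \<in> K" by (simp add: in_K_iff)
lemma K_add [simp]: "x \<in> K \<Longrightarrow> y \<in> K \<Longrightarrow> x + y \<in> K" by (simp add: in_K_iff frob_simps)
lemma K_diff [simp]: "x \<in> K \<Longrightarrow> y \<in> K \<Longrightarrow> x - y \<in> K" by (simp add: in_K_iff frob_simps)
lemma K_minus [simp]: "- x \<in> K \<longleftrightarrow> x \<in> K" by (simp add: in_K_iff frob_simps)
lemma K_mult [simp]: "x \<in> K \<Longrightarrow> y \<in> K \<Longrightarrow> x * y \<in> K" by (simp add: in_K_iff frob_simps)
lemma K_divide [simp]: "x \<in> K \<Longrightarrow> y \<in> K \<Longrightarrow> x / y \<in> K" by (simp add: in_K_iff frob_simps)
lemma K_power [simp]: "x \<in> K \<Longrightarrow> x ^ n \<in> K" by (simp add: in_K_iff frob_power)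
lemma K_of_nat [simp]: "of_nat n \<in> K" by (induction n) auto
lemma K_numeral [simp]: "numeral n \<in> K" using K_of_nat[of "numeral n"] by simp
lemma K_finite [simp]: "finite K" by simp

lemma card_frob_eq_mult_le: "card {y::'a. y ^ q = c * y} \<le> q"
proof -
  let ?P = "monom 1 q - [:0, c:]"
  have "coeff ?P q = 1" using q_ge_2 by (auto simp: coeff_pCons split: nat.split)
  then have "?P \<noteq> 0" by force
  then have "card {x. poly ?P x = 0} \<le> degree ?P" by (rule card_poly_roots_bound)
  also have "\<dots> \<le> q"
    using q_ge_2 by (intro degree_diff_le) (auto simp: degree_monom_le)
  finally show ?thesis by (simp add: poly_monom mult.commute)
qed

text \<open>The additive map \<open>x ^ q - x\<close> has kernel \<open>K\<close> and takes its
  values among the roots of \<open>y ^ q = - y\<close>. Both sets have at most \<open>q\<close>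
  elements, and the field has \<open>q * q\<close>, so \<open>K\<close> cannot have fewer than
  \<open>q\<close>.\<close>

lemma card_K: "card K = q"
proof (rule antisym)
  show "card K \<le> q" using card_frob_eq_mult_le[of 1] by (simp add: K_def)
  let ?g = "\<lambda>x::'a. x ^ q - x"
  have fib: "card {x. ?g x = y} \<le> card K" for y
  proof (cases "\<exists>x0. ?g x0 = y")
    case True
    then obtain x0 where x0: "?g x0 = y" by blast
    have "{x. ?g x = y} \<subseteq> (\<lambda>u. x0 + u) ` K"
    proof
      fix x assume "x \<in> {x. ?g x = y}"
      then have "x - x0 \<in> K" using x0 by (simp add: in_K_iff frob_simps algebra_simps)
      then show "x \<in> (\<lambda>u. x0 + u) ` K" by (intro image_eqI[of _ _ "x - x0"]) auto
    qed
    then show ?thesis by (meson card_image_le card_mono finite_imageI K_finite order_trans)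
  qed auto
  have sub: "range ?g \<subseteq> {y. y ^ q = (-1) * y}" by (auto simp: frob_simps)
  have "(\<Union>y\<in>range ?g. {x. ?g x = y}) = UNIV" by blast
  then have "q * q = card (\<Union>y\<in>range ?g. {x. ?g x = y})"
    using CARD_eq by (simp only: power2_eq_square)
  also have "\<dots> \<le> (\<Sum>y\<in>range ?g. card {x. ?g x = y})" by (rule card_UN_le) simp
  also have "\<dots> \<le> card (range ?g) * card K" using sum_bounded_above[of "range ?g" "\<lambda>y. card {x. ?g x = y}" "card K"] fib by simp
  also have "\<dots> \<le> q * card K"
    using card_mono[OF _ sub] card_frob_eq_mult_le[of "-1"] by (intro mult_right_mono) auto
  finally show "q \<le> card K" using q_ge_2 by simp
qed

lemma ex_not_K: "\<exists>x. x \<notin> K"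
proof (rule ccontr)
  assume "\<not> ?thesis"
  then have "K = UNIV" by blast
  then have "q\<^sup>2 = q" using card_K CARD_eq by simp
  then show False using q_ge_2 by (simp add: power2_eq_square)
qed

section \<open>Multiplicative structure and power sums of the small field\<close>

lemma K_fermat: "x \<in> K \<Longrightarrow> x \<noteq> 0 \<Longrightarrow> x ^ (q - 1) = 1"
proof -
  assume "x \<in> K" "x \<noteq> 0"
  then have "x * x ^ (q - 1) = x"
    using q_ge_2 by (metis in_K_iff power_eq_if not_numeral_le_zero)
  with \<open>x \<noteq> 0\<close> show ?thesis by simp
qed

lemma ex_K_power_neq_1:
  assumes "0 < m" "m < q - 1"
  shows "\<exists>x\<in>K. x \<noteq> 0 \<and> x ^ m \<noteq> 1"
proof (rule ccontr)
  assume "\<not> ?thesis"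
  then have "K - {0} \<subseteq> {x. x ^ m = 1}" by auto
  then have "card (K - {0}) \<le> m"
    using card_power_eq_one_le[OF assms(1), where 'a='a] by (meson card_mono finite order_trans)
  then show False using assms card_K by (simp add: card_Diff_singleton)
qed

text \<open>Exponent 0 is exceptional: since \<open>0 ^ 0 = 1\<close>, the sum has \<open>q\<close>
  terms 1 and vanishes, although \<open>q - 1\<close> divides 0. For other exponents that are no
  multiple of \<open>q - 1\<close>, scaling by a suitable \<open>g\<close> multiplies the sum by
  \<open>g ^ m \<noteq> 1\<close>.\<close>

lemma sum_K_power:
  "(\<Sum>x\<in>K. x ^ m) = (if m > 0 \<and> (q - 1) dvd m then - 1 else (0::'a))"
proof (cases "m = 0")
  case True
  then show ?thesis by (simp add: card_K of_nat_q)
next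
  case False
  have Q: "q - 1 > 0" using q_ge_2 by simp
  have red: "x ^ m = x ^ (m mod (q - 1))" if "x \<in> K" "x \<noteq> 0" for x
  proof -
    have "x ^ m = x ^ ((q - 1) * (m div (q - 1)) + m mod (q - 1))" by simp
    also have "\<dots> = x ^ (m mod (q - 1))" using K_fermat[OF that] by (simp only: power_add power_mult) simp
    finally show ?thesis .
  qed
  have s: "(\<Sum>x\<in>K. x ^ m) = (\<Sum>x\<in>K-{0}. x ^ m)"
    using False by (subst sum.remove[of K 0]) (auto simp: power_0_left)
  show ?thesis
  proof (cases "(q - 1) dvd m")
    case True
    then have "(\<Sum>x\<in>K-{0}. x ^ m) = (\<Sum>x\<in>K-{0}. 1)" using red by (intro sum.cong) auto
    also have "\<dots> = of_nat (q - 1)" using card_K by (simp add: card_Diff_singleton)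
    also have "\<dots> = - 1" using q_ge_2 of_nat_q by (simp add: of_nat_diff)
    finally show ?thesis using True False s by simp
  next
    case ndvd: False
    then have "0 < m mod (q - 1)" "m mod (q - 1) < q - 1"
      using Q by (auto simp: mod_greater_zero_iff_not_dvd)
    from ex_K_power_neq_1[OF this] obtain g where g: "g \<in> K" "g \<noteq> 0" "g ^ (m mod (q - 1)) \<noteq> 1" by blast
    then have g1: "g ^ m \<noteq> 1" using red by simp
    have "(\<Sum>x\<in>K. x ^ m) = (\<Sum>x\<in>K. (g * x) ^ m)"
      by (rule sum.reindex_bij_witness[of _ "\<lambda>x. g * x" "\<lambda>x. x / g"]) (use g in auto)
    also have "\<dots> = g ^ m * (\<Sum>x\<in>K. x ^ m)" by (simp add: power_mult_distrib sum_distrib_left)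
    finally have "(\<Sum>x\<in>K. x ^ m) = 0" using g1 by (metis mult_cancel_right1)
    then show ?thesis using ndvd by simp
  qed
qed

end

subsection \<open>Power sums of binary forms\<close>

text \<open>A univariate polynomial with a formal degree \<open>D\<close> encodes a binary form.
  \<open>D\<close> may exceed \<open>degree g\<close>, so forms divisible by \<open>Y\<close> need
  no separate treatment.\<close>

definition homog :: "'a::comm_semiring_1 poly \<Rightarrow> nat \<Rightarrow> 'a \<Rightarrow> 'a \<Rightarrow> 'a" where
  "homog g D X Y = (\<Sum>i\<le>D. coeff g i * X ^ i * Y ^ (D - i))"

lemma homog_nonzero:
  fixes Y :: "'a::field"
  assumes "Y \<noteq> 0" "degree g \<le> D"
  shows "homog g D X Y = Y ^ D * poly g (X / Y)"
proof -
  have "poly g (X / Y) = (\<Sum>i\<le>D. coeff g i * (X / Y) ^ i)"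
    unfolding poly_altdef using assms(2)
    by (intro sum.mono_neutral_left) (auto simp: coeff_eq_0)
  then have "Y ^ D * poly g (X / Y) = (\<Sum>i\<le>D. Y ^ D * (coeff g i * (X / Y) ^ i))"
    by (simp add: sum_distrib_left)
  also have "\<dots> = homog g D X Y"
    unfolding homog_def
    by (intro sum.cong) (use assms(1) in \<open>auto simp: power_diff power_divide\<close>)
  finally show ?thesis by simp
qed

lemma homog_zero: "homog g D X 0 = coeff g D * X ^ D"
proof -
  have "homog g D X 0 = (\<Sum>i\<in>{D}. coeff g i * X ^ i * 0 ^ (D - i))"
    unfolding homog_def
    by (intro sum.mono_neutral_right) (auto simp: power_0_left split: if_splits)
  then show ?thesis by simp
qed

lemma coeff_mult_top:
  assumes "degree g \<le> D" "degree h \<le> E"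
  shows "coeff (g * h) (D + E) = coeff g D * coeff h E"
proof -
  have "coeff (g * h) (D + E) = (\<Sum>i\<in>{D}. coeff g i * coeff h (D + E - i))"
    unfolding coeff_mult
  proof (intro sum.mono_neutral_right ballI)
    fix i assume "i \<in> {..D + E} - {D}"
    then consider "i > D" | "i < D" by fastforce
    then show "coeff g i * coeff h (D + E - i) = 0"
      using assms by cases (simp_all add: coeff_eq_0)
  qed auto
  then show ?thesis by simp
qed

lemma homog_mult:
  fixes X Y :: "'a::field"
  assumes "degree g \<le> D" "degree h \<le> E"
  shows "homog (g * h) (D + E) X Y = homog g D X Y * homog h E X Y"
proof (cases "Y = 0")
  case True
  then show ?thesis by (simp add: homog_zero coeff_mult_top[OF assms] power_add)
next
  case False
  have "degree (g * h) \<le> D + E" using assms degree_mult_le[of g h] by linarith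
  then show ?thesis using False assms by (simp add: homog_nonzero power_add)
qed

lemma homog_power:
  fixes X Y :: "'a::field"
  assumes "degree g \<le> D"
  shows "homog (g ^ n) (n * D) X Y = homog g D X Y ^ n"
proof (induction n)
  case 0
  then show ?case by (simp add: homog_def)
next
  case (Suc n)
  have "degree (g ^ n) \<le> n * D"
    using degree_power_le[of g n] assms by (metis mult.commute mult_le_mono2 order_trans)
  then show ?case using homog_mult[OF assms, of "g ^ n" "n * D" X Y] Suc by simp
qed

context quadratic_extension
begin

lemma sum_homog:
  "(\<Sum>X\<in>K. \<Sum>Y\<in>K. homog g D X Y)
    = (\<Sum>i\<le>D. coeff g i * (\<Sum>X\<in>K. X ^ i) * (\<Sum>Y\<in>K. Y ^ (D - i)))"
proof -
  have "(\<Sum>X\<in>K. \<Sum>Y\<in>K. homog g D X Y)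
      = (\<Sum>X\<in>K. \<Sum>i\<le>D. \<Sum>Y\<in>K. coeff g i * X ^ i * Y ^ (D - i))"
    unfolding homog_def by (intro sum.cong refl sum.swap)
  also have "\<dots> = (\<Sum>i\<le>D. \<Sum>X\<in>K. \<Sum>Y\<in>K. coeff g i * X ^ i * Y ^ (D - i))"
    by (rule sum.swap)
  also have "\<dots> = (\<Sum>i\<le>D. coeff g i * (\<Sum>X\<in>K. X ^ i) * (\<Sum>Y\<in>K. Y ^ (D - i)))"
    by (simp add: sum_distrib_left sum_distrib_right mult_ac)
  finally show ?thesis .
qed

text \<open>A monomial contributes only if both exponents are positive multiples of
  \<open>q - 1\<close>; then \<open>D\<close> is a multiple of \<open>q - 1\<close> too, and at
  least twice as large.\<close>

lemma sum_homog_eq_0: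
  assumes "D < 2 * (q - 1) \<or> \<not> (q - 1) dvd D"
  shows "(\<Sum>X\<in>K. \<Sum>Y\<in>K. homog g D X Y) = 0"
  unfolding sum_homog
proof (intro sum.neutral ballI)
  fix i assume "i \<in> {..D}"
  then have i: "i \<le> D" by simp
  have "\<not> ((i > 0 \<and> (q - 1) dvd i) \<and> (D - i > 0 \<and> (q - 1) dvd (D - i)))"
  proof
    assume *: "(i > 0 \<and> (q - 1) dvd i) \<and> (D - i > 0 \<and> (q - 1) dvd (D - i))"
    then have "q - 1 \<le> i" "q - 1 \<le> D - i" by (auto dest: dvd_imp_le)
    moreover have "(q - 1) dvd D" using * i by (metis dvd_add le_add_diff_inverse)
    ultimately show False using assms by linarith
  qed
  then show "coeff g i * (\<Sum>X\<in>K. X ^ i) * (\<Sum>Y\<in>K. Y ^ (D - i)) = 0"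
    unfolding sum_K_power by auto
qed

text \<open>In degree \<open>2 (q - 1)\<close> the only split into two positive multiples of
  \<open>q - 1\<close> is the even one, and the two factors \<open>-1\<close> cancel.\<close>

lemma sum_homog_eq_coeff:
  "(\<Sum>X\<in>K. \<Sum>Y\<in>K. homog g (2 * (q - 1)) X Y) = coeff g (q - 1)"
proof -
  have Q: "q - 1 > 0" using q_ge_2 by simp
  have "(\<Sum>X\<in>K. \<Sum>Y\<in>K. homog g (2 * (q - 1)) X Y) = (\<Sum>i\<in>{q - 1}. coeff g i * (\<Sum>X\<in>K. X ^ i) * (\<Sum>Y\<in>K. Y ^ (2 * (q - 1) - i)))"
    unfolding sum_homog
  proof (intro sum.mono_neutral_right ballI)
    fix i assume i: "i \<in> {..2 * (q - 1)} - {q - 1}"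
    have "\<not> (i > 0 \<and> (q - 1) dvd i) \<or> 2 * (q - 1) - i = 0"
    proof (rule ccontr)
      assume "\<not> ?thesis"
      then have "i > 0" "i < 2 * (q - 1)" and "(q - 1) dvd i" by auto
      from this(3) obtain j where "i = (q - 1) * j" by (elim dvdE)
      with \<open>i > 0\<close> \<open>i < 2 * (q - 1)\<close> have "j \<noteq> 0" "j < 2"
        by (auto simp: mult.commute)
      then have "j = 1" by linarith
      then show False using i \<open>i = (q - 1) * j\<close> by simp
    qed
    then show "coeff g i * (\<Sum>X\<in>K. X ^ i) * (\<Sum>Y\<in>K. Y ^ (2 * (q - 1) - i)) = 0"
      unfolding sum_K_power by auto
  qed auto
  moreover have "2 * (q - 1) - (q - 1) = q - 1" by linarith
  ultimately show ?thesis using Q unfolding sum_K_power by (simp del: One_nat_def)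
qed

section \<open>Powers whose exponent has constant digits in base \<open>p\<close>\<close>

lemma coeff_power_p:
  fixes H :: "'a poly"
  shows "coeff (H ^ p) n = (if p dvd n then coeff H (n div p) ^ p else 0)"
proof -
  have p0: "p > 0" using prime_gt_0_nat[OF prime_p] .
  have "H ^ p = (\<Sum>i\<le>degree H. monom (coeff H i) i) ^ p"
    by (simp add: poly_as_sum_of_monoms)
  also have "\<dots> = (\<Sum>i\<le>degree H. monom (coeff H i) i ^ p)"
    by (rule freshmans_dream_sum) (simp_all add: CHAR_eq prime_p)
  finally have eq: "coeff (H ^ p) n = (\<Sum>i\<le>degree H. if p * i = n then coeff H i ^ p else 0)"
    by (simp add: coeff_sum monom_power mult.commute[of p])
  show ?thesis
  proof (cases "p dvd n")
    case True
    then obtain j where j: "n = p * j" by (elim dvdE)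
    have "coeff (H ^ p) n = (\<Sum>i\<le>degree H. if i = j then coeff H i ^ p else 0)"
      unfolding eq using p0 by (simp add: j)
    also have "\<dots> = coeff H j ^ p" using p0 by (simp add: sum.delta' coeff_eq_0 power_0_left)
    finally show ?thesis using True j p0 by simp
  next
    case False
    then have "coeff (H ^ p) n = 0" unfolding eq by (intro sum.neutral) auto
    then show ?thesis using False by simp
  qed
qed

text \<open>The number with \<open>j\<close> digits 1 in base \<open>p\<close>, that is,
  \<open>(p ^ j - 1) / (p - 1)\<close>.\<close>

definition repunit :: "nat \<Rightarrow> nat" where
  "repunit j = (\<Sum>s<j. p ^ s)"

lemma repunit_Suc: "repunit (Suc j) = 1 + p * repunit j"
  unfolding repunit_def by (subst sum.lessThan_Suc_shift) (simp add: sum_distrib_left)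

lemma repunit_mult: "(p - 1) * repunit k = q - 1"
proof -
  have "(p - 1) * repunit j = p ^ j - 1" for j
  proof (induction j)
    case (Suc j)
    have "p ^ j \<ge> 1" using prime_gt_0_nat[OF prime_p] by simp
    have "(p - 1) * repunit (Suc j) = (p - 1) + p * ((p - 1) * repunit j)"
      unfolding repunit_Suc by (simp add: algebra_simps)
    also have "\<dots> = (p - 1) + p * (p ^ j - 1)" by (simp only: Suc)
    also have "\<dots> = p ^ Suc j - 1"
      using \<open>p ^ j \<ge> 1\<close> prime_gt_0_nat[OF prime_p] by (simp add: algebra_simps)
    finally show ?case .
  qed (simp add: repunit_def)
  then show ?thesis by (simp add: q_eq)
qed

text \<open>No carries occur in base \<open>p\<close>, so the coefficients of the Frobenius twists multiply.\<close>

lemma coeff_power_repunit: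
  fixes G :: "'a poly"
  assumes "c < p" "degree G < p + c"
  shows "coeff (G ^ repunit j) (c * repunit j) = coeff G c ^ repunit j"
proof (induction j)
  case 0
  then show ?case by (simp add: repunit_def)
next
  case (Suc j)
  have p0: "p > 0" using prime_gt_0_nat[OF prime_p] .
  let ?R = "repunit j" and ?n = "c * repunit (Suc j)"
  have n: "?n = c + p * (c * ?R)" by (simp add: repunit_Suc algebra_simps)
  have "G ^ repunit (Suc j) = G * (G ^ ?R) ^ p"
    unfolding repunit_Suc by (simp add: power_mult[symmetric] mult.commute)
  then have "coeff (G ^ repunit (Suc j)) ?n
      = (\<Sum>i\<le>?n. coeff G i * coeff ((G ^ ?R) ^ p) (?n - i))"
    by (simp add: coeff_mult)
  also have "\<dots> = (\<Sum>i\<in>{c}. coeff G i * coeff ((G ^ ?R) ^ p) (?n - i))"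
  proof (intro sum.mono_neutral_right ballI)
    fix i assume i: "i \<in> {..?n} - {c}"
    show "coeff G i * coeff ((G ^ ?R) ^ p) (?n - i) = 0"
    proof (cases "i < p + c \<and> p dvd (?n - i)")
      case True
      then obtain t where t: "?n - i = p * t" by (elim conjE dvdE)
      then have e: "int c + int p * int (c * ?R) = int i + int p * int t"
        using i n by (metis DiffD1 atMost_iff le_add_diff_inverse of_nat_add of_nat_mult)
      \<comment> \<open>Only indices \<open>c + p z\<close> can contribute;
        \<open>0 \<le> i < p + c\<close> and \<open>c < p\<close> leave
        \<open>z = 0\<close>.\<close>
      define z where "z = int (c * ?R) - int t"
      have z: "int i = int c + int p * z" using e by (simp add: z_def algebra_simps)
      have "z < 1"
      proof (rule ccontr)
        assume "\<not> z < 1"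
        then have "int p * z \<ge> int p * 1" by (intro mult_left_mono) auto
        then show False using z True by linarith
      qed
      moreover have "z > -1"
      proof (rule ccontr)
        assume "\<not> z > -1"
        then have "int p * z \<le> int p * (-1)" by (intro mult_left_mono) auto
        then show False using z assms(1) by linarith
      qed
      ultimately have "z = 0" by linarith
      then show ?thesis using z i by simp
    next
      case False
      then show ?thesis
        using assms(2) by (cases "i < p + c") (auto simp: coeff_power_p coeff_eq_0)
    qed
  qed (simp_all add: n)
  also have "\<dots> = coeff G c * (coeff G c ^ ?R) ^ p"
    using p0 Suc by (simp add: n coeff_power_p)
  also have "\<dots> = coeff G c ^ repunit (Suc j)"
    unfolding repunit_Suc by (simp add: power_mult[symmetric] mult.commute)
  finally show ?case .
qed

text \<open>Lucas's theorem for constant digits, read off from the coefficients of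
  \<open>(1 + X) ^ m\<close>.\<close>

lemma of_nat_choose_repunit:
  assumes "m < p" "c \<le> m"
  shows "of_nat (m * repunit j choose (c * repunit j)) = (of_nat (m choose c) :: 'a) ^ repunit j"
proof -
  have co: "coeff ([:1, 1:] ^ n) i = (of_nat (n choose i) :: 'a)" for n i
  proof (cases "i \<le> n")
    case True
    then show ?thesis by (simp add: coeff_linear_poly_power)
  next
    case False
    then show ?thesis by (simp add: coeff_eq_0 degree_linear_power binomial_eq_0)
  qed
  have "coeff (([:1, 1:] ^ m) ^ repunit j) (c * repunit j) = coeff ([:1, 1 :: 'a:] ^ m) c ^ repunit j"
    by (rule coeff_power_repunit) (use assms in \<open>auto simp: degree_linear_power\<close>)
  then show ?thesis unfolding power_mult[symmetric] co .
qed

text \<open>In the binomial expansion of \<open>(C + V)^n\<close> only the term of degree \<open>2 (q - 1)\<close> can contribute to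
  the sum, apart from the term \<open>C^n\<close>, which is assumed to sum to zero.\<close>

lemma hermite_coeff:
  fixes C V :: "'a poly" and m0 j0 :: nat
  defines "n \<equiv> (m0 + j0) * repunit k"
  assumes deg: "degree C \<le> 3" "degree V \<le> 1"
    and mj: "3 * m0 + j0 = 2 * (p - 1)" "m0 + j0 \<le> p - 1" and nz: "\<not> p dvd (m0 + j0 choose j0)"
    and j0: "j0 > 0"
    and S0: "(\<Sum>X\<in>K. \<Sum>Y\<in>K. homog C 3 X Y ^ n) = 0"
    and S1: "(\<Sum>X\<in>K. \<Sum>Y\<in>K. (homog C 3 X Y + homog V 1 X Y) ^ n) = 0"
  shows "coeff (C ^ m0 * V ^ j0) (p - 1) = 0"
proof -
  have p1: "p > 1" using prime_gt_1_nat[OF prime_p] .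
  define r where "r = repunit k"
  define J where "J = j0 * r"
  have qr: "q - 1 = (p - 1) * r" using repunit_mult by (simp add: r_def)
  have r0: "r > 0" using qr q_ge_2 by (cases r) auto
  have nJ: "n = m0 * r + J" by (simp add: n_def r_def J_def algebra_simps)
  have nq: "n \<le> q - 1" unfolding qr n_def r_def using mj(2) by (rule mult_right_mono) simp
  have J3: "3 * (m0 * r) + J = 2 * (q - 1)"
    unfolding qr J_def using mj(1) by (metis add_mult_distrib mult.assoc)
  define A where "A j = (\<Sum>X\<in>K. \<Sum>Y\<in>K. homog V 1 X Y ^ j * homog C 3 X Y ^ (n - j))" for j
  have A: "A j = (\<Sum>X\<in>K. \<Sum>Y\<in>K. homog (V ^ j * C ^ (n - j)) (j * 1 + (n - j) * 3) X Y)" for j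
  proof -
    have "degree (V ^ j) \<le> j * 1"
      using degree_power_le[of V j] deg(2) by (metis mult.commute mult_le_mono2 order_trans)
    moreover have "degree (C ^ (n - j)) \<le> (n - j) * 3"
      using degree_power_le[of C "n - j"] deg(1) by (metis mult.commute mult_le_mono2 order_trans)
    ultimately show ?thesis unfolding A_def
      by (simp only: homog_mult homog_power[OF deg(1)] homog_power[OF deg(2)])
  qed
  have "0 = (\<Sum>X\<in>K. \<Sum>Y\<in>K. \<Sum>j\<le>n. of_nat (n choose j) * homog V 1 X Y ^ j * homog C 3 X Y ^ (n - j))"
    unfolding binomial_ring[symmetric] using S1 by (simp add: add.commute)
  also have "\<dots> = (\<Sum>X\<in>K. \<Sum>j\<le>n. \<Sum>Y\<in>K. of_nat (n choose j) * homog V 1 X Y ^ j * homog C 3 X Y ^ (n - j))"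
    by (intro sum.cong refl sum.swap)
  also have "\<dots> = (\<Sum>j\<le>n. \<Sum>X\<in>K. \<Sum>Y\<in>K. of_nat (n choose j) * homog V 1 X Y ^ j * homog C 3 X Y ^ (n - j))"
    by (rule sum.swap)
  also have "\<dots> = (\<Sum>j\<le>n. of_nat (n choose j) * A j)"
    unfolding A_def by (simp add: sum_distrib_left mult.assoc)
  also have "\<dots> = (\<Sum>j\<in>{J}. of_nat (n choose j) * A j)"
  proof (intro sum.mono_neutral_right ballI)
    fix j assume "j \<in> {..n} - {J}"
    then have j: "j \<le> n" "j \<noteq> J" by auto
    have "A j = 0"
    proof (cases "j = 0")
      case True
      then show ?thesis using S0 by (simp add: A_def)
    next
      case False
      let ?D = "j * 1 + (n - j) * 3"
      \<comment> \<open>For \<open>j > 0\<close> and \<open>n \<le> q - 1\<close> the degree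
        \<open>3 n - 2 j\<close> stays below \<open>3 (q - 1)\<close>. The only degree with a
        nonzero sum is therefore \<open>2 (q - 1)\<close>, and that one belongs to
        \<open>j = J\<close>.\<close>
      have D: "?D < 3 * (q - 1)" "?D + 2 * j = 3 * n" using False j nq by auto
      have "?D \<noteq> 2 * (q - 1)" using D(2) J3 nJ j by linarith
      have "?D < 2 * (q - 1) \<or> \<not> (q - 1) dvd ?D"
      proof (rule ccontr)
        assume *: "\<not> ?thesis"
        then obtain t where t: "?D = (q - 1) * t" by (auto elim: dvdE)
        have "t < 3" using D(1) t by (metis mult.commute mult_less_cancel1)
        moreover have "t \<ge> 2"
        proof (rule ccontr)
          assume "\<not> t \<ge> 2"
          then have "(q - 1) * t \<le> (q - 1) * 1" by (intro mult_le_mono2) simp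
          then show False using * t q_ge_2 by simp
        qed
        ultimately have "t = 2" by linarith
        then show False using t \<open>?D \<noteq> 2 * (q - 1)\<close> by simp
      qed
      then show ?thesis unfolding A by (rule sum_homog_eq_0)
    qed
    then show "of_nat (n choose j) * A j = 0" by simp
  qed (auto simp: nJ)
  finally have 0: "of_nat (n choose J) * A J = 0" by simp
  have "of_nat (n choose J) = (of_nat (m0 + j0 choose j0) :: 'a) ^ r"
    unfolding n_def J_def r_def using mj p1 by (intro of_nat_choose_repunit) auto
  moreover have "of_nat (m0 + j0 choose j0) \<noteq> (0::'a)" using nz by (simp add: of_nat_eq_0_iff)
  ultimately have "A J = 0" using 0 by simp
  moreover have "A J = coeff ((V ^ j0 * C ^ m0) ^ r) (q - 1)"
  proof -
    have "J * 1 + (n - J) * 3 = 2 * (q - 1)" using J3 by (simp add: nJ)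
    moreover have "V ^ J * C ^ (n - J) = (V ^ j0 * C ^ m0) ^ r"
      by (simp add: nJ J_def power_mult power_mult_distrib)
    ultimately show ?thesis unfolding A by (simp only: sum_homog_eq_coeff)
  qed
  \<comment> \<open>As \<open>q - 1 = (p - 1) r\<close>, the middle coefficient sits at a position
    with all digits \<open>p - 1\<close>. The degree \<open>2 (p - 1)\<close> is just small enough
    to exclude carries.\<close>
  moreover have "\<dots> = coeff (V ^ j0 * C ^ m0) (p - 1) ^ r"
    unfolding qr r_def
  proof (rule coeff_power_repunit)
    have "degree (V ^ j0 * C ^ m0) \<le> degree V * j0 + degree C * m0"
      using degree_mult_le[of "V ^ j0" "C ^ m0"] degree_power_le[of V j0] degree_power_le[of C m0] by linarith
    also have "\<dots> \<le> 1 * j0 + 3 * m0" using deg by (intro add_mono mult_right_mono) auto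
    also have "\<dots> < p + (p - 1)" using mj(1) p1 by linarith
    finally show "degree (V ^ j0 * C ^ m0) < p + (p - 1)" .
  qed (use p1 in simp)
  ultimately show ?thesis using r0 by (simp add: mult.commute)
qed

end

subsection \<open>Cubic maps in coordinates\<close>

definition cubic_form :: "'a::comm_ring_1 \<Rightarrow> 'a \<Rightarrow> 'a \<Rightarrow> 'a \<Rightarrow> 'a \<Rightarrow> 'a \<Rightarrow> 'a" where
  "cubic_form a b c d X Y = a * X ^ 3 + b * X\<^sup>2 * Y + c * X * Y\<^sup>2 + d * Y ^ 3"

lemma homog_cubic: "homog [:d, c, b, a:] 3 X Y = cubic_form a b c d X Y"
proof -
  have "{..3::nat} = {0, 1, 2, 3}" by auto
  then show ?thesis
    by (simp add: homog_def cubic_form_def numeral_2_eq_2 numeral_3_eq_3 algebra_simps)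
qed

lemma homog_linear: "homog [:b, a:] 1 X Y = a * X + b * Y"
  by (simp add: homog_def add.commute)

section \<open>Bases of the field over \<open>K\<close> and coordinate forms of cubic maps\<close>

context quadratic_extension
begin

lemma cubic_form_in_K [simp]:
  "\<lbrakk>a \<in> K; b \<in> K; c \<in> K; d \<in> K; X \<in> K; Y \<in> K\<rbrakk> \<Longrightarrow> cubic_form a b c d X Y \<in> K"
  by (simp add: cubic_form_def)

text \<open>The determinant of the two elements and their conjugates; it is nonzero exactly when
  they are linearly independent over \<open>K\<close>.\<close>

definition K_basis :: "'a \<Rightarrow> 'a \<Rightarrow> bool" where
  "K_basis e1 e2 \<longleftrightarrow> e1 * e2 ^ q - e1 ^ q * e2 \<noteq> 0"

text \<open>Cramer's rule for the system formed by \<open>x\<close> and \<open>x ^ q\<close>.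
  Frobenius negates numerators and denominator alike, so the quotients lie in
  \<open>K\<close>.\<close>

lemma K_basis_coords:
  assumes "K_basis e1 e2"
  obtains X Y where "X \<in> K" "Y \<in> K" "x = X * e1 + Y * e2"
proof -
  define D where "D = e1 * e2 ^ q - e1 ^ q * e2"
  have D: "D \<noteq> 0" using assms by (simp add: K_basis_def D_def)
  have Dq: "D ^ q = - D" unfolding D_def by (simp add: frob_simps)
  define X where "X = (x * e2 ^ q - x ^ q * e2) / D"
  define Y where "Y = (e1 * x ^ q - e1 ^ q * x) / D"
  have "X \<in> K" "Y \<in> K" using D unfolding in_K_iff X_def Y_def
    by (simp_all add: frob_simps Dq field_simps)
  moreover have "X * e1 + Y * e2 = ((x * e2 ^ q - x ^ q * e2) * e1 + (e1 * x ^ q - e1 ^ q * x) * e2) / D"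
    by (simp add: X_def Y_def add_divide_distrib)
  then have "X * e1 + Y * e2 = (x * D) / D" by (simp add: D_def algebra_simps)
  then have "x = X * e1 + Y * e2" using D by simp
  ultimately show ?thesis using that by blast
qed

lemma K_basis_zero:
  assumes "K_basis e1 e2" "X \<in> K" "Y \<in> K" "X * e1 + Y * e2 = 0"
  shows "X = 0 \<and> Y = 0"
proof -
  define u where "u = e1 ^ q" define w where "w = e2 ^ q"
  have "(X * e1 + Y * e2) ^ q = 0" using assms(4) q_ge_2 by simp
  then have 1: "X * u + Y * w = 0"
    using assms(2,3) by (simp add: frob_simps in_K_iff u_def w_def)
  have D: "e1 * w - u * e2 \<noteq> 0" using assms(1) by (simp add: K_basis_def u_def w_def)
  have "X * (e1 * w - u * e2) = 0" "Y * (e1 * w - u * e2) = 0"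
    using 1 assms(4) by algebra+
  then show ?thesis using D by simp
qed

lemma K_basis_unique:
  assumes "K_basis e1 e2" "X \<in> K" "Y \<in> K" "X' \<in> K" "Y' \<in> K" "X * e1 + Y * e2 = X' * e1 + Y' * e2"
  shows "X = X' \<and> Y = Y'"
  using K_basis_zero[OF assms(1), of "X - X'" "Y - Y'"] assms(2-) by (simp add: algebra_simps)

lemma K_basis_shift2:
  assumes "K_basis e1 e2" "v \<in> K"
  shows "K_basis e1 (e2 - v * e1)"
  using assms by (simp add: K_basis_def frob_simps in_K_iff algebra_simps)

lemma K_basis_shift1:
  assumes "K_basis e1 e2" "v \<in> K"
  shows "K_basis (e1 + v * e2) e2"
  using assms by (simp add: K_basis_def frob_simps in_K_iff algebra_simps)

lemma K_basis_swap: "K_basis e1 e2 \<Longrightarrow> K_basis e2 e1"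
  by (simp add: K_basis_def algebra_simps)

lemma K_basis_scale:
  assumes "K_basis e1 e2" "s \<in> K" "s \<noteq> 0"
  shows "K_basis e1 (s * e2)"
proof -
  have "e1 * (s * e2) ^ q - e1 ^ q * (s * e2) = s * (e1 * e2 ^ q - e1 ^ q * e2)"
    using assms(2) by (simp add: frob_simps in_K_iff algebra_simps)
  then show ?thesis using assms by (simp add: K_basis_def)
qed

lemma ex_K_basis: obtains e1 e2 where "K_basis e1 e2"
proof -
  obtain x where "x \<notin> K" using ex_not_K by blast
  then have "K_basis 1 x" by (simp add: K_basis_def in_K_iff)
  then show ?thesis by (rule that)
qed

text \<open>The pair \<open>(A, B)\<close> permutes \<open>K \<times> K\<close>, so \<open>A\<close>
  takes each value \<open>q\<close> times, and \<open>q\<close> is 0 in the field.\<close>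

lemma sum_K_basis_bij:
  assumes bas: "K_basis e1 e2" and "bij g"
    and g: "\<And>X Y. X \<in> K \<Longrightarrow> Y \<in> K \<Longrightarrow> A X Y \<in> K \<and> B X Y \<in> K \<and> g (X * e1 + Y * e2) = A X Y * e1 + B X Y * e2"
  shows "(\<Sum>X\<in>K. \<Sum>Y\<in>K. \<phi> (A X Y)) = (0::'a)"
proof -
  let ?h = "\<lambda>(X, Y). (A X Y, B X Y)"
  have inj: "inj_on ?h (K \<times> K)"
  proof (rule inj_onI, clarify)
    fix X Y X' Y' assume K: "X \<in> K" "Y \<in> K" "X' \<in> K" "Y' \<in> K" and eq: "A X Y = A X' Y'" "B X Y = B X' Y'"
    then have "g (X * e1 + Y * e2) = g (X' * e1 + Y' * e2)" using g[of X Y] g[of X' Y'] by simp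
    then have "X * e1 + Y * e2 = X' * e1 + Y' * e2" using \<open>bij g\<close> by (simp add: bij_def inj_eq)
    then show "X = X' \<and> Y = Y'" using K_basis_unique[OF bas K] by blast
  qed
  have "?h ` (K \<times> K) \<subseteq> K \<times> K" using g by auto
  then have img: "?h ` (K \<times> K) = K \<times> K" using inj by (intro endo_inj_surj) auto
  have "(\<Sum>X\<in>K. \<Sum>Y\<in>K. \<phi> (A X Y)) = (\<Sum>z\<in>K\<times>K. \<phi> (fst (?h z)))"
    by (simp add: sum.cartesian_product case_prod_beta)
  also have "\<dots> = (\<Sum>z\<in>?h ` (K \<times> K). \<phi> (fst z))" by (subst sum.reindex[OF inj]) (simp add: o_def)
  also have "\<dots> = (\<Sum>X\<in>K. \<Sum>Y\<in>K. \<phi> X)" unfolding img sum.cartesian_product by (simp add: case_prod_beta)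
  also have "\<dots> = 0" by (simp add: card_K of_nat_q)
  finally show ?thesis .
qed

definition cubic_rep :: "('a \<Rightarrow> 'a) \<Rightarrow> 'a \<Rightarrow> 'a \<Rightarrow> 'a \<Rightarrow> 'a \<Rightarrow> 'a \<Rightarrow> 'a \<Rightarrow> 'a \<Rightarrow> 'a \<Rightarrow> 'a \<Rightarrow> 'a \<Rightarrow> bool" where
  "cubic_rep f e1 e2 P0 P1 P2 P3 R0 R1 R2 R3 \<longleftrightarrow>
    {P0, P1, P2, P3, R0, R1, R2, R3} \<subseteq> K \<and>
    (\<forall>X\<in>K. \<forall>Y\<in>K. f (X * e1 + Y * e2)
       = cubic_form P0 P1 P2 P3 X Y * e1 + cubic_form R0 R1 R2 R3 X Y * e2)"

definition cubic_map :: "('a \<Rightarrow> 'a) \<Rightarrow> bool" where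
  "cubic_map f \<longleftrightarrow> (\<forall>e1 e2. \<exists>F0 F1 F2 F3. \<forall>X\<in>K. \<forall>Y\<in>K. f (X * e1 + Y * e2) = cubic_form F0 F1 F2 F3 X Y)"

lemma cubic_rep_exists:
  assumes "cubic_map f" "K_basis e1 e2"
  shows "\<exists>P0 P1 P2 P3 R0 R1 R2 R3. cubic_rep f e1 e2 P0 P1 P2 P3 R0 R1 R2 R3"
proof -
  obtain F0 F1 F2 F3 where F: "\<And>X Y. X \<in> K \<Longrightarrow> Y \<in> K \<Longrightarrow> f (X * e1 + Y * e2) = cubic_form F0 F1 F2 F3 X Y"
    using assms(1) unfolding cubic_map_def by blast
  obtain P0 R0 where 0: "P0 \<in> K" "R0 \<in> K" "F0 = P0 * e1 + R0 * e2" using K_basis_coords[OF assms(2)] .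
  obtain P1 R1 where 1: "P1 \<in> K" "R1 \<in> K" "F1 = P1 * e1 + R1 * e2" using K_basis_coords[OF assms(2)] .
  obtain P2 R2 where 2: "P2 \<in> K" "R2 \<in> K" "F2 = P2 * e1 + R2 * e2" using K_basis_coords[OF assms(2)] .
  obtain P3 R3 where 3: "P3 \<in> K" "R3 \<in> K" "F3 = P3 * e1 + R3 * e2" using K_basis_coords[OF assms(2)] .
  have "cubic_rep f e1 e2 P0 P1 P2 P3 R0 R1 R2 R3"
    unfolding cubic_rep_def using 0 1 2 3 by (auto simp: F cubic_form_def algebra_simps)
  then show ?thesis by blast
qed

text \<open>The first form becomes \<open>P + v R\<close>, evaluated at \<open>X - v Y\<close>.
  Results about the first form alone thus reach every member of the pencil.\<close>

lemma cubic_rep_shift2: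
  assumes "cubic_rep f e1 e2 P0 P1 P2 P3 R0 R1 R2 R3" "v \<in> K"
  shows "cubic_rep f e1 (e2 - v * e1)
     (P0 + v * R0) (P1 - 3 * v * P0 + v * (R1 - 3 * v * R0))
     (P2 - 2 * v * P1 + 3 * v\<^sup>2 * P0 + v * (R2 - 2 * v * R1 + 3 * v\<^sup>2 * R0))
     (P3 - v * P2 + v\<^sup>2 * P1 - v ^ 3 * P0 + v * (R3 - v * R2 + v\<^sup>2 * R1 - v ^ 3 * R0))
     R0 (R1 - 3 * v * R0) (R2 - 2 * v * R1 + 3 * v\<^sup>2 * R0) (R3 - v * R2 + v\<^sup>2 * R1 - v ^ 3 * R0)"
  unfolding cubic_rep_def
proof (intro conjI ballI)
  fix X Y assume "X \<in> K" "Y \<in> K"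
  then have "f ((X - v * Y) * e1 + Y * e2) = cubic_form P0 P1 P2 P3 (X - v * Y) Y * e1 + cubic_form R0 R1 R2 R3 (X - v * Y) Y * e2"
    using assms by (simp add: cubic_rep_def)
  moreover have "X * e1 + Y * (e2 - v * e1) = (X - v * Y) * e1 + Y * e2" by (simp add: algebra_simps)
  ultimately have "f (X * e1 + Y * (e2 - v * e1)) = cubic_form P0 P1 P2 P3 (X - v * Y) Y * e1 + cubic_form R0 R1 R2 R3 (X - v * Y) Y * e2"
    by (simp only:)
  also have "\<dots> = cubic_form (P0 + v * R0) (P1 - 3 * v * P0 + v * (R1 - 3 * v * R0))
     (P2 - 2 * v * P1 + 3 * v\<^sup>2 * P0 + v * (R2 - 2 * v * R1 + 3 * v\<^sup>2 * R0))
     (P3 - v * P2 + v\<^sup>2 * P1 - v ^ 3 * P0 + v * (R3 - v * R2 + v\<^sup>2 * R1 - v ^ 3 * R0)) X Y * e1 + cubic_form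
     R0 (R1 - 3 * v * R0) (R2 - 2 * v * R1 + 3 * v\<^sup>2 * R0) (R3 - v * R2 + v\<^sup>2 * R1 - v ^ 3 * R0) X Y * (e2 - v * e1)"
    unfolding cubic_form_def by algebra
  finally show "f (X * e1 + Y * (e2 - v * e1)) = \<dots>" .
qed (use assms in \<open>simp add: cubic_rep_def\<close>)

text \<open>The first form only undergoes a substitution here. \<open>P0'\<close> is its value at
  \<open>(1, v)\<close>, so \<open>v\<close> can move a root to \<open>(1, 0)\<close>; another
  choice of \<open>v\<close> removes \<open>P2'\<close> when \<open>3 P3 \<noteq> 0\<close>.\<close>

lemma cubic_rep_shift1:
  assumes "cubic_rep f e1 e2 P0 P1 P2 P3 R0 R1 R2 R3" "v \<in> K"
  defines "P0' \<equiv> P0 + v * P1 + v\<^sup>2 * P2 + v ^ 3 * P3" and "P1' \<equiv> P1 + 2 * v * P2 + 3 * v\<^sup>2 * P3"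
    and "P2' \<equiv> P2 + 3 * v * P3"
  shows "cubic_rep f (e1 + v * e2) e2 P0' P1' P2' P3
     (R0 + v * R1 + v\<^sup>2 * R2 + v ^ 3 * R3 - v * P0') (R1 + 2 * v * R2 + 3 * v\<^sup>2 * R3 - v * P1')
     (R2 + 3 * v * R3 - v * P2') (R3 - v * P3)"
  unfolding cubic_rep_def
proof (intro conjI ballI)
  fix X Y assume "X \<in> K" "Y \<in> K"
  then have "f (X * e1 + (Y + v * X) * e2) = cubic_form P0 P1 P2 P3 X (Y + v * X) * e1 + cubic_form R0 R1 R2 R3 X (Y + v * X) * e2"
    using assms by (simp add: cubic_rep_def)
  moreover have "X * (e1 + v * e2) + Y * e2 = X * e1 + (Y + v * X) * e2" by (simp add: algebra_simps)
  ultimately have "f (X * (e1 + v * e2) + Y * e2) = cubic_form P0 P1 P2 P3 X (Y + v * X) * e1 + cubic_form R0 R1 R2 R3 X (Y + v * X) * e2"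
    by (simp only:)
  also have "\<dots> = cubic_form P0' P1' P2' P3 X Y * (e1 + v * e2) + cubic_form
     (R0 + v * R1 + v\<^sup>2 * R2 + v ^ 3 * R3 - v * P0') (R1 + 2 * v * R2 + 3 * v\<^sup>2 * R3 - v * P1')
     (R2 + 3 * v * R3 - v * P2') (R3 - v * P3) X Y * e2"
    unfolding cubic_form_def P0'_def P1'_def P2'_def by algebra
  finally show "f (X * (e1 + v * e2) + Y * e2) = \<dots>" .
qed (use assms(1,2) in \<open>simp add: cubic_rep_def P0'_def P1'_def P2'_def\<close>)

lemma cubic_rep_swap:
  assumes "cubic_rep f e1 e2 P0 P1 P2 P3 R0 R1 R2 R3"
  shows "cubic_rep f e2 e1 R3 R2 R1 R0 P3 P2 P1 P0"
  unfolding cubic_rep_def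
proof (intro conjI ballI)
  fix X Y assume "X \<in> K" "Y \<in> K"
  then have "f (Y * e1 + X * e2) = cubic_form P0 P1 P2 P3 Y X * e1 + cubic_form R0 R1 R2 R3 Y X * e2"
    using assms by (simp add: cubic_rep_def)
  then show "f (X * e2 + Y * e1) = cubic_form R3 R2 R1 R0 X Y * e2 + cubic_form P3 P2 P1 P0 X Y * e1"
    by (simp add: cubic_form_def algebra_simps)
qed (use assms in \<open>simp add: cubic_rep_def\<close>)

end

section \<open>Consequences of the two bijectivity conditions\<close>

locale cubic_complete_mapping = quadratic_extension q p k K
  for q p k :: nat and K :: "'a::{finite,field} set" +
  fixes f :: "'a \<Rightarrow> 'a"
  assumes cubic: "cubic_map f" and bij_f: "bij f" and bij_f_id: "bij (\<lambda>x. f x + x)"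
begin

lemma f_scale:
  assumes "s \<in> K"
  shows "f (s * x) = s ^ 3 * f x"
proof -
  obtain F0 F1 F2 F3 where F: "\<And>X Y. X \<in> K \<Longrightarrow> Y \<in> K \<Longrightarrow> f (X * x + Y * 0) = cubic_form F0 F1 F2 F3 X Y"
    using cubic unfolding cubic_map_def by blast
  from F[of s 0] F[of 1 0] assms show ?thesis by (simp add: cubic_form_def)
qed

lemma f_eq_iff: "f x = f y \<longleftrightarrow> x = y"
  using bij_f by (simp add: bij_def inj_eq)

lemma f_0: "f 0 = 0"
  using f_scale[of 0 0] by simp

text \<open>On the line \<open>K\<close> itself \<open>f s = s ^ 3 * f 1\<close>, so
  \<open>f\<close> transfers its injectivity to cubing.\<close>

lemma cube_eq_iff:
  assumes "s \<in> K" "t \<in> K"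
  shows "s ^ 3 = t ^ 3 \<longleftrightarrow> s = t"
  using f_scale[OF assms(1), of 1] f_scale[OF assms(2), of 1] f_eq_iff[of s t] by auto

lemma cube_surj:
  assumes "t \<in> K"
  obtains s where "s \<in> K" "t = s ^ 3"
proof -
  have "(\<lambda>s. s ^ 3) ` K = K" by (rule endo_inj_surj) (auto intro!: inj_onI simp: cube_eq_iff)
  then show ?thesis using assms that by (metis imageE)
qed

text \<open>The preimage of \<open>e2\<close> is a root of the first form, and it is
  nonzero.\<close>

lemma root_exists:
  assumes "K_basis e1 e2" "cubic_rep f e1 e2 P0 P1 P2 P3 R0 R1 R2 R3"
  obtains X Y where "X \<in> K" "Y \<in> K" "X \<noteq> 0 \<or> Y \<noteq> 0" "cubic_form P0 P1 P2 P3 X Y = 0"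
proof -
  obtain x where x: "f x = e2" using bij_f by (metis bij_pointE)
  obtain X Y where XY: "X \<in> K" "Y \<in> K" "x = X * e1 + Y * e2" using K_basis_coords[OF assms(1)] .
  have e2: "e2 \<noteq> 0" using assms(1) q_ge_2 by (auto simp: K_basis_def)
  have "cubic_form P0 P1 P2 P3 X Y * e1 + cubic_form R0 R1 R2 R3 X Y * e2 = 0 * e1 + 1 * e2"
    using assms(2) XY x by (simp add: cubic_rep_def)
  then have "cubic_form P0 P1 P2 P3 X Y = 0"
    using K_basis_unique[OF assms(1), of "cubic_form P0 P1 P2 P3 X Y" "cubic_form R0 R1 R2 R3 X Y" 0 1]
      XY assms(2) by (simp add: cubic_rep_def)
  moreover have "X \<noteq> 0 \<or> Y \<noteq> 0" using x e2 XY f_0 by auto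
  ultimately show ?thesis using XY that by blast
qed

text \<open>At its roots the first form sends points into the line of \<open>e2\<close>. Cubing is
  onto \<open>K\<close>, so the multiples of one nonzero root already reach every point of that
  line; a root on another line would violate injectivity.\<close>

lemma root_unique:
  assumes "K_basis e1 e2" "cubic_rep f e1 e2 P0 P1 P2 P3 R0 R1 R2 R3"
    and "X \<in> K" "Y \<in> K" "X' \<in> K" "Y' \<in> K" "cubic_form P0 P1 P2 P3 X Y = 0" "cubic_form P0 P1 P2 P3 X' Y' = 0"
  shows "X * Y' = X' * Y"
proof (cases "X = 0 \<and> Y = 0")
  case False
  define x where "x = X * e1 + Y * e2"
  define x' where "x' = X' * e1 + Y' * e2"
  define R where "R = cubic_form R0 R1 R2 R3 X Y"
  define R' where "R' = cubic_form R0 R1 R2 R3 X' Y'"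
  have fx: "f x = R * e2" "f x' = R' * e2" and RK: "R \<in> K" "R' \<in> K"
    using assms by (auto simp: cubic_rep_def x_def x'_def R_def R'_def)
  have "x \<noteq> 0" using K_basis_zero[OF assms(1,3,4)] False by (auto simp: x_def)
  then have "R \<noteq> 0" using fx f_eq_iff[of x 0] f_0 by auto
  obtain s where s: "s \<in> K" "R' / R = s ^ 3" using cube_surj[of "R' / R"] RK by auto
  have "R' = s ^ 3 * R" using s(2) \<open>R \<noteq> 0\<close> by (simp add: field_simps)
  then have "f (s * x) = f x'" using f_scale[OF s(1)] fx by simp
  then have "(s * X) * e1 + (s * Y) * e2 = X' * e1 + Y' * e2"
    unfolding f_eq_iff by (simp add: x_def x'_def algebra_simps)
  then have "s * X = X' \<and> s * Y = Y'"
    by (intro K_basis_unique[OF assms(1)]) (use assms(3-6) s(1) in auto)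
  then show ?thesis by auto
qed simp

lemma sum_powers_eq_0:
  assumes "K_basis e1 e2" "cubic_rep f e1 e2 P0 P1 P2 P3 R0 R1 R2 R3"
  shows "(\<Sum>X\<in>K. \<Sum>Y\<in>K. cubic_form P0 P1 P2 P3 X Y ^ n) = 0"
    and "(\<Sum>X\<in>K. \<Sum>Y\<in>K. (cubic_form P0 P1 P2 P3 X Y + X) ^ n) = 0"
proof -
  show "(\<Sum>X\<in>K. \<Sum>Y\<in>K. cubic_form P0 P1 P2 P3 X Y ^ n) = 0"
    by (rule sum_K_basis_bij[OF assms(1) bij_f, where B = "cubic_form R0 R1 R2 R3"])
      (use assms(2) in \<open>auto simp: cubic_rep_def\<close>)
  show "(\<Sum>X\<in>K. \<Sum>Y\<in>K. (cubic_form P0 P1 P2 P3 X Y + X) ^ n) = 0"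
    by (rule sum_K_basis_bij[OF assms(1) bij_f_id, where B = "\<lambda>X Y. cubic_form R0 R1 R2 R3 X Y + Y"])
      (use assms(2) in \<open>auto simp: cubic_rep_def algebra_simps\<close>)
qed

text \<open>For \<open>p = 3\<close> the digits \<open>m0 = j0 = 1\<close> give the exponent
  \<open>q - 1\<close>, and the decisive polynomial is \<open>C X\<close>, whose coefficient at
  \<open>p - 1 = 2\<close> is \<open>P2\<close>.\<close>

lemma hessian_coeff_char_3:
  assumes "K_basis e1 e2" "cubic_rep f e1 e2 P0 P1 P2 P3 R0 R1 R2 R3" "p = 3"
  shows "P2 = 0"
proof -
  have nd: "\<not> p dvd (1 + 1 choose 1)" using assms(3) by (auto dest!: dvd_imp_le)
  have "coeff ([:P3, P2, P1, P0:] ^ 1 * [:0, 1:] ^ 1) (p - 1) = 0"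
    by (rule hermite_coeff[OF _ _ _ _ nd])
      (use assms(3) sum_powers_eq_0[OF assms(1,2)] in \<open>simp_all add: homog_cubic homog_linear[simplified]\<close>)
  then show ?thesis using assms(3) by (simp add: numeral_2_eq_2)
qed

end

subsection \<open>Vanishing of the Hessian coefficient\<close>

lemma coeff_quadratic_power:
  fixes \<alpha> c :: "'a::comm_ring_1"
  shows "coeff ([:\<alpha>, 0, c:] ^ m) n =
    (if even n \<and> n div 2 \<le> m then of_nat (m choose (n div 2)) * c ^ (n div 2) * \<alpha> ^ (m - n div 2) else 0)"
proof -
  have "[:\<alpha>, 0, c:] = monom c 2 + [:\<alpha>:]" by (simp add: monom_Suc numeral_2_eq_2 monom_0)
  then have "[:\<alpha>, 0, c:] ^ m = (\<Sum>i\<le>m. of_nat (m choose i) * monom c 2 ^ i * [:\<alpha>:] ^ (m - i))"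
    by (simp only: binomial_ring)
  also have "\<dots> = (\<Sum>i\<le>m. monom (of_nat (m choose i) * c ^ i * \<alpha> ^ (m - i)) (2 * i))"
  proof (rule sum.cong[OF refl])
    fix i
    have "monom c 2 ^ i = monom (c ^ i) (2 * i)" by (simp add: monom_power mult.commute)
    moreover have "[:\<alpha>:] ^ (m - i) = [:\<alpha> ^ (m - i):]" by (simp add: poly_const_pow)
    ultimately show "of_nat (m choose i) * monom c 2 ^ i * [:\<alpha>:] ^ (m - i)
        = monom (of_nat (m choose i) * c ^ i * \<alpha> ^ (m - i)) (2 * i)"
      by (simp add: of_nat_poly smult_monom mult_ac)
  qed
  finally have "coeff ([:\<alpha>, 0, c:] ^ m) n
      = (\<Sum>i\<le>m. if 2 * i = n then of_nat (m choose i) * c ^ i * \<alpha> ^ (m - i) else 0)"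
    by (simp add: coeff_sum)
  also have "\<dots> = (if even n \<and> n div 2 \<le> m then of_nat (m choose (n div 2)) * c ^ (n div 2) * \<alpha> ^ (m - n div 2) else 0)"
  proof (cases "even n")
    case True
    then have "(2 * i = n) = (i = n div 2)" for i by auto
    then show ?thesis using True by (simp add: sum.delta)
  next
    case False
    then show ?thesis by (intro trans[OF sum.neutral]) auto
  qed
  finally show ?thesis .
qed

lemma prime_not_dvd_choose:
  assumes "prime (p::nat)" "m < p" "i \<le> m"
  shows "\<not> p dvd (m choose i)"
proof
  assume "p dvd (m choose i)"
  then have "p dvd fact m" using binomial_fact_lemma[OF assms(3)] by (metis dvd_mult)
  then show False using prime_dvd_fact_iff[OF assms(1)] assms(2) by simp
qed

context quadratic_extension
begin

lemma sum_K_shift: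
  assumes "\<beta> \<in> K"
  shows "(\<Sum>X\<in>K. \<Sum>Y\<in>K. F X Y) = (\<Sum>X\<in>K. \<Sum>Y\<in>K. (F (X - \<beta> * Y) Y :: 'a))"
proof -
  have "(\<Sum>X\<in>K. F X Y) = (\<Sum>X\<in>K. F (X - \<beta> * Y) Y)" if "Y \<in> K" for Y
    by (rule sum.reindex_bij_witness[of _ "\<lambda>X. X - \<beta> * Y" "\<lambda>X. X + \<beta> * Y"]) (use assms that in auto)
  then have "(\<Sum>Y\<in>K. \<Sum>X\<in>K. F X Y) = (\<Sum>Y\<in>K. \<Sum>X\<in>K. F (X - \<beta> * Y) Y)"
    by (rule sum.cong[OF refl])
  then show ?thesis by (subst (1 2) sum.swap)
qed

lemma hermite_quadratic:
  assumes p: "p \<ge> 5" "p mod 3 = 2" and nz: "c \<noteq> 0" "\<alpha> \<noteq> 0"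
    and S0: "\<And>n. (\<Sum>X\<in>K. \<Sum>Y\<in>K. cubic_form 0 c 0 \<alpha> X Y ^ n) = 0"
    and S1: "\<And>n. (\<Sum>X\<in>K. \<Sum>Y\<in>K. (cubic_form 0 c 0 \<alpha> X Y + (\<delta> * X + \<epsilon> * Y)) ^ n) = 0"
  shows "\<epsilon>\<^sup>2 * c = 3 * \<alpha> * \<delta>\<^sup>2"
proof -
  have "odd p" using prime_p p(1) prime_odd_nat[of p] by simp
  then have "p mod 6 = 5" using p(2) by presburger
  then obtain t where t: "p = 6 * t + 5" using mod_div_decomp[of p 6] by (metis mult.commute)
  \<comment> \<open>\<open>m\<close> solves \<open>3 m + 2 = 2 (p - 1)\<close>. The linear form
    enters squared because \<open>p mod 3 = 2\<close> makes 2 the least admissible exponent.\<close>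
  define m where "m = 4 * t + 2"
  have nd: "\<not> p dvd (m + 2 choose 2)"
    by (rule prime_not_dvd_choose[OF prime_p]) (simp_all add: t m_def)
  have "coeff ([:\<alpha>, 0, c, 0:] ^ m * [:\<epsilon>, \<delta>:] ^ 2) (p - 1) = 0"
    by (rule hermite_coeff[OF _ _ _ _ nd])
      (simp_all only: homog_cubic homog_linear S0 S1, simp_all add: t m_def)
  moreover have "p - 1 = Suc (Suc (6 * t + 2))" using t by simp
  moreover have "[:\<epsilon>, \<delta>:] ^ 2 = [:\<epsilon>\<^sup>2, 2 * \<epsilon> * \<delta>, \<delta>\<^sup>2:]" by (simp add: power2_eq_square)
  ultimately have "\<epsilon>\<^sup>2 * coeff ([:\<alpha>, 0, c:] ^ m) (6 * t + 4) + 2 * \<epsilon> * \<delta> * coeff ([:\<alpha>, 0, c:] ^ m) (6 * t + 3)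
      + \<delta>\<^sup>2 * coeff ([:\<alpha>, 0, c:] ^ m) (6 * t + 2) = 0"
    by (simp add: mult.commute[of _ "[:\<epsilon>\<^sup>2, 2 * \<epsilon> * \<delta>, \<delta>\<^sup>2:]"] numeral_eq_Suc algebra_simps)
  moreover have "coeff ([:\<alpha>, 0, c:] ^ m) (6 * t + 4) = of_nat (m choose (3 * t + 2)) * c ^ (3 * t + 2) * \<alpha> ^ t"
  proof -
    have "(6 * t + 4) div 2 = 3 * t + 2" "m - (3 * t + 2) = t" by (simp_all add: m_def)
    then show ?thesis unfolding coeff_quadratic_power by (simp add: m_def)
  qed
  moreover have "coeff ([:\<alpha>, 0, c:] ^ m) (6 * t + 3) = 0"
    unfolding coeff_quadratic_power by simp
  moreover have "coeff ([:\<alpha>, 0, c:] ^ m) (6 * t + 2) = of_nat (m choose (3 * t + 1)) * c ^ (3 * t + 1) * \<alpha> ^ (t + 1)"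
  proof -
    have "(6 * t + 2) div 2 = 3 * t + 1" "m - (3 * t + 1) = t + 1" by (simp_all add: m_def)
    then show ?thesis unfolding coeff_quadratic_power by (simp add: m_def)
  qed
  ultimately have "\<epsilon>\<^sup>2 * (of_nat (m choose (3 * t + 2)) * c ^ (3 * t + 2) * \<alpha> ^ t)
      + \<delta>\<^sup>2 * (of_nat (m choose (3 * t + 1)) * c ^ (3 * t + 1) * \<alpha> ^ (t + 1)) = 0"
    by simp
  then have "(c ^ (3 * t + 1) * \<alpha> ^ t) * (\<epsilon>\<^sup>2 * of_nat (m choose (3 * t + 2)) * c
      + \<delta>\<^sup>2 * of_nat (m choose (3 * t + 1)) * \<alpha>) = 0"
    by (simp add: algebra_simps)
  then have *: "\<epsilon>\<^sup>2 * of_nat (m choose (3 * t + 2)) * c + \<delta>\<^sup>2 * of_nat (m choose (3 * t + 1)) * \<alpha> = 0"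
    using nz by simp
  have "Suc (3 * t + 1) * (m choose Suc (3 * t + 1)) = (m - (3 * t + 1)) * (m choose (3 * t + 1))"
    by (metis binomial_absorb_comp binomial_absorption mult.commute)
  then have "(3 * t + 2) * (m choose (3 * t + 2)) = (t + 1) * (m choose (3 * t + 1))"
    by (simp add: m_def)
  then have B: "of_nat (3 * t + 2) * of_nat (m choose (3 * t + 2)) = (of_nat (t + 1) * of_nat (m choose (3 * t + 1)) :: 'a)"
    by (simp only: of_nat_mult[symmetric])
  have nzb: "of_nat (m choose (3 * t + 1)) \<noteq> (0::'a)"
    unfolding of_nat_eq_0_iff by (rule prime_not_dvd_choose[OF prime_p]) (simp_all add: t m_def)
  \<comment> \<open>In the field \<open>6 t = -5\<close>, so \<open>t + 1 = 1/6\<close> and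
    \<open>3 t + 2 = -1/2\<close>. Their ratio \<open>-3\<close> relates the two neighbouring
    binomial coefficients and is the source of the factor 3.\<close>
  define T where "T = (of_nat t :: 'a)"
  have T: "6 * T + 5 = 0" using of_nat_eq_0_iff[of p] by (simp add: t T_def)
  have B': "(3 * T + 2) * of_nat (m choose (3 * t + 2)) = (T + 1) * of_nat (m choose (3 * t + 1))"
    using B by (simp add: T_def add.commute)
  define b1 b2 where "b1 = (of_nat (m choose (3 * t + 1)) :: 'a)" and "b2 = (of_nat (m choose (3 * t + 2)) :: 'a)"
  have "b1 * (\<epsilon>\<^sup>2 * c * (T + 1) + \<delta>\<^sup>2 * \<alpha> * (3 * T + 2)) = 0"
    using * B' unfolding b1_def[symmetric] b2_def[symmetric] by algebra
  then have "\<epsilon>\<^sup>2 * c * (T + 1) + \<delta>\<^sup>2 * \<alpha> * (3 * T + 2) = 0"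
    using nzb by (simp add: b1_def)
  then show ?thesis using T by algebra
qed

end

context cubic_complete_mapping
begin

text \<open>The form is \<open>Y\<close> times a quadratic form. Completing the square makes its
  powers sparse and turns the added term \<open>X\<close> into \<open>X - \<beta> Y\<close>.\<close>

lemma hessian_coeff_eq_0_normalized:
  assumes "p \<ge> 5" "p mod 3 = 2"
    and bas: "K_basis e1 e2" and rep: "cubic_rep f e1 e2 0 P1 P2 P3 R0 R1 R2 R3"
  shows "P2\<^sup>2 = 3 * P1 * P3"
proof (cases "P1 = 0")
  case True
  \<comment> \<open>The form is now \<open>Y^2 (P2 X + P3 Y)\<close>, and its roots
    \<open>(1, 0)\<close> and \<open>(P3, - P2)\<close> must be proportional.\<close>
  have "1 * (- P2) = P3 * 0"
    by (rule root_unique[OF bas rep])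
      (use rep True in \<open>auto simp: cubic_rep_def cubic_form_def power2_eq_square power3_eq_cube\<close>)
  then show ?thesis using True by simp
next
  case False
  have two: "(2::'a) \<noteq> 0"
    using of_nat_eq_0_iff[of 2] assms(1) by (auto dest: dvd_imp_le)
  have four: "(4::'a) \<noteq> 0" using two by (metis mult_2 mult_eq_0_iff numeral_Bit0)
  define \<beta> where "\<beta> = P2 / (2 * P1)"
  define \<alpha> where "\<alpha> = P3 - P2\<^sup>2 / (4 * P1)"
  have K: "P1 \<in> K" "P2 \<in> K" "P3 \<in> K" "\<beta> \<in> K" using rep by (auto simp: cubic_rep_def \<beta>_def)
  have \<beta>: "P2 = 2 * P1 * \<beta>" using two False by (simp add: \<beta>_def)
  have \<alpha>: "\<alpha> = P3 - P1 * \<beta>\<^sup>2"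
    unfolding \<alpha>_def \<beta> using four False by (simp add: power2_eq_square field_simps)
  have form: "cubic_form 0 P1 P2 P3 (X - \<beta> * Y) Y = cubic_form 0 P1 0 \<alpha> X Y" for X Y
    unfolding cubic_form_def \<alpha> \<beta> by algebra
  \<comment> \<open>Otherwise the quadratic factor is \<open>P1 (X + \<beta> Y)^2\<close>, which
    gives a second root line.\<close>
  have "\<alpha> \<noteq> 0"
  proof
    assume "\<alpha> = 0"
    then have "cubic_form 0 P1 P2 P3 (- \<beta>) 1 = 0" using form[of 0 1] by (simp add: cubic_form_def)
    then have "1 * 1 = - \<beta> * 0" using K by (intro root_unique[OF bas rep]) (auto simp: cubic_form_def)
    then show False by simp
  qed
  moreover have "(\<Sum>X\<in>K. \<Sum>Y\<in>K. cubic_form 0 P1 0 \<alpha> X Y ^ n) = 0" for n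
    using sum_powers_eq_0(1)[OF bas rep, of n] by (subst (asm) sum_K_shift[OF K(4)]) (simp add: form)
  moreover have "(\<Sum>X\<in>K. \<Sum>Y\<in>K. (cubic_form 0 P1 0 \<alpha> X Y + (1 * X + (- \<beta>) * Y)) ^ n) = 0" for n
    using sum_powers_eq_0(2)[OF bas rep, of n] by (subst (asm) sum_K_shift[OF K(4)]) (simp add: form)
  ultimately have "(- \<beta>)\<^sup>2 * P1 = 3 * \<alpha> * 1\<^sup>2" using False assms(1,2) by (intro hermite_quadratic)
  then have "P1 * \<beta>\<^sup>2 = 3 * (P3 - P1 * \<beta>\<^sup>2)" unfolding \<alpha> by (simp add: mult.commute)
  then show ?thesis unfolding \<beta> by algebra
qed

lemma hessian_coeff_eq_0_large_char:
  assumes p: "p \<ge> 5" "p mod 3 = 2"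
    and bas: "K_basis e1 e2" and rep: "cubic_rep f e1 e2 P0 P1 P2 P3 R0 R1 R2 R3"
  shows "P2\<^sup>2 = 3 * P1 * P3"
proof -
  have K: "P0 \<in> K" "P1 \<in> K" "P2 \<in> K" "P3 \<in> K" using rep by (auto simp: cubic_rep_def)
  obtain X Y where XY: "X \<in> K" "Y \<in> K" "X \<noteq> 0 \<or> Y \<noteq> 0" "cubic_form P0 P1 P2 P3 X Y = 0"
    using root_exists[OF bas rep] .
  show ?thesis
  proof (cases "X = 0")
    case True
    then have P3: "P3 = 0" using XY by (simp add: cubic_form_def)
    \<comment> \<open>The root \<open>(0, 1)\<close> cannot be moved to \<open>(1, 0)\<close> by a
      shift. With the variables exchanged, the added term \<open>X\<close> is the second variable,
      so the linear form has \<open>\<delta> = 0\<close> and \<open>\<epsilon> = 1\<close>, which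
      would make \<open>P2\<close> vanish.\<close>
    have "P2 = 0"
    proof (rule ccontr)
      assume nz: "P2 \<noteq> 0"
      have two: "(2::'a) \<noteq> 0"
        using of_nat_eq_0_iff[of 2] p(1) by (auto dest: dvd_imp_le)
      have four: "(4::'a) \<noteq> 0" using two by (metis mult_2 mult_eq_0_iff numeral_Bit0)
      define \<beta> where "\<beta> = P1 / (2 * P2)"
      define \<alpha> where "\<alpha> = P0 - P1\<^sup>2 / (4 * P2)"
      have \<beta>K: "\<beta> \<in> K" using K by (auto simp: \<beta>_def)
      have \<beta>: "P1 = 2 * P2 * \<beta>" using two nz by (simp add: \<beta>_def)
      have \<alpha>: "\<alpha> = P0 - P2 * \<beta>\<^sup>2"
        unfolding \<alpha>_def \<beta> using four nz by (simp add: power2_eq_square field_simps)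
      have form: "cubic_form P0 P1 P2 P3 X (Y - \<beta> * X) = cubic_form 0 P2 0 \<alpha> Y X" for X Y
        unfolding cubic_form_def \<alpha> \<beta> P3 by algebra
      have "\<alpha> \<noteq> 0"
      proof
        assume "\<alpha> = 0"
        then have "cubic_form P0 P1 P2 P3 1 (- \<beta>) = 0" using form[of 1 0] by (simp add: cubic_form_def)
        then have "0 * - \<beta> = 1 * (1::'a)"
          using K \<beta>K P3 by (intro root_unique[OF bas rep]) (auto simp: cubic_form_def)
        then show False by simp
      qed
      moreover have "(\<Sum>Y\<in>K. \<Sum>X\<in>K. cubic_form 0 P2 0 \<alpha> Y X ^ n) = 0" for n
        using sum_powers_eq_0(1)[OF bas rep, of n]
        by (subst (asm) sum.swap, subst (asm) sum_K_shift[OF \<beta>K]) (simp add: form)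
      moreover have "(\<Sum>Y\<in>K. \<Sum>X\<in>K. (cubic_form 0 P2 0 \<alpha> Y X + (0 * Y + 1 * X)) ^ n) = 0" for n
        using sum_powers_eq_0(2)[OF bas rep, of n]
        by (subst (asm) sum.swap, subst (asm) sum_K_shift[OF \<beta>K]) (simp add: form)
      ultimately have "1\<^sup>2 * P2 = 3 * \<alpha> * 0\<^sup>2" using nz p by (intro hermite_quadratic)
      then show False using nz by simp
    qed
    then show ?thesis using P3 by simp
  next
    case False
    \<comment> \<open>The shift by \<open>v\<close> moves the root to \<open>(1, 0)\<close> and
      leaves \<open>P2^2 - 3 P1 P3\<close> unchanged.\<close>
    define v where "v = Y / X"
    have vK: "v \<in> K" using XY by (simp add: v_def)
    have "P0 + v * P1 + v\<^sup>2 * P2 + v ^ 3 * P3 = cubic_form P0 P1 P2 P3 X Y / X ^ 3"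
      unfolding v_def cubic_form_def using False
      by (simp add: field_simps power2_eq_square power3_eq_cube)
    then have z: "P0 + v * P1 + v\<^sup>2 * P2 + v ^ 3 * P3 = 0" using XY by simp
    have "(P2 + 3 * v * P3)\<^sup>2 = 3 * (P1 + 2 * v * P2 + 3 * v\<^sup>2 * P3) * P3"
      by (rule hessian_coeff_eq_0_normalized[OF p K_basis_shift1[OF bas vK] cubic_rep_shift1[OF rep vK, unfolded z]])
    then show ?thesis by algebra
  qed
qed

text \<open>Rescaling the argument by \<open>s\<close> turns \<open>f x + x\<close> into
  \<open>f x + s^2 x\<close>, up to the factor \<open>s ^ 3\<close>; hence the square.\<close>

lemma f_add_square_inj:
  assumes "s \<in> K" "f x + s\<^sup>2 * x = f y + s\<^sup>2 * y"
  shows "x = y"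
proof (cases "s = 0")
  case True
  then show ?thesis using assms f_eq_iff by simp
next
  case False
  have "s ^ 3 * (f (x / s) + x / s) = f x + s\<^sup>2 * x" for x
    using False f_scale[OF assms(1), of "x / s"] by (simp add: algebra_simps power2_eq_square power3_eq_cube)
  then have "s ^ 3 * (f (x / s) + x / s) = s ^ 3 * (f (y / s) + y / s)" using assms(2) by simp
  then have "f (x / s) + x / s = f (y / s) + y / s" using False by simp
  then have "x / s = y / s" by (rule injD[OF bij_is_inj[OF bij_f_id]])
  then show ?thesis using False by simp
qed

text \<open>In even characteristic every element of \<open>K\<close> is a square, so all maps \<open>f x + t x\<close> with \<open>t\<close> in \<open>K\<close> are injective.
  A vanishing first coordinate of \<open>f (x + e2) - f x\<close> would contradict this.\<close>

lemma hessian_coeff_eq_0_char_2: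
  assumes "p = 2"
    and bas: "K_basis e1 e2" and rep: "cubic_rep f e1 e2 P0 P1 P2 P3 R0 R1 R2 R3"
  shows "P2\<^sup>2 = 3 * P1 * P3"
proof -
  have two: "(2::'a) = 0" using of_nat_eq_0_iff[of 2] assms(1) by simp
  have dbl: "x + x = 0" for x :: 'a using two by (metis mult_2 mult_zero_left)
  have K: "P0 \<in> K" "P1 \<in> K" "P2 \<in> K" "P3 \<in> K" "R0 \<in> K" "R1 \<in> K" "R2 \<in> K" "R3 \<in> K"
    using rep by (auto simp: cubic_rep_def)
  have sq: "\<exists>s\<in>K. t = s\<^sup>2" if "t \<in> K" for t
  proof -
    have "even q" using assms(1) k_pos by (simp add: q_eq)
    then have "(t ^ (q div 2))\<^sup>2 = t" using that by (simp add: in_K_iff power_mult[symmetric])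
    then show ?thesis using that by (metis K_power)
  qed
  have ne: "P3 * (Y\<^sup>2 + Y + 1) + P2 * X + P1 * X\<^sup>2 \<noteq> 0" if XY: "X \<in> K" "Y \<in> K" for X Y
  proof
    assume 0: "P3 * (Y\<^sup>2 + Y + 1) + P2 * X + P1 * X\<^sup>2 = 0"
    define r where "r = cubic_form R0 R1 R2 R3 X Y - cubic_form R0 R1 R2 R3 X (Y + 1)"
    obtain s where s: "s \<in> K" "r = s\<^sup>2" using sq[of r] XY K by (auto simp: r_def)
    have "cubic_form P0 P1 P2 P3 X (Y + 1) = cubic_form P0 P1 P2 P3 X Y
        + (P3 * (Y\<^sup>2 + Y + 1) + P2 * X + P1 * X\<^sup>2) + 2 * (P2 * X * Y + P3 * (Y\<^sup>2 + Y))"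
      unfolding cubic_form_def by algebra
    then have "cubic_form P0 P1 P2 P3 X (Y + 1) = cubic_form P0 P1 P2 P3 X Y" using 0 two by simp
    moreover have "f (X * e1 + Z * e2) = cubic_form P0 P1 P2 P3 X Z * e1 + cubic_form R0 R1 R2 R3 X Z * e2"
      if "Z \<in> K" for Z using rep XY that by (simp add: cubic_rep_def)
    note this[of Y] this[of "Y + 1"]
    ultimately have "f (X * e1 + (Y + 1) * e2) = f (X * e1 + Y * e2) - r * e2"
      using XY unfolding r_def by (simp add: left_diff_distrib)
    then have "f (X * e1 + (Y + 1) * e2) + s\<^sup>2 * (X * e1 + (Y + 1) * e2) = f (X * e1 + Y * e2) + s\<^sup>2 * (X * e1 + Y * e2)"
      using s(2) by (simp add: algebra_simps)
    then have "X * e1 + (Y + 1) * e2 = X * e1 + Y * e2" by (rule f_add_square_inj[OF s(1)])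
    then have "X = X \<and> Y + 1 = Y" by (intro K_basis_unique[OF bas]) (use XY in auto)
    then show False by simp
  qed
  have P3: "P3 \<noteq> 0" using ne[of 0 0] by auto
  \<comment> \<open>The image of the Artin-Schreier map is an additive subgroup of index 2 that
    misses 1. By \<open>ne\<close>, \<open>1 + w\<close> with
    \<open>w = (P2 X + P1 X^2) / P3\<close> is never in \<open>I\<close>, so \<open>w\<close> always
    is.\<close>
  define I where "I = (\<lambda>Y. Y\<^sup>2 + Y) ` K"
  have IK: "I \<subseteq> K" by (auto simp: I_def)
  have I_add: "x + y \<in> I" if xy: "x \<in> I" "y \<in> I" for x y
  proof -
    obtain X Y where "X \<in> K" "Y \<in> K" "x = X\<^sup>2 + X" "y = Y\<^sup>2 + Y" using xy by (auto simp: I_def)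
    moreover have "(X + Y)\<^sup>2 + (X + Y) = (X\<^sup>2 + X) + (Y\<^sup>2 + Y) + 2 * (X * Y)" by algebra
    ultimately have "x + y = (X + Y)\<^sup>2 + (X + Y)" using two by simp
    moreover have "X + Y \<in> K" using \<open>X \<in> K\<close> \<open>Y \<in> K\<close> by simp
    ultimately show ?thesis by (auto simp: I_def)
  qed
  have "1 \<notin> I"
  proof
    assume "1 \<in> I"
    then obtain Y where "Y \<in> K" "1 = Y\<^sup>2 + Y" by (auto simp: I_def)
    then show False using ne[of 0 Y] dbl[of 1] by simp
  qed
  have card_I: "q \<le> 2 * card I"
  proof -
    have "q = card (\<Union>z\<in>I. {Y\<in>K. Y\<^sup>2 + Y = z})"
      unfolding card_K[symmetric] by (rule arg_cong[of _ _ card]) (auto simp: I_def)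
    also have "\<dots> \<le> (\<Sum>z\<in>I. card {Y\<in>K. Y\<^sup>2 + Y = z})" by (rule card_UN_le) simp
    also have "\<dots> \<le> (\<Sum>z\<in>I. 2)"
    proof (rule sum_mono)
      fix z assume "z \<in> I"
      then obtain Y0 where Y0: "z = Y0\<^sup>2 + Y0" by (auto simp: I_def)
      have "Y = Y0 \<or> Y = Y0 + 1" if "Y\<^sup>2 + Y = z" for Y
      proof -
        have "(Y - Y0) * (Y - (Y0 + 1)) = (Y\<^sup>2 + Y) - (Y0\<^sup>2 + Y0) + 2 * (Y0\<^sup>2 + Y0 - Y * Y0 - Y)"
          by algebra
        then have "(Y - Y0) * (Y - (Y0 + 1)) = 0" using that Y0 two by simp
        then show ?thesis by auto
      qed
      then have "{Y\<in>K. Y\<^sup>2 + Y = z} \<subseteq> {Y0, Y0 + 1}" by auto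
      then have "card {Y\<in>K. Y\<^sup>2 + Y = z} \<le> card {Y0, Y0 + 1}" by (rule card_mono[rotated]) simp
      also have "\<dots> \<le> 2" by (simp add: card_insert_if)
      finally show "card {Y\<in>K. Y\<^sup>2 + Y = z} \<le> 2" .
    qed
    finally show ?thesis by (simp add: mult.commute)
  qed
  have coset: "1 + w \<in> I" if w: "w \<in> K" "w \<notin> I" for w
  proof -
    have "I \<inter> (+) w ` I = {}"
    proof (rule ccontr)
      assume "I \<inter> (+) w ` I \<noteq> {}"
      then obtain x where x: "x \<in> I" "w + x \<in> I" by auto
      have "w = (w + x) + x" using dbl[of x] by (simp add: add.assoc)
      then show False using I_add[OF x(2,1)] w(2) by metis
    qed
    then have "card (I \<union> (+) w ` I) = card I + card ((+) w ` I)" by (intro card_Un_disjoint) auto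
    also have "card ((+) w ` I) = card I" by (intro card_image) (auto simp: inj_on_def)
    finally have "card (I \<union> (+) w ` I) \<ge> card K" using card_I card_K by simp
    moreover have "I \<union> (+) w ` I \<subseteq> K" using IK w(1) by auto
    ultimately have "I \<union> (+) w ` I = K" by (intro card_seteq) auto
    then have "1 \<in> (+) w ` I" using \<open>1 \<notin> I\<close> K_1 by blast
    then obtain x where "x \<in> I" "1 = w + x" by auto
    moreover from this have "1 + w = x + (w + w)" by algebra
    ultimately show ?thesis by (metis add.right_neutral dbl)
  qed
  have img: "(P2 * X + P1 * X\<^sup>2) / P3 \<in> I" if X: "X \<in> K" for X
  proof (rule ccontr)
    let ?w = "(P2 * X + P1 * X\<^sup>2) / P3"
    assume "?w \<notin> I"
    then have "1 + ?w \<in> I" using K X by (intro coset) auto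
    then obtain Y where Y: "Y \<in> K" "1 + ?w = Y\<^sup>2 + Y" by (auto simp: I_def)
    have "P3 * ?w = P2 * X + P1 * X\<^sup>2" using P3 by simp
    then have "P3 * (Y\<^sup>2 + Y + 1) + P2 * X + P1 * X\<^sup>2 = 2 * (P3 + P3 * ?w)"
      using Y(2) by algebra
    then have "P3 * (Y\<^sup>2 + Y + 1) + P2 * X + P1 * X\<^sup>2 = 0" using two by simp
    then show False using ne X Y(1) by blast
  qed
  \<comment> \<open>Modulo \<open>I\<close> the square \<open>(\<mu> X)^2\<close> may be replaced by
    \<open>\<mu> X\<close>. So \<open>(P2 / P3 + \<mu>) X\<close> lies in \<open>I\<close> for all
    \<open>X\<close> in \<open>K\<close>, which is impossible for a nonzero factor since 1 is not in
    \<open>I\<close>.\<close>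
  obtain \<mu> where \<mu>: "\<mu> \<in> K" "P1 / P3 = \<mu>\<^sup>2" using sq[of "P1 / P3"] K by auto
  have "P2 / P3 + \<mu> = 0"
  proof (rule ccontr)
    assume nz: "P2 / P3 + \<mu> \<noteq> 0"
    define X where "X = 1 / (P2 / P3 + \<mu>)"
    have X: "X \<in> K" using K \<mu> by (simp add: X_def)
    have "(\<mu> * X)\<^sup>2 + \<mu> * X \<in> I" using X \<mu> by (auto simp: I_def)
    from I_add[OF img[OF X] this]
    have "(P2 * X + P1 * X\<^sup>2) / P3 + ((\<mu> * X)\<^sup>2 + \<mu> * X) \<in> I" .
    also have "(P2 * X + P1 * X\<^sup>2) / P3 = P2 / P3 * X + \<mu>\<^sup>2 * X\<^sup>2"
      unfolding \<mu>(2)[symmetric] by (simp add: add_divide_distrib)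
    also have "P2 / P3 * X + \<mu>\<^sup>2 * X\<^sup>2 + ((\<mu> * X)\<^sup>2 + \<mu> * X) = (P2 / P3 + \<mu>) * X + 2 * (\<mu>\<^sup>2 * X\<^sup>2)"
      by algebra
    also have "\<dots> = 1" using nz two by (simp add: X_def)
    finally show False using \<open>1 \<notin> I\<close> by simp
  qed
  then have "(P2 / P3)\<^sup>2 = P1 / P3" using \<mu>(2) by algebra
  then have "P2\<^sup>2 = P1 * P3" using P3 by (simp add: power2_eq_square field_simps)
  moreover have "3 * P1 * P3 = P1 * P3 + 2 * (P1 * P3)" by algebra
  ultimately show ?thesis using two by simp
qed

end

subsection \<open>Characteristic other than 3\<close>

context quadratic_extension
begin

lemma linearized_kernel:
  fixes a b y :: 'a
  assumes "a ^ (q + 1) \<noteq> b ^ (q + 1)" "a * y ^ q + b * y = 0"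
  shows "y = 0"
proof -
  define z u w where "z = y ^ q" and "u = a ^ q" and "w = b ^ q"
  have "(a * y ^ q + b * y) ^ q = 0" using assms(2) q_ge_2 by simp
  then have "u * y + w * z = 0" by (simp add: frob_simps z_def u_def w_def)
  moreover have "a * z + b * y = 0" using assms(2) by (simp add: z_def)
  ultimately have "(a * u - b * w) * y = 0" by algebra
  then show ?thesis using assms(1) by (simp add: u_def w_def)
qed

text \<open>When the norms agree, every value \<open>z\<close> of the map satisfies
  \<open>a z ^ q = b ^ q z\<close>. An injective map would be onto, so this would hold for all
  \<open>z\<close> and force \<open>a = b = 0\<close>.\<close>

lemma linearized_kernel_nontrivial:
  fixes a b :: 'a
  assumes "a ^ (q + 1) = b ^ (q + 1)"
  shows "\<exists>y. y \<noteq> 0 \<and> a * y ^ q + b * y = 0"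
proof (rule ccontr)
  assume *: "\<not> ?thesis"
  have "inj (\<lambda>y. a * y ^ q + b * y)"
  proof (rule injI)
    fix x y assume "a * x ^ q + b * x = a * y ^ q + b * y"
    then have "a * (x - y) ^ q + b * (x - y) = 0" by (simp add: frob_simps algebra_simps)
    then have "x - y = 0" using * by blast
    then show "x = y" by simp
  qed
  then have "surj (\<lambda>y. a * y ^ q + b * y)" by (simp add: finite_UNIV_inj_surj)
  then have img: "\<exists>y. z = a * y ^ q + b * y" for z by (rule surjD)
  have eq: "a * z ^ q = b ^ q * z" for z
  proof -
    obtain y where y: "z = a * y ^ q + b * y" using img by blast
    define w u v where "w = y ^ q" and "u = a ^ q" and "v = b ^ q"
    have "z ^ q = u * y + v * w" by (simp add: y frob_simps w_def u_def v_def)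
    moreover have "a * (u * y + v * w) = v * z"
    proof -
      have "a * u = b * v" using assms by (simp add: u_def v_def)
      moreover have "z = a * w + b * y" using y by (simp add: w_def)
      ultimately show ?thesis by algebra
    qed
    ultimately show ?thesis by (simp add: v_def)
  qed
  have a: "a = b ^ q" using eq[of 1] by simp
  obtain z where "z \<notin> K" using ex_not_K by blast
  moreover have "a * (z ^ q - z) = 0" using eq[of z] a by (simp add: algebra_simps)
  ultimately have "a = 0" by (simp add: in_K_iff)
  then have "b = 0" using a q_ge_2 by simp
  then show False using * \<open>a = 0\<close> by (metis add.right_neutral mult_zero_left zero_neq_one)
qed

text \<open>The linearized polynomial of the conjugacy is the \<open>K\<close>-linear map taking
  \<open>e1\<close>, \<open>e2\<close> to \<open>l1\<close>, \<open>l2\<close>; its coefficients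
  come from Cramer's rule. Two maps with the same coordinate forms in the two bases are then
  conjugate.\<close>

lemma lin_conj_from_basis:
  assumes e: "K_basis e1 e2" and l: "K_basis l1 l2"
    and f: "\<And>X Y. X \<in> K \<Longrightarrow> Y \<in> K \<Longrightarrow>
      \<exists>A\<in>K. \<exists>B\<in>K. f (X * e1 + Y * e2) = A * e1 + B * e2 \<and> A * l1 + B * l2 = g (X * l1 + Y * l2)"
  shows "lin_conj q f g"
proof -
  define D where "D = e1 * e2 ^ q - e1 ^ q * e2"
  have D: "D \<noteq> 0" using e by (simp add: K_basis_def D_def)
  define a where "a = (e1 * l2 - e2 * l1) / D"
  define b where "b = (e2 ^ q * l1 - e1 ^ q * l2) / D"
  define u1 u2 where "u1 = e1 ^ q" and "u2 = e2 ^ q"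
  have aD: "a * D = e1 * l2 - e2 * l1" and bD: "b * D = u2 * l1 - u1 * l2"
    using D by (simp_all add: a_def b_def u1_def u2_def)
  have D': "D = e1 * u2 - u1 * e2" by (simp add: D_def u1_def u2_def)
  have L: "a * (X * e1 + Y * e2) ^ q + b * (X * e1 + Y * e2) = X * l1 + Y * l2" if "X \<in> K" "Y \<in> K" for X Y
  proof -
    have "(X * e1 + Y * e2) ^ q = X * u1 + Y * u2"
      using that by (simp add: frob_simps in_K_iff u1_def u2_def)
    moreover have "D * (a * (X * u1 + Y * u2) + b * (X * e1 + Y * e2)) = D * (X * l1 + Y * l2)"
      using aD bD D' by algebra
    ultimately show ?thesis using D by simp
  qed
  have ne: "a ^ (q + 1) \<noteq> b ^ (q + 1)"
  proof
    assume "a ^ (q + 1) = b ^ (q + 1)"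
    then obtain y where y: "y \<noteq> 0" "a * y ^ q + b * y = 0" using linearized_kernel_nontrivial by blast
    obtain X Y where XY: "X \<in> K" "Y \<in> K" "y = X * e1 + Y * e2" using K_basis_coords[OF e] .
    then have "X * l1 + Y * l2 = 0" using L y by simp
    then show False using K_basis_zero[OF l XY(1,2)] XY(3) y(1) by simp
  qed
  have "f x = (let y = g (a * x ^ q + b * x) in (a * y ^ q - b ^ q * y) / (a ^ (q + 1) - b ^ (q + 1)))" for x
  proof -
    obtain X Y where XY: "X \<in> K" "Y \<in> K" "x = X * e1 + Y * e2" using K_basis_coords[OF e] .
    obtain A B where AB: "A \<in> K" "B \<in> K" "f x = A * e1 + B * e2" "A * l1 + B * l2 = g (X * l1 + Y * l2)"
      using f[OF XY(1,2)] XY(3) by blast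
    define w where "w = f x ^ q"
    have y: "g (a * x ^ q + b * x) = a * w + b * f x"
      using L[OF XY(1,2)] L[OF AB(1,2)] AB XY(3) by (simp add: w_def)
    have "(a * w + b * f x) ^ q = a ^ q * f x + b ^ q * w" by (simp add: frob_simps w_def)
    then have "a * (a * w + b * f x) ^ q - b ^ q * (a * w + b * f x) = (a ^ (q + 1) - b ^ (q + 1)) * f x"
      by (simp add: algebra_simps)
    then show ?thesis unfolding y Let_def using ne by (simp add: field_simps)
  qed
  then show ?thesis unfolding lin_conj_def using ne by blast
qed

lemma cubic_rep_scale:
  assumes "cubic_rep f e1 e2 P0 P1 P2 P3 R0 R1 R2 R3" "t \<in> K" "t \<noteq> 0"
  shows "cubic_rep f e1 (t * e2) P0 (P1 * t) (P2 * t\<^sup>2) (P3 * t ^ 3) (R0 / t) R1 (R2 * t) (R3 * t\<^sup>2)"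
  unfolding cubic_rep_def
proof (intro conjI ballI)
  fix X Y assume XY: "X \<in> K" "Y \<in> K"
  have "f (X * e1 + (Y * t) * e2) = cubic_form P0 P1 P2 P3 X (Y * t) * e1 + cubic_form R0 R1 R2 R3 X (Y * t) * e2"
    using assms XY by (simp add: cubic_rep_def)
  then have "f (X * e1 + Y * (t * e2)) = cubic_form P0 P1 P2 P3 X (Y * t) * e1 + cubic_form R0 R1 R2 R3 X (Y * t) * e2"
    by (simp only: mult.assoc)
  also have "cubic_form P0 P1 P2 P3 X (Y * t) = cubic_form P0 (P1 * t) (P2 * t\<^sup>2) (P3 * t ^ 3) X Y"
    unfolding cubic_form_def by algebra
  also have "cubic_form R0 R1 R2 R3 X (Y * t) = cubic_form (R0 / t) R1 (R2 * t) (R3 * t\<^sup>2) X Y * t"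
    unfolding cubic_form_def using assms(3) by (simp add: field_simps power2_eq_square power3_eq_cube)
  finally show "f (X * e1 + Y * (t * e2)) = cubic_form P0 (P1 * t) (P2 * t\<^sup>2) (P3 * t ^ 3) X Y * e1
      + cubic_form (R0 / t) R1 (R2 * t) (R3 * t\<^sup>2) X Y * (t * e2)" by (simp add: mult.assoc)
qed (use assms in \<open>simp add: cubic_rep_def\<close>)

lemma ex_primitive_cube_root:
  assumes "q mod 3 = 2"
  obtains \<zeta> :: 'a where "\<zeta>\<^sup>2 + \<zeta> + 1 = 0"
proof -
  define N where "N = q\<^sup>2 - 1"
  have q4: "q\<^sup>2 \<ge> 4" using power_mono[OF q_ge_2, of 2] by simp
  obtain j where "q = 3 * j + 2" using assms mod_div_decomp[of q 3] by (metis mult.commute)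
  then have "N = 3 * (3 * j\<^sup>2 + 4 * j + 1)" by (simp add: N_def power2_eq_square algebra_simps)
  then obtain m where m: "N = 3 * m" by blast
  have N: "N > 0" using q4 by (simp add: N_def)
  have m0: "m > 0" using m N by (cases m) auto
  have "\<exists>x::'a. x \<noteq> 0 \<and> x ^ m \<noteq> 1"
  proof (rule ccontr)
    assume "\<not> ?thesis"
    then have "UNIV - {0} \<subseteq> {x::'a. x ^ m = 1}" by auto
    then have "card (UNIV - {0::'a}) \<le> m"
      using card_power_eq_one_le[OF m0, where 'a='a] by (meson card_mono finite order_trans)
    then show False using CARD_eq m N m0 by (simp add: card_Diff_singleton N_def)
  qed
  then obtain x :: 'a where x: "x \<noteq> 0" "x ^ m \<noteq> 1" by blast
  have "x * x ^ N = x"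
    using power_CARD_eq_same[of x] q4 unfolding CARD_eq N_def by (cases "q\<^sup>2") auto
  then have "x ^ N = 1" using x(1) by simp
  then have "(x ^ m) ^ 3 = 1" using m by (simp add: power_mult[symmetric] mult.commute)
  moreover define y where "y = x ^ m"
  ultimately have "y ^ 3 = 1" by simp
  then have "(y - 1) * (y\<^sup>2 + y + 1) = 0" by algebra
  then have "y\<^sup>2 + y + 1 = 0" using x(2) by (simp add: y_def)
  then show ?thesis by (rule that)
qed

end

context cubic_complete_mapping
begin

text \<open>If \<open>q mod 3 = 1\<close>, then \<open>K\<close> contains a nontrivial cube root of
  unity, against the injectivity of cubing.\<close>

lemma q_mod_3: assumes "p \<noteq> 3" shows "q mod 3 = 2"
proof -
  have "q mod 3 \<noteq> 0"
  proof
    assume "q mod 3 = 0"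
    then have "3 dvd p ^ k" using q_eq by (simp add: mod_eq_0_iff_dvd)
    then have "3 dvd p" by (rule prime_dvd_power[rotated]) simp
    then show False using assms prime_p primes_dvd_imp_eq[of 3 p] by simp
  qed
  moreover have "q mod 3 \<noteq> 1"
  proof
    assume "q mod 3 = 1"
    then have "3 dvd (q - 1)" using q_ge_2 by presburger
    then obtain m where m: "q - 1 = 3 * m" by (elim dvdE)
    then have "0 < m" "m < q - 1" using q_ge_2 by (cases m; simp)+
    then obtain x where x: "x \<in> K" "x \<noteq> 0" "x ^ m \<noteq> 1" using ex_K_power_neq_1 by blast
    have "(x ^ m) ^ 3 = 1 ^ 3" using K_fermat[OF x(1,2)] m by (simp add: power_mult[symmetric] mult.commute)
    then show False using cube_eq_iff[of "x ^ m" 1] x by simp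
  qed
  ultimately show ?thesis by presburger
qed

lemma hessian_coeff_eq_0:
  assumes "p \<noteq> 3" "K_basis e1 e2" "cubic_rep f e1 e2 P0 P1 P2 P3 R0 R1 R2 R3"
  shows "P2\<^sup>2 = 3 * P1 * P3"
proof (cases "p = 2")
  case True
  then show ?thesis using hessian_coeff_eq_0_char_2 assms by blast
next
  case False
  have "p \<noteq> 4" using prime_p by auto
  then have p5: "p \<ge> 5" using False assms(1) prime_ge_2_nat[OF prime_p] by linarith
  have "p mod 3 \<noteq> 0"
    using prime_p assms(1) primes_dvd_imp_eq[of 3 p] by (auto simp: mod_eq_0_iff_dvd)
  moreover have "p mod 3 \<noteq> 1"
  proof
    assume "p mod 3 = 1"
    then have "q mod 3 = 1" unfolding q_eq power_mod[of p 3 k, symmetric] by simp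
    then show False using q_mod_3[OF assms(1)] by simp
  qed
  ultimately have "p mod 3 = 2" by presburger
  then show ?thesis using hessian_coeff_eq_0_large_char[OF p5] assms(2,3) by blast
qed

text \<open>The previous lemma for the basis \<open>(e1, e2 - v e1)\<close> is a quartic equation in \<open>v\<close>, valid for all
  \<open>v\<close> in \<open>K\<close>.\<close>

lemma hessian_coeff_equations:
  assumes "p \<noteq> 3" "q > 4" and bas: "K_basis e1 e2" and rep: "cubic_rep f e1 e2 d c b a a' b' c' d'"
  shows "b\<^sup>2 - 3 * a * c = 0" "2 * b * c' - 3 * a * b' - 3 * c * d' + 9 * a * d - b * c = 0"
    "c'\<^sup>2 - 3 * b' * d' + c\<^sup>2 - 3 * b * d + 9 * d * d' + 9 * a * a' - c * c' - b * b' = 0"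
    "2 * b' * c - 3 * a' * b - 3 * c' * d + 9 * a' * d' - b' * c' = 0" "b'\<^sup>2 - 3 * a' * c' = 0"
proof -
  let ?P = "[:b\<^sup>2 - 3 * a * c, 2 * b * c' - 3 * a * b' - 3 * c * d' + 9 * a * d - b * c,
    c'\<^sup>2 - 3 * b' * d' + c\<^sup>2 - 3 * b * d + 9 * d * d' + 9 * a * a' - c * c' - b * b',
    2 * b' * c - 3 * a' * b - 3 * c' * d + 9 * a' * d' - b' * c', b'\<^sup>2 - 3 * a' * c':]"
  have "poly ?P v = poly 0 v" if "v \<in> K" for v
  proof -
    have "(b - 2 * v * c + 3 * v\<^sup>2 * d + v * (c' - 2 * v * b' + 3 * v\<^sup>2 * a'))\<^sup>2
      = 3 * (c - 3 * v * d + v * (b' - 3 * v * a')) * (a - v * b + v\<^sup>2 * c - v ^ 3 * d + v * (d' - v * c' + v\<^sup>2 * b' - v ^ 3 * a'))"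
      by (rule hessian_coeff_eq_0[OF assms(1) K_basis_shift2[OF bas that] cubic_rep_shift2[OF rep that]])
    then show ?thesis unfolding poly_pCons poly_0 by algebra
  qed
  \<comment> \<open>The degree is at most 4 and there are \<open>q > 4\<close> zeros.\<close>
  then have "?P = 0" by (rule poly_eqI_degree[of K]) (use card_K assms(2) in auto)
  then show "b\<^sup>2 - 3 * a * c = 0" "2 * b * c' - 3 * a * b' - 3 * c * d' + 9 * a * d - b * c = 0"
    "c'\<^sup>2 - 3 * b' * d' + c\<^sup>2 - 3 * b * d + 9 * d * d' + 9 * a * a' - c * c' - b * b' = 0"
    "2 * b' * c - 3 * a' * b - 3 * c' * d + 9 * a' * d' - b' * c' = 0" "b'\<^sup>2 - 3 * a' * c' = 0"
    by (simp_all only: pCons_eq_0_iff)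
qed

text \<open>The two forms are \<open>d (X^2 + X Y + Y^2)\<close> times \<open>X - Y\<close> and
  \<open>X + 2 Y\<close>. A shift of \<open>e1\<close> removes the third coefficient of the first
  form, scaling \<open>e2\<close> makes \<open>a'\<close> equal to \<open>d\<close>, and the five
  equations fix the rest.\<close>

lemma normal_form:
  assumes "p \<noteq> 3" "q > 4"
  obtains e1 e2 d where "K_basis e1 e2" "d \<in> K" "d \<noteq> 0"
    "cubic_rep f e1 e2 d 0 0 (- d) d (3 * d) (3 * d) (2 * d)"
proof -
  have three: "(3::'a) \<noteq> 0"
    using of_nat_eq_0_iff[of 3] assms(1) prime_p primes_dvd_imp_eq[of p 3] by auto
  have "(9::'a) = 3 * 3" by simp
  then have nine: "(9::'a) \<noteq> 0" using three by (metis mult_eq_0_iff)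
  have cancel3: "x = y" if "3 * x = 3 * y" for x y :: 'a using three that by simp
  obtain e1 e2 where bas: "K_basis e1 e2" using ex_K_basis .
  obtain P0 P1 P2 P3 R0 R1 R2 R3 where rep: "cubic_rep f e1 e2 P0 P1 P2 P3 R0 R1 R2 R3"
    using cubic_rep_exists[OF cubic bas] by blast
  note E = hessian_coeff_equations[OF assms bas rep]
  have nonzero: "\<not> (P0 = 0 \<and> R0 = 0)" if "K_basis e1 e2" "cubic_rep f e1 e2 P0 P1 P2 P3 R0 R1 R2 R3"
    for e1 e2 P0 P1 P2 P3 R0 R1 R2 R3
  proof
    assume "P0 = 0 \<and> R0 = 0"
    have "f (1 * e1 + 0 * e2) = cubic_form P0 P1 P2 P3 1 0 * e1 + cubic_form R0 R1 R2 R3 1 0 * e2"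
      using that(2) K_0 K_1 unfolding cubic_rep_def by blast
    then have "f e1 = f 0" using \<open>P0 = 0 \<and> R0 = 0\<close> f_0 by (simp add: cubic_form_def)
    then have "e1 = 0" using f_eq_iff by blast
    then show False using that(1) q_ge_2 by (simp add: K_basis_def)
  qed
  \<comment> \<open>If \<open>P3 = 0\<close>, the first equations leave only \<open>P0\<close> of
    the first form, and the next two express the second form by \<open>P0\<close>, \<open>R3\<close>
    and \<open>\<tau>\<close>. The last one becomes \<open>9 P0^2 = 0\<close>, so the first form
    would vanish identically.\<close>
  have "P3 \<noteq> 0"
  proof
    assume P3: "P3 = 0"
    have R3: "R3 \<noteq> 0" using nonzero[OF K_basis_swap[OF bas] cubic_rep_swap[OF rep]] P3 by blast
    have P2: "P2 = 0" using E(1) P3 by simp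
    have "3 * (P1 * R3) = 0" using E(2) P3 P2 by simp
    then have P1: "P1 = 0" using R3 three by simp
    have P0: "P0 \<noteq> 0" using K_basis_unique[OF bas, of 1 0 0 0] root_unique[OF bas rep, of 1 0 0 1]
      by (auto simp: cubic_form_def P1 P2 P3)
    define \<tau> where "\<tau> = R2 / (3 * R3)"
    have \<tau>: "R2 = 3 * R3 * \<tau>" using R3 three by (simp add: \<tau>_def)
    have "3 * R3 * (3 * R3 * \<tau>\<^sup>2 - R1 + 3 * P0) = 0"
      using E(3) P1 P2 P3 \<tau> by algebra
    then have "3 * R3 * \<tau>\<^sup>2 - R1 + 3 * P0 = 0" using R3 three by simp
    then have R1: "R1 = 3 * R3 * \<tau>\<^sup>2 + 3 * P0" by algebra
    have "9 * R3 * (R0 - (2 * \<tau> * P0 + R3 * \<tau> ^ 3)) = 0"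
      using E(4) unfolding P1 P2 P3 \<tau> R1 by (simp add: algebra_simps power2_eq_square power3_eq_cube)
    then have R0: "R0 = 2 * \<tau> * P0 + R3 * \<tau> ^ 3" using R3 nine by simp
    have "9 * P0\<^sup>2 = 0" using E(5) unfolding \<tau> R1 R0 by algebra
    then show False using nine P0 by simp
  qed
  have K: "P2 \<in> K" "P3 \<in> K" using rep by (auto simp: cubic_rep_def)
  define v where "v = - P2 / (3 * P3)"
  have vK: "v \<in> K" using K by (simp add: v_def)
  have v: "P2 + 3 * v * P3 = 0" using three \<open>P3 \<noteq> 0\<close> by (simp add: v_def)
  define f1 where "f1 = e1 + v * e2"
  have bas1: "K_basis f1 e2" unfolding f1_def by (rule K_basis_shift1[OF bas vK])
  obtain d c a' b' c' d' where rep1: "cubic_rep f f1 e2 d c 0 P3 a' b' c' d'"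
    using cubic_rep_shift1[OF rep vK, unfolded v] unfolding f1_def by blast
  define a where "a = P3"
  have a: "a \<noteq> 0" using \<open>P3 \<noteq> 0\<close> by (simp add: a_def)
  note E1 = hessian_coeff_equations[OF assms bas1 rep1, folded a_def]
  have c: "c = 0" using E1(1) three a by simp
  have "3 * a * (b' - 3 * d) = 0" using E1(2) unfolding c by algebra
  then have b': "b' = 3 * d" using three a by simp
  have e2: "c'\<^sup>2 + 9 * a * a' = 0" using E1(3) unfolding c b' by (simp add: algebra_simps)
  have "3 * (3 * d\<^sup>2) = 3 * (a' * c')" using E1(5) unfolding b' by algebra
  then have e4: "3 * d\<^sup>2 = a' * c'" by (rule cancel3)
  have "3 * (3 * a' * d') = 3 * (2 * c' * d)" using E1(4) unfolding c b' by algebra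
  then have e3: "3 * a' * d' = 2 * c' * d" by (rule cancel3)
  have a': "a' \<noteq> 0"
  proof
    assume a'0: "a' = 0"
    then have "d = 0" using e4 three by simp
    then show False using nonzero[OF bas1 rep1] a'0 by simp
  qed
  have d: "d \<noteq> 0"
  proof
    assume "d = 0"
    then have "c' = 0" using e4 a' by simp
    then show False using e2 nine a a' by simp
  qed
  \<comment> \<open>Scaling \<open>e2\<close> by \<open>t\<close> divides \<open>a'\<close> by
    \<open>t\<close>, so this \<open>t\<close> turns it into \<open>d\<close>.\<close>
  define t where "t = a' / d"
  have t: "a' = t * d" using d by (simp add: t_def)
  have "d * (c' * t) = d * (3 * d)" using e4 t by algebra
  then have c': "c' * t = 3 * d" using d by simp
  have "3 * d * (d' * t\<^sup>2) = 3 * d * (2 * d)" using e3 t c' by algebra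
  then have d': "d' * t\<^sup>2 = 2 * d" using d three by (metis mult_cancel_left mult_eq_0_iff)
  have "9 * d * (a * t ^ 3) = 9 * d * (- d)" using e2 t c' by algebra
  then have aa: "a * t ^ 3 = - d" using d nine by (metis mult_cancel_left mult_eq_0_iff)
  have "d \<in> K" "a' \<in> K" using rep1 by (auto simp: cubic_rep_def)
  then have tK: "t \<in> K" "t \<noteq> 0" using d a' by (auto simp: t_def)
  have "cubic_rep f f1 (t * e2) d 0 0 (a * t ^ 3) (a' / t) (3 * d) (c' * t) (d' * t\<^sup>2)"
    using cubic_rep_scale[OF rep1 tK] by (simp add: c b' a_def)
  moreover have "a' / t = d" using tK(2) t by simp
  ultimately have "cubic_rep f f1 (t * e2) d 0 0 (- d) d (3 * d) (3 * d) (2 * d)"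
    by (simp only: aa c' d')
  then show ?thesis using that K_basis_scale[OF bas1 tK] \<open>d \<in> K\<close> d by blast
qed

text \<open>The norm of \<open>X - \<zeta> Y\<close> is \<open>X^2 + X Y + Y^2\<close>, and
  \<open>d (1 - \<zeta>) (X - \<zeta> Y)\<close> has coordinates \<open>d (X - Y)\<close> and
  \<open>d (X + 2 Y)\<close> in the basis \<open>1, - \<zeta>\<close>. As \<open>x ^ (q + 2)\<close>
  is the norm times \<open>x\<close>, this is the normal form; it also dictates the value of
  \<open>\<gamma>\<close>.\<close>

lemma conj_not_char_3:
  assumes "p \<noteq> 3" "q > 4"
  shows "\<exists>\<gamma>::'a. \<gamma> \<noteq> 0 \<and> \<gamma> ^ (2 * q - 2) - \<gamma> ^ (q - 1) + 1 = 0 \<and> lin_conj q f (\<lambda>x. \<gamma> * x ^ (q + 2))"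
proof -
  have three: "(3::'a) \<noteq> 0"
    using of_nat_eq_0_iff[of 3] assms(1) prime_p primes_dvd_imp_eq[of p 3] by auto
  obtain e1 e2 d where bas: "K_basis e1 e2" and d: "d \<in> K" "d \<noteq> 0"
    and rep: "cubic_rep f e1 e2 d 0 0 (- d) d (3 * d) (3 * d) (2 * d)" using normal_form[OF assms] .
  obtain \<zeta> :: 'a where z: "\<zeta>\<^sup>2 + \<zeta> + 1 = 0" using ex_primitive_cube_root[OF q_mod_3[OF assms(1)]] .
  have z1: "\<zeta> \<noteq> 1" using z three by auto
  have z3: "\<zeta> ^ 3 = 1" using z by algebra
  have "\<zeta> \<notin> K" using cube_eq_iff[of \<zeta> 1] z3 z1 by auto
  define \<xi> where "\<xi> = \<zeta> ^ q"
  have "(\<zeta>\<^sup>2 + \<zeta> + 1) ^ q = 0" using z q_ge_2 by simp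
  then have "\<xi>\<^sup>2 + \<xi> + 1 = 0" by (simp add: frob_simps frob_power \<xi>_def)
  then have "(\<xi> - \<zeta>) * (\<xi> - \<zeta>\<^sup>2) = 0" using z by algebra
  moreover have "\<xi> \<noteq> \<zeta>" using \<open>\<zeta> \<notin> K\<close> by (simp add: in_K_iff \<xi>_def)
  ultimately have \<xi>: "\<zeta> ^ q = \<zeta>\<^sup>2" by (simp add: \<xi>_def)
  have l: "K_basis 1 (- \<zeta>)" using \<open>\<zeta> \<notin> K\<close> by (simp add: K_basis_def in_K_iff frob_simps)
  define \<gamma> where "\<gamma> = d * (1 - \<zeta>)"
  have g0: "\<gamma> \<noteq> 0" using d z1 by (simp add: \<gamma>_def)
  have "\<gamma> ^ q = d * (1 - \<zeta>\<^sup>2)" using d(1) by (simp add: \<gamma>_def frob_simps \<xi> in_K_iff)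
  also have "d * (1 - \<zeta>\<^sup>2) = \<gamma> * (1 + \<zeta>)" unfolding \<gamma>_def by algebra
  finally have "\<gamma> ^ q = \<gamma> * (1 + \<zeta>)" .
  moreover have "\<gamma> ^ q = \<gamma> * \<gamma> ^ (q - 1)" using q_ge_2 by (metis power_eq_if not_numeral_le_zero)
  ultimately have g1: "\<gamma> ^ (q - 1) = 1 + \<zeta>" using g0 by simp
  have "2 * q - 2 = (q - 1) * 2" by simp
  then have "\<gamma> ^ (2 * q - 2) = (\<gamma> ^ (q - 1))\<^sup>2" by (simp only: power_mult)
  moreover have "(1 + \<zeta>)\<^sup>2 - (1 + \<zeta>) + 1 = 0" using z by algebra
  ultimately have "\<gamma> ^ (2 * q - 2) - \<gamma> ^ (q - 1) + 1 = 0" unfolding g1 by simp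
  moreover have "lin_conj q f (\<lambda>x. \<gamma> * x ^ (q + 2))"
  proof (rule lin_conj_from_basis[OF bas l])
    fix X Y assume XY: "X \<in> K" "Y \<in> K"
    define A where "A = cubic_form d 0 0 (- d) X Y"
    define B where "B = cubic_form d (3 * d) (3 * d) (2 * d) X Y"
    have AB: "A \<in> K" "B \<in> K" "f (X * e1 + Y * e2) = A * e1 + B * e2"
      using rep XY by (auto simp: cubic_rep_def A_def B_def)
    have "(X * 1 + Y * - \<zeta>) ^ q = X - Y * \<zeta>\<^sup>2" using XY by (simp add: frob_simps \<xi> in_K_iff)
    then have "(X * 1 + Y * - \<zeta>) ^ (q + 2) = (X - Y * \<zeta>\<^sup>2) * (X - Y * \<zeta>)\<^sup>2"
      by (simp add: power_add power2_eq_square)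
    moreover have "A * 1 + B * - \<zeta> = \<gamma> * ((X - Y * \<zeta>\<^sup>2) * (X - Y * \<zeta>)\<^sup>2)"
      using z unfolding A_def B_def cubic_form_def \<gamma>_def by algebra
    ultimately show "\<exists>A\<in>K. \<exists>B\<in>K. f (X * e1 + Y * e2) = A * e1 + B * e2 \<and> A * 1 + B * - \<zeta> = \<gamma> * (X * 1 + Y * - \<zeta>) ^ (q + 2)"
      using AB by auto
  qed
  ultimately show ?thesis using g0 by blast
qed

end

subsection \<open>Quartics without square values\<close>

lemma degree_pderiv_le: "degree (pderiv p) \<le> degree p - 1"
  by (rule degree_le) (auto simp: coeff_pderiv coeff_eq_0)

text \<open>Squaring is at most two-to-one, so \<open>M\<close> has at least \<open>m\<close>
  squares. All of them are roots of \<open>x ^ m = 1\<close>, which has no more than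
  \<open>m\<close> solutions.\<close>

lemma square_if_power_eq_1:
  fixes M :: "'a::{finite,field} set"
  assumes "card M = 2 * m" "m > 0" and M: "\<And>y. y \<in> M \<Longrightarrow> y ^ (2 * m) = 1" and "x ^ m = 1"
  shows "\<exists>y\<in>M. x = y\<^sup>2"
proof -
  let ?S = "(\<lambda>y. y\<^sup>2) ` M"
  have "2 * m = card (\<Union>z\<in>?S. {y\<in>M. y\<^sup>2 = z})"
    unfolding assms(1)[symmetric] by (rule arg_cong[of _ _ card]) auto
  also have "\<dots> \<le> (\<Sum>z\<in>?S. card {y\<in>M. y\<^sup>2 = z})" by (rule card_UN_le) simp
  also have "\<dots> \<le> (\<Sum>z\<in>?S. 2)"
  proof (rule sum_mono)
    fix z assume "z \<in> ?S"
    then obtain y0 where y0: "z = y0\<^sup>2" by auto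
    then have "{y\<in>M. y\<^sup>2 = z} \<subseteq> {y0, - y0}" by (auto simp: power2_eq_iff)
    then have "card {y\<in>M. y\<^sup>2 = z} \<le> card {y0, - y0}" by (rule card_mono[rotated]) simp
    also have "\<dots> \<le> 2" by (simp add: card_insert_if)
    finally show "card {y\<in>M. y\<^sup>2 = z} \<le> 2" .
  qed
  finally have "m \<le> card ?S" by simp
  moreover have "?S \<subseteq> {x. x ^ m = 1}" using M by (auto simp: power_mult[symmetric])
  ultimately have "?S = {x. x ^ m = 1}"
    using card_power_eq_one_le[OF assms(2), where 'a='a] by (intro card_seteq) auto
  then show ?thesis using assms(4) by blast
qed

context quadratic_extension
begin

lemma nonsquare_power_eq:
  assumes "odd q" "x \<in> K" "x \<noteq> 0" "\<And>y. y \<in> K \<Longrightarrow> x \<noteq> y\<^sup>2"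
  shows "x ^ ((q - 1) div 2) = - 1"
proof -
  define m where "m = (q - 1) div 2"
  have m: "q - 1 = 2 * m" using assms(1) by (simp add: m_def)
  have "m > 0" using m q_ge_2 by simp
  have "(x ^ m)\<^sup>2 = 1" using K_fermat[OF assms(2,3)] unfolding m by (simp add: power_mult mult.commute)
  moreover have "x ^ m \<noteq> 1"
  proof
    assume "x ^ m = 1"
    moreover have "card (K - {0}) = 2 * m" using card_K m by (simp add: card_Diff_singleton)
    moreover have "y ^ (2 * m) = 1" if "y \<in> K - {0}" for y using K_fermat[of y] that m by simp
    ultimately obtain y where "y \<in> K - {0}" "x = y\<^sup>2"
      using square_if_power_eq_1[OF _ \<open>m > 0\<close>, of "K - {0}" x] by auto
    then show False using assms(4) by blast
  qed
  ultimately show ?thesis unfolding m_def[symmetric] by (simp add: power2_eq_1_iff)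
qed

text \<open>\<open>(q^2 - 1) / 2\<close> is a multiple of \<open>q - 1\<close>, so nonzero elements
  of \<open>K\<close> pass Euler's criterion in the larger field.\<close>

lemma K_square_in_extension:
  assumes "odd q" "x \<in> K"
  shows "\<exists>y. x = y\<^sup>2"
proof (cases "x = 0")
  case False
  obtain m where m: "q = 2 * m + 1" using assms(1) by (elim oddE)
  define n where "n = (q - 1) * (m + 1)"
  have "q\<^sup>2 - 1 = 2 * n" unfolding n_def m by (simp add: power2_eq_square algebra_simps)
  have "n > 0" using q_ge_2 by (simp add: n_def)
  have "card (UNIV - {0::'a}) = 2 * n" using CARD_eq \<open>q\<^sup>2 - 1 = 2 * n\<close> by (simp add: card_Diff_singleton)
  moreover have "y ^ (2 * n) = 1" if "y \<in> UNIV - {0}" for y :: 'a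
  proof -
    have "y * y ^ (q\<^sup>2 - 1) = y" using power_CARD_eq_same[of y] q_ge_2 unfolding CARD_eq by (cases "q\<^sup>2") auto
    then show ?thesis using that \<open>q\<^sup>2 - 1 = 2 * n\<close> by simp
  qed
  moreover have "x ^ n = 1" unfolding n_def power_mult using K_fermat[OF assms(2) False] by simp
  ultimately show ?thesis using square_if_power_eq_1[OF _ \<open>n > 0\<close>, of "UNIV - {0}" x] by blast
qed auto

text \<open>Stepanov's method: a quartic that takes only nonsquare values on \<open>K\<close> satisfies a
  differential equation, because \<open>G\<close> to the power \<open>(q - 1) / 2\<close> is \<open>-1\<close> on \<open>K\<close>.\<close>

lemma nonsquare_quartic_ode:
  fixes G :: "'a poly"
  assumes "odd q" "q > 6" "degree G \<le> 4" and G: "\<And>v. v \<in> K \<Longrightarrow> poly G v ^ ((q - 1) div 2) = - 1"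
  obtains T where "degree T \<le> 2" "2 * pderiv G ^ 2 = G * T"
proof -
  define m where "m = (q - 1) div 2"
  have m: "q - 1 = 2 * m" using assms(1) by (simp add: m_def)
  have m0: "m > 0" using m assms(2) by simp
  define h where "h = G ^ m"
  define Z where "Z = monom 1 q - [:0, 1:: 'a:]"
  have cZ: "coeff Z q = 1" using q_ge_2 by (auto simp: Z_def coeff_pCons split: nat.split)
  have "degree Z \<le> q" unfolding Z_def using q_ge_2 by (intro degree_diff_le) (auto simp: degree_monom_le)
  then have degZ: "degree Z = q" using cZ le_degree[of Z q] by simp
  then have Z0: "Z \<noteq> 0" using q_ge_2 by auto
  have polyZ: "poly Z v = 0" if "v \<in> K" for v using that by (simp add: Z_def poly_monom in_K_iff)
  define kk where "kk = (h + 1) div Z"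
  define rr where "rr = (h + 1) mod Z"
  have dm: "h + 1 = kk * Z + rr" unfolding kk_def rr_def by simp
  have "rr = 0"
  proof (rule ccontr)
    assume "rr \<noteq> 0"
    then have "degree rr < q" using degree_mod_less[OF Z0, of "h + 1"] degZ by (auto simp: rr_def)
    moreover have "poly rr v = poly 0 v" if "v \<in> K" for v
    proof -
      have "poly (h + 1) v = poly (kk * Z + rr) v" using dm by simp
      then show ?thesis using G[OF that] polyZ[OF that] by (simp add: h_def m_def)
    qed
    ultimately have "rr = 0" by (intro poly_eqI_degree[of K]) (auto simp: card_K)
    then show False using \<open>rr \<noteq> 0\<close> by simp
  qed
  then have hk: "h = Z * kk - 1" using dm by (simp add: algebra_simps)
  have degh: "degree h \<le> 2 * (q - 1)"
    unfolding h_def m using order_trans[OF degree_power_le[of G m] mult_le_mono1[OF assms(3)]] by simp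
  have degk: "degree kk \<le> q - 2 \<or> kk = 0"
  proof (rule disjCI)
    assume "kk \<noteq> 0"
    then have "q + degree kk = degree (Z * kk)" using Z0 degZ by (simp add: degree_mult_eq)
    also have "Z * kk = h + 1" using hk by simp
    also have "degree (h + 1) \<le> 2 * (q - 1)" using degh by (intro degree_add_le) auto
    finally show "degree kk \<le> q - 2" by linarith
  qed
  have dZ: "pderiv Z = - 1"
    unfolding Z_def by (simp add: pderiv_diff pderiv_monom of_nat_q pderiv_pCons one_pCons)
  define G1 where "G1 = pderiv G"
  define G2 where "G2 = pderiv G1"
  define k1 where "k1 = pderiv kk"
  have d1: "pderiv h = smult (of_nat m) (G ^ (m - 1)) * G1"
    unfolding h_def G1_def using pderiv_power_Suc[of G "m - 1"] m0 by simp
  have Gh: "h = G * G ^ (m - 1)" unfolding h_def using m0 by (metis power_eq_if not_gr_zero)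
  have d2: "pderiv h = Z * k1 - kk"
    unfolding hk by (simp add: pderiv_diff pderiv_mult dZ k1_def algebra_simps)
  \<comment> \<open>Multiplying the derivative of \<open>G ^ m\<close> by \<open>G\<close> restores
    \<open>h\<close> itself. With \<open>2 m = -1\<close> in the field and
    \<open>h = Z kk - 1\<close>, the result is a congruence modulo \<open>Z\<close> whose cofactor
    \<open>r\<close> has degree at most 2.\<close>
  have "G * (Z * k1 - kk) = G * (smult (of_nat m) (G ^ (m - 1)) * G1)" using d1 d2 by simp
  also have "\<dots> = smult (of_nat m) (h * G1)" unfolding Gh by (simp add: mult.assoc)
  finally have "G * (Z * k1 - kk) = smult (of_nat m) (h * G1)" .
  moreover have "2 * of_nat m = (-1 :: 'a)"
  proof -
    have "2 * of_nat m = (of_nat (q - 1) :: 'a)" unfolding m by simp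
    also have "\<dots> = - 1" using of_nat_q q_ge_2 by (simp add: of_nat_diff)
    finally show ?thesis .
  qed
  ultimately have "2 * (G * (Z * k1 - kk)) = - (h * G1)"
    by (simp add: numeral_poly mult.commute[of "of_nat m"])
  then have "2 * (G * (Z * k1 - kk)) + (Z * kk - 1) * G1 = 0" unfolding hk by simp
  then have star: "Z * (2 * G * k1 + kk * G1) = 2 * G * kk + G1" by algebra
  define r where "r = 2 * G * k1 + kk * G1"
  define r1 where "r1 = pderiv r"
  have degG1: "degree G1 \<le> 3" unfolding G1_def using degree_pderiv_le[of G] assms(3) by linarith
  have degG2: "degree G2 \<le> 2" unfolding G2_def using degree_pderiv_le[of G1] degG1 by linarith
  have degr: "degree r \<le> 2"
  proof (cases "r = 0")
    case False
    have "degree (2 * G * kk) \<le> q + 2"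
    proof (cases "kk = 0")
      case nz: False
      have "degree (2 * G * kk) \<le> degree (2 * G) + degree kk" by (rule degree_mult_le)
      also have "degree (2 * G) \<le> 4" using degree_mult_le[of 2 G] assms(3) by simp
      finally show ?thesis using degk nz assms(2) by linarith
    qed simp
    moreover have "degree G1 \<le> q + 2" using degG1 assms(2) by linarith
    ultimately have "degree (Z * r) \<le> q + 2" unfolding star[folded r_def] by (intro degree_add_le)
    then show ?thesis using False Z0 degZ by (simp add: degree_mult_eq)
  qed simp
  have "pderiv (Z * r) = pderiv (2 * G * kk + G1)" using star by (simp add: r_def)
  then have diff: "Z * r1 - r = 2 * (G1 * kk + G * k1) + G2"
    by (simp add: pderiv_mult pderiv_add dZ r1_def G1_def[symmetric] G2_def[symmetric] k1_def[symmetric] algebra_simps)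
  \<comment> \<open>The unknown quotient \<open>kk\<close> and its derivative are eliminated between
    \<open>star\<close> and its derivative. The left side is a multiple of \<open>Z\<close>, of
    degree \<open>q\<close>; the right side has degree at most 6, so both vanish.\<close>
  have main: "Z * (G1 * r - 2 * G * r1) = G1\<^sup>2 - 2 * G * G2 - 4 * G * r"
    using diff star[folded r_def] r_def by algebra
  have "degree (G1\<^sup>2 - 2 * G * G2 - 4 * G * r) \<le> 6"
  proof (intro degree_diff_le)
    show "degree (G1\<^sup>2) \<le> 6" using degree_power_le[of G1 2] degG1 by linarith
    have "degree (2 * G) \<le> 4" using degree_mult_le[of 2 G] assms(3) by simp
    then show "degree (2 * G * G2) \<le> 6" using degree_mult_le[of "2 * G" G2] degG2 by linarith
    have "degree (4 * G) \<le> 4" using degree_mult_le[of 4 G] assms(3) by simp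
    then show "degree (4 * G * r) \<le> 6" using degree_mult_le[of "4 * G" r] degr by linarith
  qed
  then have "G1 * r - 2 * G * r1 = 0"
    unfolding main[symmetric] using Z0 degZ assms(2)
    by (metis degree_mult_eq le_add1 le_trans not_le)
  then have "G1\<^sup>2 - 2 * G * G2 - 4 * G * r = 0" using main by simp
  then have "2 * G1\<^sup>2 = G * (4 * G2 + 8 * r)" by algebra
  moreover have "degree (4 * G2 + 8 * r) \<le> 2"
    using degree_mult_le[of 4 G2] degree_mult_le[of 8 r] degG2 degr
    by (intro degree_add_le) (simp_all add: numeral_poly)
  ultimately show ?thesis using that unfolding G1_def by blast
qed

end

subsection \<open>Characteristic 3\<close>

context cubic_complete_mapping
begin

text \<open>The same vanishing coefficient is read in three bases: the given one, the swapped one,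
  and the one with \<open>e2 - e1\<close> in place of \<open>e2\<close>.\<close>

lemma char_3_rep:
  assumes "p = 3" and bas: "K_basis e1 e2" and rep: "cubic_rep f e1 e2 P0 P1 P2 P3 R0 R1 R2 R3"
  shows "P2 = 0" "R1 = 0" "R2 = - P1"
proof -
  have three: "(3::'a) = 0" using of_nat_eq_0_iff[of 3] assms(1) by simp
  show P2: "P2 = 0" by (rule hessian_coeff_char_3[OF bas rep assms(1)])
  show R1: "R1 = 0" by (rule hessian_coeff_char_3[OF K_basis_swap[OF bas] cubic_rep_swap[OF rep] assms(1)])
  have "P2 - 2 * 1 * P1 + 3 * 1\<^sup>2 * P0 + 1 * (R2 - 2 * 1 * R1 + 3 * 1\<^sup>2 * R0) = 0"
    by (rule hessian_coeff_char_3[OF K_basis_shift2[OF bas K_1] cubic_rep_shift2[OF rep K_1] assms(1)])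
  then have "R2 = 2 * P1" using three P2 R1 by simp
  moreover have "2 * P1 = - P1 + 3 * P1" by algebra
  ultimately show "R2 = - P1" using three by simp
qed

text \<open>In characteristic 3 the expression \<open>a Y^3 + c X^2 Y\<close> is additive in
  \<open>Y\<close>. A solution \<open>s\<close> in \<open>K\<close> of \<open>a s^2 + c = 0\<close>
  puts \<open>s X\<close> into its kernel, so a root \<open>(X, Y)\<close> would yield the second
  root \<open>(X, Y + s X)\<close>.\<close>

lemma char_3_nonsquare:
  assumes "p = 3" and bas: "K_basis e1 e2" and rep: "cubic_rep f e1 e2 d c 0 a R0 R1 R2 R3" and "c \<noteq> 0"
  shows "a \<noteq> 0" "y \<in> K \<Longrightarrow> - c * a \<noteq> y\<^sup>2"
proof -
  have three: "(3::'a) = 0" using of_nat_eq_0_iff[of 3] assms(1) by simp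
  have K: "d \<in> K" "c \<in> K" "a \<in> K" using rep by (auto simp: cubic_rep_def)
  show a: "a \<noteq> 0"
  proof
    assume "a = 0"
    then have "0 * - d = c * 1"
      using K by (intro root_unique[OF bas rep]) (auto simp: cubic_form_def power2_eq_square power3_eq_cube)
    then show False using assms(4) by simp
  qed
  show "- c * a \<noteq> y\<^sup>2" if y: "y \<in> K"
  proof
    assume y2: "- c * a = y\<^sup>2"
    define s where "s = y / a"
    have sK: "s \<in> K" using y K by (simp add: s_def)
    have ys: "y = s * a" using a by (simp add: s_def)
    have "a * (a * s\<^sup>2 + c) = 0" using y2 unfolding ys by algebra
    then have s: "a * s\<^sup>2 + c = 0" using a by simp
    obtain X Y where XY: "X \<in> K" "Y \<in> K" "X \<noteq> 0 \<or> Y \<noteq> 0" "cubic_form d c 0 a X Y = 0"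
      using root_exists[OF bas rep] .
    have X: "X \<noteq> 0" using XY a by (auto simp: cubic_form_def)
    have "cubic_form d c 0 a X (Y + s * X)
        = cubic_form d c 0 a X Y + s * X ^ 3 * (a * s\<^sup>2 + c) + 3 * (a * (Y\<^sup>2 * s * X + Y * s\<^sup>2 * X\<^sup>2))"
      unfolding cubic_form_def by algebra
    then have "cubic_form d c 0 a X (Y + s * X) = 0" using XY s three by simp
    then have "X * (Y + s * X) = X * Y" using XY sK by (intro root_unique[OF bas rep]) auto
    then have "s = 0" using X by (simp add: algebra_simps)
    then show False using s assms(4) by simp
  qed
qed

text \<open>The quartic is the coefficient of \<open>Y^3\<close> in the first form for the basis
  \<open>e1, e2 - v e1\<close>, while the coefficient \<open>c\<close> of \<open>X^2 Y\<close> does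
  not change with \<open>v\<close>.\<close>

lemma char_3_quartic:
  assumes "p = 3" and bas: "K_basis e1 e2" and rep: "cubic_rep f e1 e2 d c 0 a a' 0 (- c) d'" and c: "c \<noteq> 0"
    and v: "v \<in> K"
  shows "(- c * (a + d' * v + 2 * c * v\<^sup>2 - d * v ^ 3 - a' * v ^ 4)) ^ ((q - 1) div 2) = - 1"
proof -
  have three: "(3::'a) = 0" using of_nat_eq_0_iff[of 3] assms(1) by simp
  have K: "d \<in> K" "c \<in> K" "a \<in> K" "a' \<in> K" "d' \<in> K" using rep by (auto simp: cubic_rep_def)
  define H where "H = a + d' * v + 2 * c * v\<^sup>2 - d * v ^ 3 - a' * v ^ 4"
  have HK: "H \<in> K" using K v by (simp add: H_def)
  note rep' = cubic_rep_shift2[OF rep v] and bas' = K_basis_shift2[OF bas v]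
  have e: "c - 3 * v * d + v * (0 - 3 * v * a') = c" using three by simp
  have "a - v * 0 + v\<^sup>2 * c - v ^ 3 * d + v * (d' - v * - c + v\<^sup>2 * 0 - v ^ 3 * a') = H"
    unfolding H_def by (simp add: algebra_simps power2_eq_square power3_eq_cube power4_eq_xxxx)
  note rep'' = rep'[unfolded this e char_3_rep(1)[OF assms(1) bas' rep']]
  have "odd q" using assms(1) by (simp add: q_eq)
  then show ?thesis unfolding H_def[symmetric]
    using char_3_nonsquare[OF assms(1) bas' rep'' c] HK K c by (intro nonsquare_power_eq) auto
qed

text \<open>The two relations say that \<open>a + d' v + 2 c v^2 - d v^3 - a' v^4\<close> is a constant times a square.\<close>

lemma char_3_relations:
  assumes "p = 3" and bas: "K_basis e1 e2" and rep: "cubic_rep f e1 e2 d c 0 a a' 0 (- c) d'" and c: "c \<noteq> 0"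
    and a': "a' \<noteq> 0"
  shows "a'\<^sup>2 * d' + 2 * c * d * a' + d ^ 3 = 0" "a' * (c\<^sup>2 + a * a' - d * d') + 2 * c * d\<^sup>2 = 0"
proof -
  have three: "(3::'a) = 0" using of_nat_eq_0_iff[of 3] assms(1) by simp
  have two: "(2::'a) \<noteq> 0" using of_nat_eq_0_iff[of 2] assms(1) by (auto dest: dvd_imp_le)
  have K: "d \<in> K" "c \<in> K" "a \<in> K" "a' \<in> K" "d' \<in> K" using rep by (auto simp: cubic_rep_def)
  have odd_q: "odd q" using assms(1) by (simp add: q_eq)
  note quart = char_3_quartic[OF assms(1) bas rep c]
  have "a'\<^sup>2 * d' + 2 * c * d * a' + d ^ 3 = 0 \<and> a' * (c\<^sup>2 + a * a' - d * d') + 2 * c * d\<^sup>2 = 0"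
  \<comment> \<open>For \<open>q = 3\<close>, too small for Stepanov's method, the exponent
    \<open>(q - 1) / 2\<close> is 1, and the values at \<open>0\<close>, \<open>1\<close> and
    \<open>-1\<close> give \<open>a = c\<close>, \<open>d' = d\<close> and
    \<open>a' = - c\<close>.\<close>
  proof (cases "k = 1")
    case True
    then have q3: "q = 3" using assms(1) q_eq by simp
    have "c\<^sup>2 = 1" using K_fermat[OF K(2) c] by (simp add: q3)
    have "- c * a = - 1" using quart[of 0] by (simp add: q3)
    then have ac: "a = c" using \<open>c\<^sup>2 = 1\<close> by algebra
    have v1: "- c * (a + d' + 2 * c - d - a') = - 1" using quart[of 1] by (simp add: q3)
    have v2: "- c * (a - d' + 2 * c + d - a') = - 1" using quart[of "-1"] by (simp add: q3)
    have "2 * (c * (d' - d)) = 0" using v1 v2 by algebra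
    then have dd: "d' = d" using two c by simp
    have "c * a' = 3 * c\<^sup>2 - 1" using v1 unfolding dd ac by algebra
    then have "c * a' = - 1" using three by simp
    then have a'c: "a' = - c" using \<open>c\<^sup>2 = 1\<close> by algebra
    have "d ^ 3 = d" using K(1) by (simp add: in_K_iff q3)
    show ?thesis
    proof
      have "a'\<^sup>2 * d' + 2 * c * d * a' + d ^ 3 = c\<^sup>2 * d - 2 * c\<^sup>2 * d + d ^ 3"
        unfolding dd a'c by algebra
      then show "a'\<^sup>2 * d' + 2 * c * d * a' + d ^ 3 = 0" using \<open>c\<^sup>2 = 1\<close> \<open>d ^ 3 = d\<close> by simp
      have "a' * (c\<^sup>2 + a * a' - d * d') + 2 * c * d\<^sup>2 = 3 * (c * d\<^sup>2)"
        unfolding dd a'c ac by algebra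
      then show "a' * (c\<^sup>2 + a * a' - d * d') + 2 * c * d\<^sup>2 = 0" using three by simp
    qed
  next
    case False
    then have "k \<ge> 2" using k_pos by linarith
    then have "(3::nat) ^ 2 \<le> 3 ^ k" by (intro power_increasing) auto
    then have q9: "q \<ge> 9" using assms(1) q_eq by simp
    define G where "G = [:- c * a, - c * d', - c * (2 * c), c * d, c * a':]"
    have polyG: "poly G v = - c * (a + d' * v + 2 * c * v\<^sup>2 - d * v ^ 3 - a' * v ^ 4)" for v
      unfolding G_def by (simp add: algebra_simps power2_eq_square power3_eq_cube power4_eq_xxxx)
    have qG: "poly G v ^ ((q - 1) div 2) = - 1" if "v \<in> K" for v
      unfolding polyG by (rule quart[OF that])
    have "degree G \<le> 4" "q > 6" using q9 by (simp_all add: G_def)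
    then obtain T where T: "degree T \<le> 2" "2 * pderiv G ^ 2 = G * T"
      using nonsquare_quartic_ode[OF odd_q _ _ qG] by blast
    define t0 t1 t2 where "t0 = coeff T 0" and "t1 = coeff T 1" and "t2 = coeff T 2"
    have "T = [:t0, t1, t2:]"
    proof (rule poly_eqI)
      fix n
      show "coeff T n = coeff [:t0, t1, t2:] n"
      proof (cases "n > 2")
        case True
        then have "coeff T n = 0" using T(1) by (intro coeff_eq_0) simp
        then show ?thesis using True by (auto simp: coeff_pCons numeral_2_eq_2 split: nat.split)
      next
        case False
        then have "n = 0 \<or> n = 1 \<or> n = 2" by linarith
        then show ?thesis by (auto simp: t0_def t1_def t2_def numeral_2_eq_2)
      qed
    qed
    moreover have "pderiv G = [:- c * d', - c * c, 0, c * a':]"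
    proof -
      have "(4::'a) = 3 + 1" by simp
      then have "(4::'a) = 1" using three by simp
      then show ?thesis unfolding G_def using three by (simp add: pderiv_pCons algebra_simps)
    qed
    ultimately have "2 * [:- c * d', - c * c, 0, c * a':]\<^sup>2 = [:- c * a, - c * d', - c * (2 * c), c * d, c * a':] * [:t0, t1, t2:]"
      using T(2) by (simp add: G_def)
    then have eqs: "[:- c * a, - c * d', - c * (2 * c), c * d, c * a':] * [:t0, t1, t2:] - 2 * [:- c * d', - c * c, 0, c * a':]\<^sup>2 = 0"
      by simp
    have co: "coeff ([:- c * a, - c * d', - c * (2 * c), c * d, c * a':] * [:t0, t1, t2:] - 2 * [:- c * d', - c * c, 0, c * a':]\<^sup>2) n = 0" for n
      unfolding eqs by simp
    \<comment> \<open>The three top coefficients determine \<open>T\<close>; the next two give the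
      two relations.\<close>
    have c6: "c * (a' * t2 - 2 * c * a'\<^sup>2) = 0"
      using co[of 6] by (simp add: numeral_poly numeral_eq_Suc algebra_simps power2_eq_square)
    have c5: "c * (d * t2 + a' * t1) = 0"
      using co[of 5] by (simp add: numeral_poly numeral_eq_Suc algebra_simps power2_eq_square)
    have c4: "c * (a' * t0 + d * t1 - 2 * c * t2 + 4 * a' * c\<^sup>2) = 0"
      using co[of 4] by (simp add: numeral_poly numeral_eq_Suc algebra_simps power2_eq_square)
    have c3: "c * (d * t0 - 2 * c * t1 - d' * t2 + 4 * c * a' * d') = 0"
      using co[of 3] by (simp add: numeral_poly numeral_eq_Suc algebra_simps power2_eq_square)
    have c2: "c * (2 * c * t0 + d' * t1 + a * t2 + 2 * c ^ 3) = 0"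
      using co[of 2]
      by (simp add: numeral_poly numeral_eq_Suc algebra_simps power2_eq_square neg_eq_iff_add_eq_0)
    have "a' * t2 - 2 * c * a'\<^sup>2 = 0" using c6 c by simp
    then have "a' * (t2 - 2 * c * a') = 0" by algebra
    then have t2: "t2 = 2 * c * a'" using a' by simp
    have "d * t2 + a' * t1 = 0" using c5 c by simp
    then have "a' * (t1 + 2 * c * d) = 0" using t2 by algebra
    then have "t1 + 2 * c * d = 0" using a' by simp
    then have t1: "t1 = - 2 * c * d" by algebra
    have "a' * t0 + d * t1 - 2 * c * t2 + 4 * a' * c\<^sup>2 = 0" using c4 c by simp
    then have t0: "a' * t0 = 2 * c * d\<^sup>2" using t1 t2 by algebra
    have "d * t0 - 2 * c * t1 - d' * t2 + 4 * c * a' * d' = 0" using c3 c by simp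
    then have "2 * c * (a'\<^sup>2 * d' + 2 * c * d * a' + d ^ 3) = 0" using t0 t1 t2 by algebra
    moreover have "2 * c * t0 + d' * t1 + a * t2 + 2 * c ^ 3 = 0" using c2 c by simp
    then have "2 * c * (a' * (c\<^sup>2 + a * a' - d * d') + 2 * c * d\<^sup>2) = 0" using t0 t1 t2 by algebra
    ultimately show ?thesis using two c by simp
  qed
  then show "a'\<^sup>2 * d' + 2 * c * d * a' + d ^ 3 = 0" "a' * (c\<^sup>2 + a * a' - d * d') + 2 * c * d\<^sup>2 = 0" by auto
qed

lemma char_3_additive_or_conj:
  assumes "p = 3"
  shows "(\<forall>x y. f (x + y) = f x + f y) \<or>
    (\<exists>\<gamma>::'a. \<gamma> \<noteq> 0 \<and> \<gamma> ^ (2 * q - 2) - \<gamma> ^ (q - 1) + 1 = 0 \<and> lin_conj q f (\<lambda>x. \<gamma> * x ^ (q + 2)))"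
proof -
  have three: "(3::'a) = 0" using of_nat_eq_0_iff[of 3] assms(1) by simp
  obtain e1 e2 where bas: "K_basis e1 e2" using ex_K_basis .
  obtain d c P2 a w R1 R2 d' where rep0: "cubic_rep f e1 e2 d c P2 a w R1 R2 d'"
    using cubic_rep_exists[OF cubic bas] by blast
  have rep: "cubic_rep f e1 e2 d c 0 a w 0 (- c) d'"
    using rep0 char_3_rep[OF assms bas rep0] by simp
  have K: "d \<in> K" "c \<in> K" "a \<in> K" "w \<in> K" "d' \<in> K" using rep by (auto simp: cubic_rep_def)
  show ?thesis
  proof (cases "c = 0")
    case True
    have cube: "(x + y) ^ 3 = x ^ 3 + y ^ 3" for x y :: 'a
    proof -
      have "(x + y) ^ 3 = x ^ 3 + y ^ 3 + 3 * (x\<^sup>2 * y + x * y\<^sup>2)" by algebra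
      then show ?thesis using three by simp
    qed
    have "f (x + y) = f x + f y" for x y
    proof -
      obtain X Y where XY: "X \<in> K" "Y \<in> K" "x = X * e1 + Y * e2" using K_basis_coords[OF bas] .
      obtain U V where UV: "U \<in> K" "V \<in> K" "y = U * e1 + V * e2" using K_basis_coords[OF bas] .
      have F: "f (X * e1 + Y * e2) = cubic_form d c 0 a X Y * e1 + cubic_form w 0 (- c) d' X Y * e2" if "X \<in> K" "Y \<in> K" for X Y
        using rep that by (simp add: cubic_rep_def)
      have "x + y = (X + U) * e1 + (Y + V) * e2" by (simp add: XY UV algebra_simps)
      then have "f (x + y) = cubic_form d c 0 a (X + U) (Y + V) * e1 + cubic_form w 0 (- c) d' (X + U) (Y + V) * e2"
        using F[of "X + U" "Y + V"] XY UV by simp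
      also have "\<dots> = f x + f y" unfolding XY(3) UV(3) F[OF XY(1,2)] F[OF UV(1,2)]
        by (simp add: cubic_form_def True cube algebra_simps)
      finally show ?thesis .
    qed
    then show ?thesis by blast
  next
    case False
    have w: "w \<noteq> 0"
    proof
      assume w0: "w = 0"
      have "cubic_rep f e2 e1 d' (- c) 0 w a 0 c d" by (rule cubic_rep_swap[OF rep])
      from char_3_nonsquare(1)[OF assms K_basis_swap[OF bas] this] False w0 show False by simp
    qed
    note rel = char_3_relations[OF assms bas rep False w]
    \<comment> \<open>With these parameters the relations turn the quartic of
      \<open>char_3_quartic\<close> into \<open>- w (v^2 - s v + t)^2\<close>, and
      \<open>X^2 + s X Y + t Y^2\<close> becomes a common factor of both coordinate forms.\<close>
    define s where "s = d / w"
    define t where "t = s\<^sup>2 - c / w"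
    have stK: "s \<in> K" "t \<in> K" using K by (auto simp: s_def t_def)
    have d: "d = w * s" using w by (simp add: s_def)
    have c: "c = w * (s\<^sup>2 - t)" using w by (simp add: t_def)
    have "w\<^sup>2 * (d' - 2 * w * s * t) = - (3 * (w ^ 3 * s * t)) * 0 - 3 * (w ^ 3 * s ^ 3) + (w\<^sup>2 * d' + 2 * c * d * w + d ^ 3)"
      unfolding d c by algebra
    then have "w\<^sup>2 * (d' - 2 * w * s * t) = 0" using rel(1) three by simp
    then have d': "d' = 2 * w * s * t" using w by simp
    have "w\<^sup>2 * (a + w * t\<^sup>2) = (w * (c\<^sup>2 + a * w - d * d') + 2 * c * d\<^sup>2) + 3 * (w ^ 3 * (2 * s\<^sup>2 * t - s ^ 4))"
      unfolding d c d' by algebra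
    then have "w\<^sup>2 * (a + w * t\<^sup>2) = 0" using rel(2) three by simp
    then have a: "a = - (w * t\<^sup>2)" using w by (simp add: add_eq_0_iff2)
    have odd_q: "odd q" using assms by (simp add: q_eq)
    obtain \<delta> where \<delta>: "s\<^sup>2 - 4 * t = \<delta>\<^sup>2" using K_square_in_extension[OF odd_q, of "s\<^sup>2 - 4 * t"] stK by auto
    \<comment> \<open>The quadratic formula \<open>(- s + \<delta>) / 2\<close>, where
      \<open>1 / 2 = -1\<close> in characteristic 3.\<close>
    define \<theta> where "\<theta> = s - \<delta>"
    have "\<theta>\<^sup>2 + s * \<theta> + t = 3 * (s\<^sup>2 - t - s * \<delta>)" unfolding \<theta>_def using \<delta> by algebra
    then have \<theta>: "\<theta>\<^sup>2 + s * \<theta> + t = 0" using three by simp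
    have F: "f (X * e1 + Y * e2) = cubic_form d c 0 a X Y * e1 + cubic_form w 0 (- c) d' X Y * e2" if "X \<in> K" "Y \<in> K" for X Y
      using rep that by (simp add: cubic_rep_def)
    have fac1: "cubic_form d c 0 a X Y = - w * (X\<^sup>2 + s * X * Y + t * Y\<^sup>2) * (2 * s * X + t * Y)" for X Y
    proof -
      have "cubic_form d c 0 a X Y = - w * (X\<^sup>2 + s * X * Y + t * Y\<^sup>2) * (2 * s * X + t * Y)
          + 3 * w * (s * X ^ 3 + s\<^sup>2 * X\<^sup>2 * Y + s * t * X * Y\<^sup>2)"
        unfolding cubic_form_def d c a by algebra
      then show ?thesis using three by simp
    qed
    have fac2: "cubic_form w 0 (- c) d' X Y = w * (X\<^sup>2 + s * X * Y + t * Y\<^sup>2) * (X + 2 * s * Y)" for X Y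
    proof -
      have "cubic_form w 0 (- c) d' X Y = w * (X\<^sup>2 + s * X * Y + t * Y\<^sup>2) * (X + 2 * s * Y)
          - 3 * w * (s * X\<^sup>2 * Y + s\<^sup>2 * X * Y\<^sup>2)"
        unfolding cubic_form_def c d' by algebra
      then show ?thesis using three by simp
    qed
    have "\<theta> \<notin> K"
    proof
      assume "\<theta> \<in> K"
      then have "f (\<theta> * e1 + 1 * e2) = 0" unfolding F[OF \<open>\<theta> \<in> K\<close> K_1] fac1 fac2 using \<theta> by simp
      then have "\<theta> * e1 + 1 * e2 = 0" using f_0 f_eq_iff[of "\<theta> * e1 + 1 * e2" 0] by simp
      then show False using K_basis_zero[OF bas \<open>\<theta> \<in> K\<close> K_1] by simp
    qed
    define \<eta> where "\<eta> = \<theta> ^ q"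
    have "(\<theta>\<^sup>2 + s * \<theta> + t) ^ q = 0" using \<theta> q_ge_2 by simp
    then have "\<eta>\<^sup>2 + s * \<eta> + t = 0" using stK by (simp add: frob_simps frob_power \<eta>_def in_K_iff)
    then have "(\<eta> - \<theta>) * (\<eta> + \<theta> + s) = 0" using \<theta> by algebra
    moreover have "\<eta> \<noteq> \<theta>" using \<open>\<theta> \<notin> K\<close> by (simp add: in_K_iff \<eta>_def)
    ultimately have "\<eta> + \<theta> + s = 0" by simp
    then have \<eta>: "\<theta> ^ q = - s - \<theta>" unfolding \<eta>_def[symmetric] by algebra
    have l: "K_basis 1 (- \<theta>)" using \<open>\<theta> \<notin> K\<close> by (simp add: K_basis_def in_K_iff frob_simps)
    \<comment> \<open>The linear cofactors combine to \<open>\<gamma> (X - \<theta> Y)\<close> in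
      the basis \<open>1, - \<theta>\<close>. Frobenius negates \<open>\<gamma>\<close>, which is
      what is wanted, as \<open>z^2 - z + 1 = (z + 1)^2\<close> in characteristic 3.\<close>
    define \<gamma> where "\<gamma> = - w * (2 * s + \<theta>)"
    have "2 * s + \<theta> \<noteq> 0"
    proof
      assume "2 * s + \<theta> = 0"
      then have "\<theta> = - (2 * s)" by (simp add: eq_neg_iff_add_eq_0 add.commute)
      then show False using \<open>\<theta> \<notin> K\<close> stK by simp
    qed
    then have g0: "\<gamma> \<noteq> 0" using w by (simp add: \<gamma>_def)
    have "(2::'a) ^ q = 2" using K_numeral[of "num.Bit0 num.One"] by (simp only: in_K_iff)
    then have "\<gamma> ^ q = - w * (2 * s + (- s - \<theta>))" using K stK by (simp add: \<gamma>_def frob_simps \<eta> in_K_iff)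
    also have "\<dots> = \<gamma> * (- 1) - 3 * (w * s)" unfolding \<gamma>_def by algebra
    finally have "\<gamma> ^ q = \<gamma> * (- 1)" using three by simp
    moreover have "\<gamma> ^ q = \<gamma> * \<gamma> ^ (q - 1)" using q_ge_2 by (metis power_eq_if not_numeral_le_zero)
    ultimately have g1: "\<gamma> ^ (q - 1) = - 1" using g0 by (metis mult_cancel_left)
    have "2 * q - 2 = (q - 1) * 2" by simp
    then have "\<gamma> ^ (2 * q - 2) = (\<gamma> ^ (q - 1))\<^sup>2" by (simp only: power_mult)
    then have "\<gamma> ^ (2 * q - 2) - \<gamma> ^ (q - 1) + 1 = 0" unfolding g1 using three by simp
    moreover have "lin_conj q f (\<lambda>x. \<gamma> * x ^ (q + 2))"
    proof (rule lin_conj_from_basis[OF bas l])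
      fix X Y assume XY: "X \<in> K" "Y \<in> K"
      define A where "A = cubic_form d c 0 a X Y"
      define B where "B = cubic_form w 0 (- c) d' X Y"
      have AB: "A \<in> K" "B \<in> K" "f (X * e1 + Y * e2) = A * e1 + B * e2"
        using rep XY by (auto simp: cubic_rep_def A_def B_def)
      have "(X * 1 + Y * - \<theta>) ^ q = X + Y * (s + \<theta>)" using XY by (simp add: frob_simps \<eta> in_K_iff algebra_simps)
      then have pw: "(X * 1 + Y * - \<theta>) ^ (q + 2) = (X + Y * (s + \<theta>)) * (X - Y * \<theta>)\<^sup>2"
        by (simp add: power_add power2_eq_square)
      have Q: "X\<^sup>2 + s * X * Y + t * Y\<^sup>2 = (X + Y * (s + \<theta>)) * (X - Y * \<theta>)" using \<theta> by algebra
      have "A * 1 + B * - \<theta> = - w * (X\<^sup>2 + s * X * Y + t * Y\<^sup>2) * (2 * s * X + t * Y + \<theta> * (X + 2 * s * Y))"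
        unfolding A_def B_def fac1 fac2 by algebra
      also have "2 * s * X + t * Y + \<theta> * (X + 2 * s * Y) = (2 * s + \<theta>) * (X - Y * \<theta>) + 3 * (s * \<theta> * Y)" using \<theta> by algebra
      finally have "A * 1 + B * - \<theta> = - w * (X\<^sup>2 + s * X * Y + t * Y\<^sup>2) * ((2 * s + \<theta>) * (X - Y * \<theta>))"
        using three by simp
      also have "\<dots> = \<gamma> * ((X + Y * (s + \<theta>)) * (X - Y * \<theta>)\<^sup>2)" unfolding Q \<gamma>_def by algebra
      finally show "\<exists>A\<in>K. \<exists>B\<in>K. f (X * e1 + Y * e2) = A * e1 + B * e2 \<and> A * 1 + B * - \<theta> = \<gamma> * (X * 1 + Y * - \<theta>) ^ (q + 2)"
        using AB pw by auto
    qed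
    ultimately show ?thesis using g0 by blast
  qed
qed

end

subsection \<open>Converse direction\<close>

context quadratic_extension
begin

definition quadrinomial :: "'a \<Rightarrow> 'a \<Rightarrow> 'a \<Rightarrow> 'a \<Rightarrow> 'a \<Rightarrow> 'a" where
  "quadrinomial a b c d x = a * x ^ (3 * q) + b * x ^ (2 * q + 1) + c * x ^ (q + 2) + d * x ^ 3"

lemma quadrinomial_eq: "quadrinomial a b c d x = a * (x ^ q) ^ 3 + b * (x ^ q)\<^sup>2 * x + c * x ^ q * x\<^sup>2 + d * x ^ 3"
proof -
  have "x ^ (3 * q) = (x ^ q) ^ 3" "x ^ (2 * q + 1) = (x ^ q)\<^sup>2 * x" "x ^ (q + 2) = x ^ q * x\<^sup>2"
    by (simp_all only: power_mult[symmetric] power_add mult.commute power_one_right)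
  then show ?thesis by (simp only: quadrinomial_def mult.assoc)
qed

lemma cubic_map_quadrinomial: "cubic_map (quadrinomial a b c d)"
  unfolding cubic_map_def
proof (intro allI)
  fix e1 e2 :: 'a
  define g1 g2 where "g1 = e1 ^ q" and "g2 = e2 ^ q"
  define F0 where "F0 = a * g1 ^ 3 + b * g1\<^sup>2 * e1 + c * g1 * e1\<^sup>2 + d * e1 ^ 3"
  define F1 where "F1 = 3 * a * g1\<^sup>2 * g2 + b * (2 * g1 * g2 * e1 + g1\<^sup>2 * e2)
    + c * (g2 * e1\<^sup>2 + 2 * g1 * e1 * e2) + 3 * d * e1\<^sup>2 * e2"
  define F2 where "F2 = 3 * a * g2\<^sup>2 * g1 + b * (2 * g2 * g1 * e2 + g2\<^sup>2 * e1)
    + c * (g1 * e2\<^sup>2 + 2 * g2 * e2 * e1) + 3 * d * e2\<^sup>2 * e1"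
  define F3 where "F3 = a * g2 ^ 3 + b * g2\<^sup>2 * e2 + c * g2 * e2\<^sup>2 + d * e2 ^ 3"
  have "quadrinomial a b c d (X * e1 + Y * e2) = cubic_form F0 F1 F2 F3 X Y" if "X \<in> K" "Y \<in> K" for X Y
  proof -
    have e: "(X * e1 + Y * e2) ^ q = X * g1 + Y * g2"
      using that by (simp add: frob_simps in_K_iff g1_def g2_def)
    show ?thesis
      unfolding quadrinomial_eq e cubic_form_def F0_def F1_def F2_def F3_def by algebra
  qed
  then show "\<exists>F0 F1 F2 F3. \<forall>X\<in>K. \<forall>Y\<in>K. quadrinomial a b c d (X * e1 + Y * e2) = cubic_form F0 F1 F2 F3 X Y"
    by blast
qed

lemma norm_in_K: "x * x ^ q \<in> K"
  unfolding in_K_iff power_mult_distrib frob_frob by (rule mult.commute)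

lemma bij_if_inj: "(\<And>x y. h x = h y \<Longrightarrow> x = y) \<Longrightarrow> bij (h :: 'a \<Rightarrow> 'a)"
  by (simp add: bij_def inj_def finite_UNIV_inj_surj)

text \<open>Since \<open>L\<close> is additive, \<open>L (f x) = g (L x)\<close> entails
  \<open>L (f x + x) = g (L x) + L x\<close>.\<close>

lemma complete_mapping_lin_conj:
  fixes f g :: "'a \<Rightarrow> 'a"
  assumes "lin_conj q f g" "complete_mapping g"
  shows "complete_mapping f"
proof -
  obtain a b where ab: "a ^ (q + 1) \<noteq> b ^ (q + 1)"
    and f: "\<And>x. f x = (a * g (a * x ^ q + b * x) ^ q - b ^ q * g (a * x ^ q + b * x)) / (a ^ (q + 1) - b ^ (q + 1))"
    using assms(1) unfolding lin_conj_def Let_def by blast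
  define L where "L x = a * x ^ q + b * x" for x
  define u w D where "u = a ^ q" and "w = b ^ q" and "D = a ^ (q + 1) - b ^ (q + 1)"
  have D: "D \<noteq> 0" "D = a * u - b * w" using ab by (simp_all add: D_def u_def w_def)
  have "D \<in> K" using K_diff[OF norm_in_K[of a] norm_in_K[of b]] D(2) by (simp only: u_def w_def)
  then have Dq: "D ^ q = D" unfolding in_K_iff .
  have L_inj: "x = y" if "L x = L y" for x y
  proof -
    have "a * (x - y) ^ q + b * (x - y) = 0" using that by (simp add: L_def frob_simps algebra_simps)
    then have "x - y = 0" by (rule linearized_kernel[OF ab])
    then show ?thesis by simp
  qed
  have L_add: "L (x + y) = L x + L y" for x y by (simp add: L_def frob_simps algebra_simps)
  have Lf: "L (f x) = g (L x)" for x
  proof -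
    define y z where "y = g (L x)" and "z = g (L x) ^ q"
    have fx: "f x = (a * z - w * y) / D" by (simp add: f y_def z_def L_def w_def D_def)
    then have "f x ^ q = (u * y - b * z) / D"
      by (simp add: frob_simps Dq u_def w_def y_def z_def)
    then have "L (f x) = (a * (u * y - b * z) + b * (a * z - w * y)) / D"
      by (simp add: L_def fx add_divide_distrib)
    also have "a * (u * y - b * z) + b * (a * z - w * y) = D * y" unfolding D(2) by algebra
    finally show ?thesis using D(1) by (simp add: y_def)
  qed
  have g: "x = y" if "g x = g y" for x y
    using assms(2) that by (simp add: complete_mapping_def bij_def inj_eq)
  have g': "x = y" if "g x + x = g y + y" for x y
    using assms(2) injD[of "\<lambda>x. g x + x" x y] that by (simp add: complete_mapping_def bij_def)
  show ?thesis unfolding complete_mapping_def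
  proof (intro conjI bij_if_inj)
    fix x y assume "f x = f y"
    then have "g (L x) = g (L y)" using Lf by metis
    then show "x = y" using g L_inj by blast
  next
    fix x y assume "f x + x = f y + y"
    then have "L (f x + x) = L (f y + y)" by simp
    then have "g (L x) + L x = g (L y) + L y" by (simp only: L_add Lf)
    then show "x = y" using g' L_inj by blast
  qed
qed

text \<open>With \<open>N\<close> the norm of \<open>x\<close>, the second map is
  \<open>(\<gamma> N + 1) x\<close>. Taking norms leaves the cubic \<open>M N^3 + T N^2 + N\<close>
  on \<open>K\<close>, where \<open>T^2 = 3 M\<close>. If 3 is invertible, this is cubing up to
  affine changes; in characteristic 3 it is additive with trivial kernel. Once \<open>N\<close> is
  known, \<open>x\<close> follows because \<open>\<gamma> N + 1 \<noteq> 0\<close>.\<close>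

lemma complete_mapping_norm_monomial:
  fixes \<gamma> :: 'a
  assumes g0: "\<gamma> \<noteq> 0" and g: "\<gamma> ^ (2 * q - 2) - \<gamma> ^ (q - 1) + 1 = 0"
  shows "complete_mapping (\<lambda>x. \<gamma> * x ^ (q + 2))"
proof -
  define \<beta> where "\<beta> = \<gamma> ^ q"
  define \<rho> where "\<rho> = \<gamma> ^ (q - 1)"
  have "2 * q - 2 = (q - 1) * 2" by simp
  then have "\<gamma> ^ (2 * q - 2) = \<rho>\<^sup>2" unfolding \<rho>_def by (simp only: power_mult)
  then have "\<rho>\<^sup>2 - \<rho> + 1 = 0" using g by (simp add: \<rho>_def)
  moreover have "\<beta> = \<gamma> * \<rho>" unfolding \<beta>_def \<rho>_def using q_ge_2 by (metis power_eq_if not_numeral_le_zero)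
  ultimately have rel: "\<beta>\<^sup>2 - \<beta> * \<gamma> + \<gamma>\<^sup>2 = 0" by algebra
  have bq: "\<beta> ^ q = \<gamma>" by (simp add: \<beta>_def frob_frob)
  have b0: "\<beta> \<noteq> 0" using g0 by (simp add: \<beta>_def)
  have gK: "\<gamma> \<notin> K"
  proof
    assume "\<gamma> \<in> K"
    then have "\<beta> = \<gamma>" by (simp add: in_K_iff \<beta>_def)
    then have "\<gamma>\<^sup>2 = 0" using rel by (simp add: power2_eq_square)
    then show False using g0 by simp
  qed
  have ratio: "\<kappa>\<^sup>2 = 1" if "\<kappa> \<in> K" "\<beta> = \<kappa> * \<gamma>" for \<kappa>
  proof -
    have "\<beta> ^ q = \<kappa> * \<beta>" using that by (simp add: frob_simps in_K_iff \<beta>_def[symmetric])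
    then have "\<gamma> * (\<kappa>\<^sup>2 - 1) = 0" unfolding bq using that(2) by algebra
    then show ?thesis using g0 by simp
  qed
  \<comment> \<open>A nontrivial cube root of unity \<open>z\<close> in \<open>K\<close> would make
    \<open>\<beta> / \<gamma>\<close> equal to \<open>- z\<close> or \<open>- z^2\<close>, hence an
    element of \<open>K\<close>. Frobenius exchanges \<open>\<beta>\<close> and
    \<open>\<gamma>\<close>, so the square of this quotient would be 1.\<close>
  have cube_inj: "s = t" if st: "s \<in> K" "t \<in> K" "s ^ 3 = t ^ 3" for s t
  proof (rule ccontr)
    assume ne: "s \<noteq> t"
    then have t0: "t \<noteq> 0" using st(3) by auto
    define z where "z = s / t"
    have zK: "z \<in> K" using st by (simp add: z_def)
    have z1: "z \<noteq> 1" using ne t0 by (simp add: z_def)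
    have z3: "z ^ 3 = 1" using st(3) t0 by (simp add: z_def power_divide)
    then have "(z - 1) * (z\<^sup>2 + z + 1) = 0" by algebra
    then have z: "z\<^sup>2 + z + 1 = 0" using z1 by simp
    have "(\<beta> - (- z) * \<gamma>) * (\<beta> - (- (z\<^sup>2)) * \<gamma>) = 0" using rel z by algebra
    then have "\<beta> = (- z) * \<gamma> \<or> \<beta> = (- (z\<^sup>2)) * \<gamma>"
      unfolding mult_eq_0_iff right_minus_eq .
    then have "z\<^sup>2 = 1 \<or> z ^ 4 = 1"
      using ratio[of "- z"] ratio[of "- (z\<^sup>2)"] zK by (auto simp flip: power_mult)
    then have "z\<^sup>2 = 1 \<or> z = 1" using z3 by (auto simp: power4_eq_xxxx power3_eq_cube mult.assoc)
    then have "z\<^sup>2 = 1" using z1 by simp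
    then have "(z - 1) * (z + 1) = 0" by algebra
    then have "z = - 1" using z1 by (simp add: eq_neg_iff_add_eq_0)
    then show False using z by simp
  qed
  define M T where "M = \<gamma> * \<beta>" and "T = \<gamma> + \<beta>"
  have M0: "M \<noteq> 0" using g0 b0 by (simp add: M_def)
  have MK: "M \<in> K" unfolding M_def \<beta>_def by (rule norm_in_K)
  have TK: "T \<in> K" unfolding T_def in_K_iff by (simp add: frob_simps bq \<beta>_def[symmetric] add.commute)
  have TM: "T\<^sup>2 = 3 * M" using rel unfolding T_def M_def by algebra
  have N_inj: "N = N'" if N: "N \<in> K" "N' \<in> K" "N * (M * N\<^sup>2 + T * N + 1) = N' * (M * N'\<^sup>2 + T * N' + 1)" for N N'
  proof (cases "(3::'a) = 0")
    case True
    have T0: "T = 0" using TM True by simp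
    define D where "D = N - N'"
    have DK: "D \<in> K" using N by (simp add: D_def)
    have "M * D ^ 3 + D = 3 * (M * (N * N'\<^sup>2 - N\<^sup>2 * N'))" unfolding D_def using N(3) T0 by algebra
    then have "M * D ^ 3 + D = 0" using True by simp
    moreover have "\<beta> = - \<gamma>" using T0 unfolding T_def by algebra
    then have "M = - \<gamma>\<^sup>2" unfolding M_def by algebra
    ultimately have "D * ((1 - \<gamma> * D) * (1 + \<gamma> * D)) = 0" by algebra
    then have "D = 0 \<or> \<gamma> * D = 1 \<or> \<gamma> * D = - 1" by (auto simp: add_eq_0_iff)
    moreover have "\<gamma> * D \<notin> K \<or> D = 0" using gK DK by (metis K_divide nonzero_mult_div_cancel_right)
    ultimately have "D = 0" using K_1 K_minus by metis
    then show ?thesis by (simp add: D_def)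
  next
    case False
    have T0: "T \<noteq> 0" using TM False M0 by auto
    have TN: "T * N + 1 \<in> K" "T * N' + 1 \<in> K" using N(1,2) TK by simp_all
    \<comment> \<open>By \<open>TM\<close>,
      \<open>(T N + 1)^3 = 3 T (M N^3 + T N^2 + N) + 1\<close>.\<close>
    have "(T * N + 1) ^ 3 = (T * N' + 1) ^ 3" using TM N(3) by algebra
    then have "T * N + 1 = T * N' + 1" by (rule cube_inj[OF TN])
    then show ?thesis using T0 by simp
  qed
  have pw: "\<gamma> * x ^ (q + 2) = \<gamma> * (x * x ^ q) * x" for x by (simp add: power_add power2_eq_square)
  show ?thesis unfolding complete_mapping_def
  proof (intro conjI bij_if_inj)
    fix x y assume eq: "\<gamma> * x ^ (q + 2) = \<gamma> * y ^ (q + 2)"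
    define N N' where "N = x * x ^ q" and "N' = y * y ^ q"
    have NK: "N \<in> K" "N' \<in> K" by (simp_all add: N_def N'_def norm_in_K)
    have e: "\<gamma> * N * x = \<gamma> * N' * y" using eq unfolding pw N_def N'_def .
    have "(\<gamma> * N * x) ^ q = (\<gamma> * N' * y) ^ q" by (simp only: e)
    then have h: "\<beta> * N * x ^ q = \<beta> * N' * y ^ q" using NK by (simp add: power_mult_distrib in_K_iff \<beta>_def)
    have "(\<gamma> * N * x) * (\<beta> * N * x ^ q) = (\<gamma> * N' * y) * (\<beta> * N' * y ^ q)" by (simp only: e h)
    then have "M * N ^ 3 = M * N' ^ 3" unfolding M_def
      by (simp add: power3_eq_cube N_def N'_def mult_ac)
    then have "N ^ 3 = N' ^ 3" using M0 by simp
    then have NN: "N = N'" by (rule cube_inj[OF NK])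
    show "x = y"
    proof (cases "N = 0")
      case True
      then show ?thesis using NN by (auto simp: N_def N'_def)
    next
      case False
      then show ?thesis using e NN g0 by simp
    qed
  next
    fix x y assume eq: "\<gamma> * x ^ (q + 2) + x = \<gamma> * y ^ (q + 2) + y"
    define N N' where "N = x * x ^ q" and "N' = y * y ^ q"
    have NK: "N \<in> K" "N' \<in> K" by (simp_all add: N_def N'_def norm_in_K)
    have e: "(\<gamma> * N + 1) * x = (\<gamma> * N' + 1) * y"
      using eq unfolding pw N_def[symmetric] N'_def[symmetric] by (simp add: algebra_simps)
    have "((\<gamma> * N + 1) * x) ^ q = ((\<gamma> * N' + 1) * y) ^ q" by (simp only: e)
    then have h: "(\<beta> * N + 1) * x ^ q = (\<beta> * N' + 1) * y ^ q"
      using NK by (simp add: frob_simps in_K_iff \<beta>_def)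
    have "((\<gamma> * N + 1) * x) * ((\<beta> * N + 1) * x ^ q) = ((\<gamma> * N' + 1) * y) * ((\<beta> * N' + 1) * y ^ q)"
      by (simp only: e h)
    then have "(\<gamma> * N + 1) * (\<beta> * N + 1) * N = (\<gamma> * N' + 1) * (\<beta> * N' + 1) * N'"
      unfolding N_def N'_def by (simp only: mult_ac)
    then have "N * (M * N\<^sup>2 + T * N + 1) = N' * (M * N'\<^sup>2 + T * N' + 1)"
      unfolding M_def T_def by algebra
    then have NN: "N = N'" by (rule N_inj[OF NK])
    have "\<gamma> * N + 1 \<noteq> 0"
    proof
      assume 0: "\<gamma> * N + 1 = 0"
      then have "N \<noteq> 0" by auto
      moreover from 0 have "\<gamma> * N = - 1" by (simp add: eq_neg_iff_add_eq_0)
      ultimately have "\<gamma> = - 1 / N" by (simp add: field_simps)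
      then show False using gK NK by (metis K_1 K_divide K_minus)
    qed
    then show "x = y" using e NN by simp
  qed
qed

text \<open>Both maps are additive, so only kernels matter: the first is a linearized polynomial in
  \<open>x ^ 3\<close>, and the second is divided by \<open>x\<close>.\<close>

lemma complete_mapping_char_3:
  assumes "q mod 3 = 0" "a ^ (q + 1) \<noteq> d ^ (q + 1)"
    and nr: "\<And>x. x \<noteq> 0 \<Longrightarrow> a * x ^ (3 * q - 1) + d * x ^ 2 + 1 \<noteq> 0"
  shows "complete_mapping (quadrinomial a 0 0 d)"
proof -
  have "3 dvd p ^ k" using assms(1) by (simp add: q_eq mod_eq_0_iff_dvd)
  then have "3 dvd p" by (rule prime_dvd_power[rotated]) simp
  then have "p = 3" using prime_p primes_dvd_imp_eq[of 3 p] by simp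
  then have three: "(3::'a) = 0" using of_nat_eq_0_iff[of 3] by simp
  have cube: "(x - y) ^ 3 = x ^ 3 - y ^ 3" for x y :: 'a
  proof -
    have "(x - y) ^ 3 = x ^ 3 - y ^ 3 + 3 * (x * y\<^sup>2 - x\<^sup>2 * y)" by algebra
    then show ?thesis using three by simp
  qed
  have sub: "quadrinomial a 0 0 d (x - y) = quadrinomial a 0 0 d x - quadrinomial a 0 0 d y" for x y
    by (simp add: quadrinomial_eq frob_diff cube algebra_simps)
  have k1: "x = 0" if "quadrinomial a 0 0 d x = 0" for x
  proof -
    have "a * (x ^ 3) ^ q + d * x ^ 3 = 0" using that by (simp add: quadrinomial_eq frob_power)
    then have "x ^ 3 = 0" by (rule linearized_kernel[OF assms(2)])
    then show ?thesis by simp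
  qed
  have k2: "x = 0" if "quadrinomial a 0 0 d x + x = 0" for x
  proof (rule ccontr)
    assume x: "x \<noteq> 0"
    have "3 * q = Suc (3 * q - 1)" using q_ge_2 by simp
    then have "x ^ (3 * q) = x * x ^ (3 * q - 1)" by (metis power_Suc)
    then have "quadrinomial a 0 0 d x + x = x * (a * x ^ (3 * q - 1) + d * x ^ 2 + 1)"
      by (simp add: quadrinomial_def algebra_simps power2_eq_square power3_eq_cube)
    then show False using that nr[OF x] x by simp
  qed
  show ?thesis unfolding complete_mapping_def
  proof (intro conjI bij_if_inj)
    fix x y assume "quadrinomial a 0 0 d x = quadrinomial a 0 0 d y"
    then show "x = y" using k1[of "x - y"] by (simp add: sub)
  next
    fix x y assume "quadrinomial a 0 0 d x + x = quadrinomial a 0 0 d y + y"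
    then have "quadrinomial a 0 0 d (x - y) + (x - y) = 0" by (simp add: sub algebra_simps)
    then show "x = y" using k2[of "x - y"] by simp
  qed
qed

text \<open>Additivity at \<open>(1, x)\<close> and \<open>(1, - x)\<close> separates odd from even
  terms in \<open>x\<close>. Modulo 3 they leave \<open>(c - b) (u - x) = 0\<close> and then
  \<open>b (u - x)^2 = 0\<close>.\<close>

lemma additive_quadrinomial:
  assumes "p = 3" and add: "\<And>x y. quadrinomial a b c d (x + y) = quadrinomial a b c d x + quadrinomial a b c d y"
  shows "b = 0 \<and> c = 0"
proof -
  have three: "(3::'a) = 0" using of_nat_eq_0_iff[of 3] assms(1) by simp
  have two: "(2::'a) \<noteq> 0" using of_nat_eq_0_iff[of 2] assms(1) by (auto dest: dvd_imp_le)
  obtain x where x: "x \<notin> K" using ex_not_K by blast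
  define u where "u = x ^ q"
  have ux: "u - x \<noteq> 0" using x by (simp add: u_def in_K_iff)
  have v: "quadrinomial a b c d (1 + x) = a * (1 + u) ^ 3 + b * (1 + u)\<^sup>2 * (1 + x) + c * (1 + u) * (1 + x)\<^sup>2 + d * (1 + x) ^ 3"
    "quadrinomial a b c d (1 + - x) = a * (1 - u) ^ 3 + b * (1 - u)\<^sup>2 * (1 - x) + c * (1 - u) * (1 - x)\<^sup>2 + d * (1 - x) ^ 3"
    "quadrinomial a b c d x = a * u ^ 3 + b * u\<^sup>2 * x + c * u * x\<^sup>2 + d * x ^ 3"
    "quadrinomial a b c d (- x) = - (a * u ^ 3 + b * u\<^sup>2 * x + c * u * x\<^sup>2 + d * x ^ 3)"
    "quadrinomial a b c d 1 = a + b + c + d"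
    by (simp_all add: quadrinomial_eq frob_simps u_def)
  note s1 = add[of 1 x, unfolded v] and s2 = add[of 1 "- x", unfolded v]
  have "2 * ((c - b) * (u - x)) = 3 * (- 2 * (a * u + d * x) - 2 * (b * u + c * x))" using s1 s2 by algebra
  then have "c - b = 0" using two three ux by simp
  then have cb: "c = b" by simp
  have "2 * (b * (u - x)\<^sup>2) = 3 * (- 2 * (a * u\<^sup>2 + d * x\<^sup>2) - 4 * b * u * x)" using s1 s2 cb by algebra
  then have "b = 0" using two three ux by simp
  then show ?thesis using cb by simp
qed

end

subsection \<open>The classification\<close>

context quadratic_extension
begin

text \<open>On four elements \<open>x ^ 4 = x\<close> reduces the map to
  \<open>(a + d) x^3 + b x^2 + c x\<close>. The sum over the field removes the cubic term, after
  which the map is additive and its kernel decides.\<close>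

lemma conj_q_2:
  assumes q2: "q = 2" and cm: "complete_mapping (quadrinomial a b c d)"
  shows "\<exists>\<gamma>::'a. \<gamma> \<noteq> 0 \<and> \<gamma> ^ (2 * q - 2) - \<gamma> ^ (q - 1) + 1 = 0 \<and> lin_conj q (quadrinomial a b c d) (\<lambda>x. \<gamma> * x ^ (q + 2))"
proof -
  have card4: "CARD('a) = 4" using CARD_eq q2 by simp
  have two: "(2::'a) = 0" using of_nat_q q2 by simp
  have dbl: "x + x = 0" for x :: 'a using two by (metis mult_2 mult_zero_left)
  have p4: "x ^ 4 = x" for x :: 'a using power_CARD_eq_same[of x] card4 by simp
  have p3: "x ^ 3 = 1" if "x \<noteq> 0" for x :: 'a
    using p4[of x] that by (simp add: power4_eq_xxxx power3_eq_cube mult.assoc)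
  have f: "quadrinomial a b c d x = (a + d) * x ^ 3 + b * x\<^sup>2 + c * x" for x
  proof -
    have "x ^ 6 = x ^ 4 * x\<^sup>2" "x ^ 5 = x ^ 4 * x" by (simp_all flip: power_add power_Suc2)
    then have "x ^ 6 = x ^ 3" "x ^ 5 = x\<^sup>2" by (simp_all add: p4 power2_eq_square power3_eq_cube)
    moreover have "quadrinomial a b c d x = a * x ^ 6 + b * x ^ 5 + c * x ^ 4 + d * x ^ 3"
      unfolding quadrinomial_def by (simp add: q2)
    ultimately show ?thesis by (simp add: p4 algebra_simps)
  qed
  have inj1: "x = 0" if "quadrinomial a b c d x = 0" for x
  proof -
    have "quadrinomial a b c d x = quadrinomial a b c d 0" using that by (simp add: f)
    then show ?thesis using cm by (simp add: complete_mapping_def bij_def inj_eq)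
  qed
  have inj2: "x = 0" if "quadrinomial a b c d x + x = 0" for x
  proof -
    have "quadrinomial a b c d x + x = quadrinomial a b c d 0 + 0" using that by (simp add: f)
    then show ?thesis using cm injD[of "\<lambda>x. quadrinomial a b c d x + x" x 0] by (simp add: complete_mapping_def bij_def)
  qed
  have S1: "(\<Sum>x\<in>UNIV. x) = (0::'a)"
  proof -
    obtain t where t: "t \<notin> K" using ex_not_K by blast
    then have t0: "t \<noteq> 0" "t \<noteq> 1" using K_0 K_1 by auto
    have "(\<Sum>x\<in>UNIV. x) = (\<Sum>x\<in>UNIV. t * x)"
      by (rule sum.reindex_bij_witness[of _ "\<lambda>x. t * x" "\<lambda>x. x / t"]) (use t0 in auto)
    also have "\<dots> = t * (\<Sum>x\<in>UNIV. x)" by (simp add: sum_distrib_left)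
    finally show ?thesis using t0 by (metis mult_cancel_right1)
  qed
  have S2: "(\<Sum>x\<in>UNIV. x\<^sup>2) = (0::'a)"
  proof -
    have "(\<Sum>x\<in>UNIV. x\<^sup>2) = (\<Sum>x\<in>UNIV. x::'a)\<^sup>2"
    proof -
      have "p dvd 2" using q2 q_eq k_pos by (metis dvd_power)
      then have "2 = CHAR('a)" using prime_p primes_dvd_imp_eq[of p 2] unfolding CHAR_eq by simp
      moreover have "prime CHAR('a)" unfolding CHAR_eq by (rule prime_p)
      ultimately show ?thesis by (intro freshmans_dream_sum[symmetric])
    qed
    then show ?thesis by (simp add: S1)
  qed
  have S3: "(\<Sum>x\<in>UNIV. x ^ 3) = (1::'a)"
  proof -
    have "(\<Sum>x\<in>UNIV. (x::'a) ^ 3) = (\<Sum>x\<in>UNIV - {0}. x ^ 3)"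
      by (subst sum.remove[of UNIV 0]) auto
    also have "\<dots> = (\<Sum>x\<in>UNIV - {0::'a}. 1)" by (intro sum.cong) (auto simp: p3)
    also have "\<dots> = 3" using card4 by (simp add: card_Diff_singleton)
    also have "(3::'a) = 2 + 1" by simp
    finally show ?thesis using two by simp
  qed
  have "(\<Sum>x\<in>UNIV. quadrinomial a b c d x) = (\<Sum>x\<in>UNIV. x)"
    using cm by (intro sum.reindex_bij_betw) (simp add: complete_mapping_def)
  moreover have "(\<Sum>x\<in>UNIV. quadrinomial a b c d x) = (a + d) * (\<Sum>x\<in>UNIV. x ^ 3) + b * (\<Sum>x\<in>UNIV. x\<^sup>2) + c * (\<Sum>x\<in>UNIV. x)"
    by (simp add: f sum.distrib sum_distrib_left)
  ultimately have ad: "a + d = 0" by (simp add: S1 S2 S3)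
  have f': "quadrinomial a b c d x = b * x\<^sup>2 + c * x" for x by (simp add: f ad)
  have b: "b = 0"
  proof (rule ccontr)
    \<comment> \<open>\<open>c / b\<close> is a root of the map, so \<open>c = 0\<close>; then
      \<open>1 / b\<close> is a root of the map plus the identity.\<close>
    assume b: "b \<noteq> 0"
    have "quadrinomial a b c d (c / b) = c\<^sup>2 / b + c\<^sup>2 / b" using b by (simp add: f' power2_eq_square)
    then have "quadrinomial a b c d (c / b) = 0" by (simp only: dbl)
    then have "c / b = 0" by (rule inj1)
    then have "c = 0" using b by simp
    then have "quadrinomial a b c d (1 / b) + 1 / b = 1 / b + 1 / b"
      unfolding f' using b by (simp add: power2_eq_square)
    then have "quadrinomial a b c d (1 / b) + 1 / b = 0" by (simp only: dbl)
    then have "1 / b = 0" by (rule inj2)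
    then show False using b by simp
  qed
  have f'': "quadrinomial a b c d x = c * x" for x using f'[of x] b by simp
  have c0: "c \<noteq> 0" using inj1[of 1, unfolded f''] by auto
  have c1: "c \<noteq> 1"
  proof
    assume "c = 1"
    then have "quadrinomial a b c d 1 + 1 = 1 + 1" unfolding f'' by simp
    then have "quadrinomial a b c d 1 + 1 = 0" by (simp only: dbl)
    then have "1 = (0::'a)" by (rule inj2)
    then show False by simp
  qed
  have "(c - 1) * (c\<^sup>2 + c + 1) = 0" using p3[OF c0] by algebra
  then have "c\<^sup>2 + c + 1 = 0" using c1 by simp
  moreover have "c\<^sup>2 - c + 1 = c\<^sup>2 + c + 1 - 2 * c" by simp
  ultimately have "c\<^sup>2 - c + 1 = 0" using two by simp
  then have "c ^ (2 * q - 2) - c ^ (q - 1) + 1 = 0" by (simp add: q2)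
  moreover have "lin_conj q (quadrinomial a b c d) (\<lambda>x. c * x ^ (q + 2))"
    \<comment> \<open>The conjugating map is the identity, and \<open>x ^ (q + 2) = x\<close> on
      four elements.\<close>
    unfolding lin_conj_def f'' by (rule exI[of _ 0], rule exI[of _ 1]) (simp add: q2 p4)
  ultimately show ?thesis using c0 by blast
qed

lemma complete_quadrinomial_imp:
  assumes cm: "complete_mapping (quadrinomial a b c d)"
  shows "(\<exists>\<gamma>::'a. \<gamma> \<noteq> 0 \<and> \<gamma> ^ (2 * q - 2) - \<gamma> ^ (q - 1) + 1 = 0 \<and> lin_conj q (quadrinomial a b c d) (\<lambda>x. \<gamma> * x ^ (q + 2)))
      \<or> (q mod 3 = 0 \<and> b = 0 \<and> c = 0 \<and> a ^ (q + 1) \<noteq> d ^ (q + 1) \<and>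
         (\<forall>x::'a. x \<noteq> 0 \<longrightarrow> a * x ^ (3 * q - 1) + d * x ^ 2 + 1 \<noteq> 0))"
proof -
  interpret cubic_complete_mapping q p k K "quadrinomial a b c d"
    by unfold_locales (use cm in \<open>simp_all add: cubic_map_quadrinomial complete_mapping_def\<close>)
  show ?thesis
  proof (cases "p = 3")
    case False
    \<comment> \<open>Both values are excluded by \<open>q mod 3 = 2\<close>, which closes the gap
      between 2 and the bound \<open>q > 4\<close>.\<close>
    have "q \<noteq> 3" "q \<noteq> 4" using q_mod_3[OF False] by auto
    then consider "q = 2" | "q > 4" using q_ge_2 by linarith
    then show ?thesis using conj_q_2[OF _ cm] conj_not_char_3[OF False] by cases auto
  next
    case p: True
    show ?thesis
    proof (cases "\<forall>x y. quadrinomial a b c d (x + y) = quadrinomial a b c d x + quadrinomial a b c d y")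
      case True
      then have bc: "b = 0" "c = 0" using additive_quadrinomial[OF p] by blast+
      have "q mod 3 = 0" using p k_pos by (simp add: q_eq)
      moreover have "a ^ (q + 1) \<noteq> d ^ (q + 1)"
      proof
        assume "a ^ (q + 1) = d ^ (q + 1)"
        then obtain y where y: "y \<noteq> 0" "a * y ^ q + d * y = 0" using linearized_kernel_nontrivial by blast
        have "inj (\<lambda>x::'a. x ^ 3)"
        proof (rule injI)
          fix x y :: 'a assume "x ^ 3 = y ^ 3"
          moreover have "(x - y) ^ 3 = x ^ 3 - y ^ 3 + 3 * (x * y\<^sup>2 - x\<^sup>2 * y)" by algebra
          ultimately have "(x - y) ^ 3 = 0" using of_nat_eq_0_iff[of 3] p by simp
          then show "x = y" by simp
        qed
        then have "surj (\<lambda>x::'a. x ^ 3)" by (simp add: finite_UNIV_inj_surj)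
        then obtain x where x: "y = x ^ 3" by (rule surjE)
        have "quadrinomial a b c d x = 0" using y(2) by (simp add: quadrinomial_eq bc x frob_power)
        then have "x = 0" using f_eq_iff[of x 0] f_0 by simp
        then show False using y(1) x by simp
      qed
      moreover have "a * x ^ (3 * q - 1) + d * x ^ 2 + 1 \<noteq> 0" if x: "x \<noteq> 0" for x
      proof
        assume 0: "a * x ^ (3 * q - 1) + d * x ^ 2 + 1 = 0"
        have "3 * q = Suc (3 * q - 1)" using q_ge_2 by simp
        then have "x ^ (3 * q) = x * x ^ (3 * q - 1)" by (metis power_Suc)
        then have "quadrinomial a b c d x + x = x * (a * x ^ (3 * q - 1) + d * x ^ 2 + 1)"
          by (simp add: quadrinomial_def bc algebra_simps power2_eq_square power3_eq_cube)
        then have "quadrinomial a b c d x + x = quadrinomial a b c d 0 + 0" using 0 f_0 by simp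
        then have "x = 0" by (rule injD[OF bij_is_inj[OF bij_f_id]])
        then show False using x by simp
      qed
      ultimately show ?thesis using bc by blast
    next
      case False
      then show ?thesis using char_3_additive_or_conj[OF p] by blast
    qed
  qed
qed

end

theorem theorem1p1:
  fixes q :: nat and a b c d :: "'a::{finite,field}"
  assumes "prime_power q" and "CARD('a) = q ^ 2"
  shows "complete_mapping (\<lambda>x. a * x ^ (3 * q) + b * x ^ (2 * q + 1) + c * x ^ (q + 2) + d * x ^ 3)
     \<longleftrightarrow>
     ((\<exists>\<gamma>::'a. \<gamma> \<noteq> 0 \<and> \<gamma> ^ (2 * q - 2) - \<gamma> ^ (q - 1) + 1 = 0 \<and>
         lin_conj q (\<lambda>x. a * x ^ (3 * q) + b * x ^ (2 * q + 1) + c * x ^ (q + 2) + d * x ^ 3)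
                    (\<lambda>x. \<gamma> * x ^ (q + 2)))
      \<or> (q mod 3 = 0 \<and> b = 0 \<and> c = 0 \<and> a ^ (q + 1) \<noteq> d ^ (q + 1) \<and>
         (\<forall>x::'a. x \<noteq> 0 \<longrightarrow> a * x ^ (3 * q - 1) + d * x ^ 2 + 1 \<noteq> 0)))"
proof -
  obtain p k where "prime p" "k > 0" "q = p ^ k" using assms(1) unfolding prime_power_def by blast
  then interpret quadratic_extension q p k "{x::'a. x ^ q = x}"
    using assms(2) by unfold_locales auto
  have "(\<lambda>x. a * x ^ (3 * q) + b * x ^ (2 * q + 1) + c * x ^ (q + 2) + d * x ^ 3) = quadrinomial a b c d"
    by (simp add: quadrinomial_def fun_eq_iff)
  then show ?thesis
    using complete_quadrinomial_imp[of a b c d] complete_mapping_lin_conj[of "quadrinomial a b c d"]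
      complete_mapping_norm_monomial complete_mapping_char_3[of a d]
    by auto
qed

end
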